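(* For every successor ordinal $\alpha<\omega^\omega+1$ there exists an elementary group $G$ with decomposition rank $\xi(G)=\alpha$; moreover there exists an elementary group with decomposition rank $\omega^\omega+1$.
   Context: All groups are totally disconnected, locally compact, second countable (t.d.l.c.s.c.) topological groups. A topological group is compactly generated if it is generated (as an abstract group) by a compact subset. The class $\mathcal{E}$ of elementary groups is the smallest class of t.d.l.c.s.c. groups such that: (i) $\mathcal{E}$ contains all second countable profinite groups and all countable discrete groups; (ii) $\mathcal{E}$ is closed under group extensions (if $N$ is a closed normal subgroup of a t.d.l.c.s.c. group $H$ with $N\in\mathcal{E}$ and $H/N\in\mathcal{E}$ then $H\in\mathcal{E}$); (iii) $\mathcal{E}$ is closed under closed subgroups; (iv) $\mathcal{E}$ is closed under quotients by closed normal subgroups; (v) if a t.d.l.c.s.c. group $G$ is the union of an increasing sequence of open subgroups $O_i\in\mathcal{E}$, $i\in\mathbb{N}$, then $G\in\mathcal{E}$. The discrete residual $\mathrm{Res}(G)$ is the intersection of all open normal subgroups of $G$. The decomposition rank $\xi:\mathcal{E}\to[1,\omega_1)$ is the (well-defined) ordinal-valued function with: (i) $\xi(\{1\})=1$; (ii) if $G$ is non-trivial and compactly generated, $\xi(G)=\xi(\mathrm{Res}(G))+1$; (iii) if $G$ is non-trivial and $(O_i)_{i\in\mathbb{N}}$ is any increasing sequence of compactly generated open subgroups with union $G$, then $\xi(G)=\sup_{i}\xi(\mathrm{Res}(O_i))+1$ (such sequences always exist and the value does not depend on the choice). *)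

theory Defs
  imports "HOL-Analysis.Analysis" "HOL-Algebra.Algebra" "HOL-Library.Countable_Set_Type"
begin

section \<open>Countable ordinals\<close>

text \<open>
  \<^term>\<open>cardSuc natLeq\<close> is a well-order whose order type is the first uncountable ordinal, so its
  elements, in order, represent exactly the countable ordinals.
\<close>

typedef countable_ord = "Field (cardSuc natLeq)"
  morphisms rep_ord abs_ord
proof -
  have "infinite (Field (cardSuc natLeq))"
    by (metis Field_natLeq cardSuc_finite infinite_UNIV_nat natLeq_Card_order)
  then show ?thesis
    by (metis equals0I finite.emptyI)
qed

instantiation countable_ord :: wellorder
begin

definition less_eq_countable_ord :: "countable_ord \<Rightarrow> countable_ord \<Rightarrow> bool"
  where "a \<le> b \<longleftrightarrow> (rep_ord a, rep_ord b) \<in> cardSuc natLeq"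

definition less_countable_ord :: "countable_ord \<Rightarrow> countable_ord \<Rightarrow> bool"
  where "(a :: countable_ord) < b \<longleftrightarrow> a \<le> b \<and> a \<noteq> b"

instance
proof -
  have W: "Well_order (cardSuc natLeq)"
    using cardSuc_Card_order[OF natLeq_Card_order] by (simp add: card_order_on_well_order_on)
  then have L: "Linear_order (cardSuc natLeq)" and wf: "wf (cardSuc natLeq - Id)"
    by (auto simp: well_order_on_def)
  then have P: "Preorder (cardSuc natLeq)" "antisym (cardSuc natLeq)" "Total (cardSuc natLeq)"
    by (auto simp: linear_order_on_def partial_order_on_def)
  then have R: "refl_on (Field (cardSuc natLeq)) (cardSuc natLeq)" "trans (cardSuc natLeq)"
    by (auto simp: preorder_on_def)
  have antisym: "a = b" if "a \<le> b" "b \<le> a" for a b :: countable_ord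
    using that P(2) unfolding less_eq_countable_ord_def
    by (meson antisymD rep_ord_inject)
  have total: "a \<le> b \<or> b \<le> a" for a b :: countable_ord
    using P(3) R(1) rep_ord[of a] rep_ord[of b] unfolding less_eq_countable_ord_def total_on_def
    by (metis refl_onD)
  have wf': "wf {(a, b). a < (b :: countable_ord)}"
    by (rule wf_subset[OF wf_inv_image[OF wf, of rep_ord]])
      (auto simp: less_countable_ord_def less_eq_countable_ord_def rep_ord_inject)
  show "OFCLASS(countable_ord, wellorder_class)"
  proof
    fix a b c :: countable_ord
    show "a < b \<longleftrightarrow> a \<le> b \<and> \<not> b \<le> a"
      using antisym total by (auto simp: less_countable_ord_def)
    show "a \<le> a" using total[of a a] by simp
    show "a \<le> c" if "a \<le> b" "b \<le> c"
      using that R(2) unfolding less_eq_countable_ord_def by (meson transD)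
    show "a = b" if "a \<le> b" "b \<le> a" using antisym that .
    show "a \<le> b \<or> b \<le> a" by (rule total)
    show "Q a" if "\<And>x. (\<And>y. y < x \<Longrightarrow> Q y) \<Longrightarrow> Q x" for Q
      using wf' by (rule wf_induct_rule) (auto intro: that)
  qed
qed

end

instantiation countable_ord :: conditionally_complete_linorder
begin

definition inf_countable_ord :: "countable_ord \<Rightarrow> countable_ord \<Rightarrow> countable_ord"
  where "inf_countable_ord = min"

definition sup_countable_ord :: "countable_ord \<Rightarrow> countable_ord \<Rightarrow> countable_ord"
  where "sup_countable_ord = max"

definition Inf_countable_ord :: "countable_ord set \<Rightarrow> countable_ord"
  where "Inf A = (LEAST x :: countable_ord. x \<in> A)"

definition Sup_countable_ord :: "countable_ord set \<Rightarrow> countable_ord"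
  where "Sup A = (LEAST u :: countable_ord. \<forall>x\<in>A. x \<le> u)"

instance
proof
  fix a b c :: countable_ord and A :: "countable_ord set"
  show "Inf A \<le> a" if "a \<in> A" "bdd_below A"
    using that(1) by (simp add: Inf_countable_ord_def Least_le)
  show "c \<le> Inf A" if "A \<noteq> {}" "\<And>x. x \<in> A \<Longrightarrow> c \<le> x"
    using that unfolding Inf_countable_ord_def by (metis LeastI ex_in_conv)
  show "a \<le> Sup A" if A: "a \<in> A" "bdd_above A"
  proof -
    obtain u where "\<forall>x\<in>A. x \<le> u" using A(2) by (auto simp: bdd_above_def)
    then have "\<forall>x\<in>A. x \<le> Sup A"
      unfolding Sup_countable_ord_def by (rule LeastI)
    with A(1) show ?thesis by blast
  qed
  show "Sup A \<le> c" if "A \<noteq> {}" "\<And>x. x \<in> A \<Longrightarrow> x \<le> c"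
    using that unfolding Sup_countable_ord_def by (simp add: Least_le)
qed (auto simp: inf_countable_ord_def sup_countable_ord_def)

end

lemma countable_ord_bdd_above:
  fixes A :: "countable_ord set"
  assumes "countable A"
  shows "bdd_above A"
proof -
  let ?r = "cardSuc natLeq"
  have W: "Well_order ?r"
    using cardSuc_Card_order[OF natLeq_Card_order] by (simp add: card_order_on_well_order_on)
  have trans: "trans ?r" and refl: "refl_on (Field ?r) ?r"
    using W by (auto simp: order_on_defs)
  have chain: "relChain ?r (\<lambda>i. {x. (x, i) \<in> ?r})"
    using trans by (auto simp: relChain_def dest: transD)
  have sub: "rep_ord ` A \<subseteq> (\<Union>i \<in> Field ?r. {x. (x, i) \<in> ?r})"
    using refl rep_ord by (auto dest: refl_onD)
  have "|rep_ord ` A| \<le>o natLeq"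
    using assms countable_card_le_natLeq countable_image by blast
  then obtain i where i: "i \<in> Field ?r" "rep_ord ` A \<subseteq> {x. (x, i) \<in> ?r}"
    using cardSuc_UNION[OF natLeq_Card_order _ chain sub] by (auto simp: Field_natLeq)
  then have "\<forall>a\<in>A. a \<le> abs_ord i"
    by (auto simp: less_eq_countable_ord_def abs_ord_inverse)
  then show ?thesis by (auto simp: bdd_above_def)
qed

lemma countable_ord_lessThan:
  fixes a :: countable_ord
  shows "countable {..<a}"
proof -
  let ?r = "cardSuc natLeq"
  have C: "Card_order ?r" using cardSuc_Card_order[OF natLeq_Card_order] .
  have "rep_ord ` {..<a} \<subseteq> underS ?r (rep_ord a)"
    by (auto simp: underS_def less_countable_ord_def less_eq_countable_ord_def rep_ord_inject)
  moreover have "|underS ?r (rep_ord a)| <o ?r"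
    using C rep_ord by (rule card_of_underS)
  then have "|underS ?r (rep_ord a)| \<le>o natLeq"
    using cardSuc_ordLeq_ordLess[OF natLeq_Card_order card_of_Card_order] by blast
  then have "countable (underS ?r (rep_ord a))"
    by (simp add: countable_card_le_natLeq)
  ultimately have "countable (rep_ord ` {..<a})" by (rule countable_subset)
  then show ?thesis
    by (rule countable_image_inj_on) (auto simp: inj_on_def rep_ord_inject)
qed

lemma countable_ord_no_top: "\<exists>b. a < (b :: countable_ord)"
proof (rule ccontr)
  assume "\<not> ?thesis"
  then have "UNIV = insert a {..<a}" by (auto simp: not_less order_le_less)
  then have "countable (UNIV :: countable_ord set)"
    by (metis countable_insert countable_ord_lessThan)
  then have "countable (Field (cardSuc natLeq))"
    by (metis countable_image type_definition.Rep_range type_definition_countable_ord)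
  then have "|Field (cardSuc natLeq)| \<le>o natLeq"
    by (simp add: countable_card_le_natLeq)
  then have "cardSuc natLeq \<le>o natLeq"
    by (meson card_of_Field_ordIso cardSuc_Card_order natLeq_Card_order ordIso_ordLeq_trans
        ordIso_symmetric)
  then show False
    using cardSuc_greater[OF natLeq_Card_order] not_ordLess_ordLeq by blast
qed

definition ord_succ :: "countable_ord \<Rightarrow> countable_ord"
  where "ord_succ a = (LEAST b. a < b)"

lemma ord_succ_greater: "a < ord_succ a"
  unfolding ord_succ_def by (rule LeastI_ex) (rule countable_ord_no_top)

lemma ord_succ_le_iff: "ord_succ a \<le> b \<longleftrightarrow> a < b"
  using ord_succ_greater[of a] by (auto simp: ord_succ_def Least_le)

text \<open>
  Ordinal arithmetic by transfinite recursion on the right argument. In each case one equation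
  covers the zero, successor and limit cases, which are recovered as lemmas below.
\<close>

function ord_add :: "countable_ord \<Rightarrow> countable_ord \<Rightarrow> countable_ord"
  where "ord_add a b = Sup (insert a ((\<lambda>c. ord_succ (ord_add a c)) ` {..<b}))"
  by auto
termination
  by (relation "inv_image {(x, y). x < y} snd") (auto simp: wf)

declare ord_add.simps [simp del]

instantiation countable_ord :: "{zero, one, plus}"
begin

definition zero_countable_ord :: countable_ord
  where "0 = (LEAST a :: countable_ord. True)"

definition one_countable_ord :: countable_ord
  where "1 = ord_succ 0"

definition plus_countable_ord :: "countable_ord \<Rightarrow> countable_ord \<Rightarrow> countable_ord"
  where "a + b = ord_add a b"

instance ..

end

function ord_mult :: "countable_ord \<Rightarrow> countable_ord \<Rightarrow> countable_ord"
  where "ord_mult a b = Sup (insert 0 ((\<lambda>c. ord_mult a c + a) ` {..<b}))"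
  by auto
termination
  by (relation "inv_image {(x, y). x < y} snd") (auto simp: wf)

declare ord_mult.simps [simp del]

text \<open>The base is meant to be nonzero: this gives \<open>ord_power 0 b = 1\<close> for every \<open>b\<close>.\<close>

function ord_power :: "countable_ord \<Rightarrow> countable_ord \<Rightarrow> countable_ord"
  where "ord_power a b = Sup (insert 1 ((\<lambda>c. ord_mult (ord_power a c) a) ` {..<b}))"
  by auto
termination
  by (relation "inv_image {(x, y). x < y} snd") (auto simp: wf)

declare ord_power.simps [simp del]

definition ord_omega :: countable_ord
  where "ord_omega = (SUP n :: nat. (ord_succ ^^ n) 0)"

definition successor_ord :: "countable_ord \<Rightarrow> bool"
  where "successor_ord a \<longleftrightarrow> (\<exists>b. a = b + 1)"

lemma zero_le_ord [simp]: "0 \<le> (a :: countable_ord)"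
  by (simp add: zero_countable_ord_def Least_le)

lemma lessThan_zero_ord [simp]: "{..<0 :: countable_ord} = {}"
  using zero_le_ord leD by blast

lemma less_ord_succ_iff: "a < ord_succ b \<longleftrightarrow> a \<le> b"
  using ord_succ_le_iff[of b a] by (simp only: not_less[symmetric]) blast

lemma ord_Sup_le_iff:
  fixes A :: "countable_ord set"
  assumes "countable A" "A \<noteq> {}"
  shows "Sup A \<le> u \<longleftrightarrow> (\<forall>a\<in>A. a \<le> u)"
  using assms by (simp add: cSup_le_iff countable_ord_bdd_above)

lemma ord_recursion_le_iff:
  "Sup (insert z (f ` {..<b})) \<le> u \<longleftrightarrow> z \<le> u \<and> (\<forall>c<b. f c \<le> u)"
    for f :: "countable_ord \<Rightarrow> countable_ord"
  by (subst ord_Sup_le_iff) (auto simp: countable_ord_lessThan)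

lemma ord_add_le_iff: "a + b \<le> u \<longleftrightarrow> a \<le> u \<and> (\<forall>c<b. ord_succ (a + c) \<le> u)"
  unfolding plus_countable_ord_def by (subst ord_add.simps) (rule ord_recursion_le_iff)

lemma ord_mult_le_iff: "ord_mult a b \<le> u \<longleftrightarrow> (\<forall>c<b. ord_mult a c + a \<le> u)"
  by (subst ord_mult.simps) (simp only: ord_recursion_le_iff zero_le_ord simp_thms)

lemma ord_power_le_iff: "ord_power a b \<le> u \<longleftrightarrow> 1 \<le> u \<and> (\<forall>c<b. ord_mult (ord_power a c) a \<le> u)"
  by (subst ord_power.simps) (rule ord_recursion_le_iff)

lemma ord_add_0: "a + 0 = (a :: countable_ord)"
  unfolding plus_countable_ord_def by (subst ord_add.simps) simp

lemma ord_mult_0: "ord_mult a 0 = 0"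
  by (subst ord_mult.simps) simp

lemma ord_power_0: "ord_power a 0 = 1"
  by (subst ord_power.simps) simp

lemma ord_add_mono_right: "b \<le> c \<Longrightarrow> a + b \<le> a + (c :: countable_ord)"
  using order_refl[of "a + c"] unfolding ord_add_le_iff by (meson less_le_trans)

lemma ord_add_succ: "a + ord_succ b = ord_succ (a + b)"
proof (rule antisym)
  have "ord_succ (a + c) \<le> ord_succ (a + b)" if "c \<le> b" for c
    using ord_add_mono_right[OF that] by (simp add: ord_succ_le_iff less_ord_succ_iff)
  moreover have "a \<le> ord_succ (a + b)"
    using ord_add_mono_right[of 0 b a] ord_succ_greater[of "a + b"] by (simp add: ord_add_0)
  ultimately show "a + ord_succ b \<le> ord_succ (a + b)"
    by (simp add: ord_add_le_iff[of _ "ord_succ b"] less_ord_succ_iff)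
  show "ord_succ (a + b) \<le> a + ord_succ b"
    using order_refl[of "a + ord_succ b"] unfolding ord_add_le_iff[of a "ord_succ b"]
    by (simp add: ord_succ_greater)
qed

lemma ord_add_1: "a + 1 = ord_succ a"
  by (simp add: one_countable_ord_def ord_add_succ ord_add_0)

lemma ord_mult_succ: "ord_mult a (ord_succ b) = ord_mult a b + a"
proof (rule antisym)
  have "ord_mult a c + a \<le> ord_mult a b + a" if "c < b" for c
  proof -
    have "ord_mult a c + a \<le> ord_mult a b"
      using order_refl[of "ord_mult a b"] that unfolding ord_mult_le_iff[of a b] by blast
    also have "\<dots> \<le> ord_mult a b + a"
      using ord_add_mono_right[of 0 a "ord_mult a b"] by (simp add: ord_add_0)
    finally show ?thesis .
  qed
  then show "ord_mult a (ord_succ b) \<le> ord_mult a b + a"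
    unfolding ord_mult_le_iff[of a "ord_succ b"] less_ord_succ_iff by (metis order_le_less)
  show "ord_mult a b + a \<le> ord_mult a (ord_succ b)"
    using order_refl[of "ord_mult a (ord_succ b)"] unfolding ord_mult_le_iff[of a "ord_succ b"]
    by (simp add: ord_succ_greater)
qed

lemma ord_add_limit:
  assumes "0 < b" "\<And>c. c < b \<Longrightarrow> ord_succ c < b"
  shows "a + b = (SUP c\<in>{..<b}. a + c)"
proof (rule antisym)
  have bdd: "bdd_above ((\<lambda>c. a + c) ` {..<b})"
    by (simp add: countable_ord_bdd_above countable_ord_lessThan)
  show "a + b \<le> (SUP c\<in>{..<b}. a + c)"
    unfolding ord_add_le_iff[of a b]
    using cSUP_upper[OF _ bdd] assms ord_add_0[of a] by (metis lessThan_iff ord_add_succ)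
  show "(SUP c\<in>{..<b}. a + c) \<le> a + b"
    using assms(1) by (intro cSUP_least) (auto intro: ord_add_mono_right)
qed

lemma ord_mult_mono_right: "b \<le> c \<Longrightarrow> ord_mult a b \<le> ord_mult a c"
  using order_refl[of "ord_mult a c"] unfolding ord_mult_le_iff by (meson less_le_trans)

lemma ord_mult_limit:
  assumes "0 < b" "\<And>c. c < b \<Longrightarrow> ord_succ c < b"
  shows "ord_mult a b = (SUP c\<in>{..<b}. ord_mult a c)"
proof (rule antisym)
  have bdd: "bdd_above (ord_mult a ` {..<b})"
    by (simp add: countable_ord_bdd_above countable_ord_lessThan)
  show "ord_mult a b \<le> (SUP c\<in>{..<b}. ord_mult a c)"
    unfolding ord_mult_le_iff[of a b]
    using cSUP_upper[OF _ bdd] assms by (metis lessThan_iff ord_mult_succ)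
  show "(SUP c\<in>{..<b}. ord_mult a c) \<le> ord_mult a b"
    using assms(1) by (intro cSUP_least) (auto intro: ord_mult_mono_right)
qed

lemma ord_power_mono_right: "b \<le> c \<Longrightarrow> ord_power a b \<le> ord_power a c"
  using order_refl[of "ord_power a c"] unfolding ord_power_le_iff by (meson less_le_trans)

lemma ord_zero_add: "0 + a = (a :: countable_ord)"
proof (induction a rule: less_induct)
  case (less a)
  then have "0 + a \<le> u \<longleftrightarrow> (\<forall>c<a. c < u)" for u
    by (simp add: ord_add_le_iff[of 0 a] ord_succ_le_iff)
  then have "0 + a \<le> u \<longleftrightarrow> a \<le> u" for u
    by (meson less_le_trans not_le order_less_irrefl)
  then show ?case by (meson antisym order_refl)
qed

lemma ord_mult_1: "ord_mult a 1 = a"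
  by (simp add: one_countable_ord_def ord_mult_succ ord_mult_0 ord_zero_add)

lemma ord_zero_less_iff: "0 < a \<longleftrightarrow> 1 \<le> (a :: countable_ord)"
  by (simp add: one_countable_ord_def ord_succ_le_iff)

lemma ord_power_succ:
  assumes "0 < a"
  shows "ord_power a (ord_succ b) = ord_mult (ord_power a b) a"
proof (rule antisym)
  have *: "x \<le> ord_mult x a" for x
    using ord_mult_mono_right[of 1 a x] assms by (simp add: ord_zero_less_iff ord_mult_1)
  have "ord_mult (ord_power a c) a \<le> ord_mult (ord_power a b) a" if "c < b" for c
  proof -
    have "ord_mult (ord_power a c) a \<le> ord_power a b"
      using order_refl[of "ord_power a b"] that unfolding ord_power_le_iff[of a b] by blast
    then show ?thesis using * order_trans by blast
  qed
  moreover have "1 \<le> ord_mult (ord_power a b) a"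
    using order_refl[of "ord_power a b"] * order_trans unfolding ord_power_le_iff[of a b] by blast
  ultimately show "ord_power a (ord_succ b) \<le> ord_mult (ord_power a b) a"
    unfolding ord_power_le_iff[of a "ord_succ b"] less_ord_succ_iff by (metis order_le_less)
  show "ord_mult (ord_power a b) a \<le> ord_power a (ord_succ b)"
    using order_refl[of "ord_power a (ord_succ b)"] unfolding ord_power_le_iff[of a "ord_succ b"]
    by (simp add: ord_succ_greater)
qed

lemma ord_power_limit:
  assumes "0 < a" "0 < b" "\<And>c. c < b \<Longrightarrow> ord_succ c < b"
  shows "ord_power a b = (SUP c\<in>{..<b}. ord_power a c)"
proof (rule antisym)
  have bdd: "bdd_above (ord_power a ` {..<b})"
    by (simp add: countable_ord_bdd_above countable_ord_lessThan)
  show "ord_power a b \<le> (SUP c\<in>{..<b}. ord_power a c)"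
    unfolding ord_power_le_iff[of a b]
    using cSUP_upper[OF _ bdd] assms by (metis lessThan_iff ord_power_succ ord_power_0)
  show "(SUP c\<in>{..<b}. ord_power a c) \<le> ord_power a b"
    using assms(2) by (intro cSUP_least) (auto intro: ord_power_mono_right)
qed

lemma ord_omega_limit:
  "0 < ord_omega" "c < ord_omega \<Longrightarrow> ord_succ c < ord_omega"
proof -
  have bdd: "bdd_above (range (\<lambda>n :: nat. (ord_succ ^^ n) 0))"
    by (simp add: countable_ord_bdd_above)
  have less: "(ord_succ ^^ n) 0 < ord_omega" for n
    using cSUP_upper[OF UNIV_I bdd, of "Suc n"] ord_succ_greater[of "(ord_succ ^^ n) 0"]
    unfolding ord_omega_def by simp
  show "0 < ord_omega" using less[of 0] by simp
  assume "c < ord_omega"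
  then obtain n where "c < (ord_succ ^^ n) 0"
    unfolding ord_omega_def using less_cSUP_iff[OF _ bdd] by auto
  then have "ord_succ c \<le> (ord_succ ^^ n) 0" by (simp add: ord_succ_le_iff)
  then show "ord_succ c < ord_omega" using less le_less_trans by blast
qed

lemma ord_omega_least:
  assumes "0 < b" "\<And>c. c < b \<Longrightarrow> ord_succ c < b"
  shows "ord_omega \<le> b"
proof -
  have "(ord_succ ^^ n) 0 < b" for n :: nat
    using assms by (induction n) auto
  then show ?thesis
    unfolding ord_omega_def by (intro cSUP_least) (auto intro: less_imp_le)
qed


section \<open>Totally disconnected locally compact second countable groups\<close>

locale topological_group = group G for G :: "('a, 'b) monoid_scheme" (structure) +
  fixes T :: "'a topology"
  assumes topspace_eq_carrier: "topspace T = carrier G"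
    and continuous_map_mult: "continuous_map (prod_topology T T) T (\<lambda>(x, y). x \<otimes> y)"
    and continuous_map_inv: "continuous_map T T (\<lambda>x. inv x)"

locale tdlcsc_group = topological_group +
  assumes Hausdorff: "Hausdorff_space T"
    and totally_disconnected: "connectedin T C \<Longrightarrow> \<exists>x. C \<subseteq> {x}"
    and locally_compact: "locally_compact_space T"
    and second_countable: "second_countable T"

definition topological_group_iso ::
    "('a, 'c) monoid_scheme \<Rightarrow> 'a topology \<Rightarrow> ('b, 'd) monoid_scheme \<Rightarrow> 'b topology \<Rightarrow> bool"
  where "topological_group_iso G T G' T' \<longleftrightarrow> (\<exists>h. h \<in> iso G G' \<and> homeomorphic_map T T' h)"

text \<open>
  The quotient topology on the set of cosets of \<open>N\<close>: the preimage of a set \<open>W\<close> of cosets under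
  the canonical map is the union of \<open>W\<close>.
\<close>

definition coset_topology :: "('a, 'b) monoid_scheme \<Rightarrow> 'a topology \<Rightarrow> 'a set \<Rightarrow> 'a set topology"
  where "coset_topology G T N = topology (\<lambda>W. W \<subseteq> rcosets\<^bsub>G\<^esub> N \<and> openin T (\<Union>W))"

lemma (in topological_group) coset_partition:
  assumes "subgroup N G" "x \<in> carrier G" "W \<subseteq> rcosets N"
  shows "N #> x \<in> W \<longleftrightarrow> x \<in> \<Union>W"
proof
  assume "N #> x \<in> W"
  then show "x \<in> \<Union>W" using rcos_self[OF assms(2,1)] by blast
next
  assume "x \<in> \<Union>W"
  then obtain w where w: "w \<in> W" "x \<in> w" by blast
  then obtain y where "y \<in> carrier G" "w = N #> y" using assms(3) by (auto simp: RCOSETS_def)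
  with w show "N #> x \<in> W" using repr_independence[of x N y] assms(1) by simp
qed

lemma (in topological_group) openin_coset_topology:
  assumes "subgroup N G"
  shows "openin (coset_topology G T N) W \<longleftrightarrow> W \<subseteq> rcosets N \<and> openin T (\<Union>W)"
proof -
  have "\<Union>(V \<inter> W) = \<Union>V \<inter> \<Union>W" if "V \<subseteq> rcosets N" "W \<subseteq> rcosets N" for V W
  proof
    show "\<Union>V \<inter> \<Union>W \<subseteq> \<Union>(V \<inter> W)"
    proof
      fix x assume x: "x \<in> \<Union>V \<inter> \<Union>W"
      then have "x \<in> carrier G"
        using that(1) assms rcosets_part_G by blast
      with x have "N #> x \<in> V \<inter> W"
        using coset_partition[OF assms] that by blast
      then show "x \<in> \<Union>(V \<inter> W)" using rcos_self[OF \<open>x \<in> carrier G\<close> assms] by blast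
    qed
  qed blast
  then have "istopology (\<lambda>W. W \<subseteq> rcosets N \<and> openin T (\<Union>W))"
    unfolding istopology_def
  proof (intro conjI allI impI)
    fix \<K> assume K: "\<forall>W\<in>\<K>. W \<subseteq> rcosets N \<and> openin T (\<Union>W)"
    then show "\<Union>\<K> \<subseteq> rcosets N" by blast
    have "\<Union>(\<Union>\<K>) = \<Union>(Union ` \<K>)" by blast
    also have "openin T \<dots>" using K by blast
    finally show "openin T (\<Union>(\<Union>\<K>))" .
  qed auto
  then show ?thesis by (simp add: coset_topology_def topology_inverse')
qed

lemma (in topological_group) quotient_map_coset_topology:
  assumes "subgroup N G"
  shows "quotient_map T (coset_topology G T N) (\<lambda>x. N #> x)"
proof -
  have un: "\<Union>(rcosets N) = topspace T"
    using rcosets_part_G[OF assms] by (simp add: topspace_eq_carrier)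
  have "openin (coset_topology G T N) (rcosets N)"
    by (simp add: openin_coset_topology[OF assms] un)
  then have top: "topspace (coset_topology G T N) = rcosets N"
    by (metis openin_coset_topology[OF assms] openin_subset openin_topspace subset_antisym)
  have "{x \<in> carrier G. N #> x \<in> W} = \<Union>W" if "W \<subseteq> rcosets N" for W
  proof -
    have "\<Union>W \<subseteq> carrier G" using that un topspace_eq_carrier by blast
    then show ?thesis using coset_partition[OF assms _ that] by blast
  qed
  moreover have "(\<lambda>x. N #> x) ` carrier G = rcosets N"
    by (auto simp: RCOSETS_def)
  ultimately show ?thesis
    by (simp add: quotient_map_def top topspace_eq_carrier openin_coset_topology[OF assms])
qed


section \<open>Elementary groups\<close>

text \<open>
  Every second countable Hausdorff space has at most continuum many points, so every t.d.l.c.s.c.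
  group is isomorphic to one whose carrier is a set of functions \<^typ>\<open>nat \<Rightarrow> nat\<close>. The class of
  elementary groups is defined within this universe; quotients, whose elements are cosets, enter
  through their isomorphic copies. Taking \<open>N\<close> trivial in the rule \<open>quotient\<close> shows that the class is
  closed under isomorphism. A profinite group is a compact totally disconnected group.
\<close>

inductive elementary :: "(nat \<Rightarrow> nat) monoid \<Rightarrow> (nat \<Rightarrow> nat) topology \<Rightarrow> bool"
  where
    profinite: "tdlcsc_group G T \<Longrightarrow> compact_space T \<Longrightarrow> elementary G T"
  | discrete: "group G \<Longrightarrow> countable (carrier G) \<Longrightarrow> T = discrete_topology (carrier G) \<Longrightarrow> elementary G T"
  | extension:
      "tdlcsc_group H T \<Longrightarrow> N \<lhd> H \<Longrightarrow> closedin T N \<Longrightarrow>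
       elementary (H\<lparr>carrier := N\<rparr>) (subtopology T N) \<Longrightarrow>
       elementary Q T' \<Longrightarrow> topological_group_iso (H Mod N) (coset_topology H T N) Q T' \<Longrightarrow>
       elementary H T"
  | closed_subgroup:
      "elementary G T \<Longrightarrow> subgroup H G \<Longrightarrow> closedin T H \<Longrightarrow>
       elementary (G\<lparr>carrier := H\<rparr>) (subtopology T H)"
  | quotient:
      "elementary G T \<Longrightarrow> N \<lhd> G \<Longrightarrow> closedin T N \<Longrightarrow>
       tdlcsc_group Q T' \<Longrightarrow> topological_group_iso (G Mod N) (coset_topology G T N) Q T' \<Longrightarrow>
       elementary Q T'"
  | increasing_union:
      "tdlcsc_group G T \<Longrightarrow>
       (\<And>i :: nat. subgroup (U i) G \<and> openin T (U i) \<and>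
          elementary (G\<lparr>carrier := U i\<rparr>) (subtopology T (U i))) \<Longrightarrow>
       incseq U \<Longrightarrow> (\<Union>i. U i) = carrier G \<Longrightarrow> elementary G T"


section \<open>The decomposition rank\<close>

definition compactly_generated :: "('a, 'b) monoid_scheme \<Rightarrow> 'a topology \<Rightarrow> bool"
  where "compactly_generated G T \<longleftrightarrow> (\<exists>K. compactin T K \<and> generate G K = carrier G)"

definition discrete_residual :: "('a, 'b) monoid_scheme \<Rightarrow> 'a topology \<Rightarrow> 'a set"
  where "discrete_residual G T = \<Inter>{N. N \<lhd> G \<and> openin T N}"

definition residual_in :: "('a, 'b) monoid_scheme \<Rightarrow> 'a topology \<Rightarrow> 'a set \<Rightarrow> 'a set"
  where "residual_in G T H = discrete_residual (G\<lparr>carrier := H\<rparr>) (subtopology T H)"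

definition compactly_generated_exhaustion ::
    "('a, 'b) monoid_scheme \<Rightarrow> 'a topology \<Rightarrow> (nat \<Rightarrow> 'a set) \<Rightarrow> bool"
  where "compactly_generated_exhaustion G T U \<longleftrightarrow>
    incseq U \<and> (\<Union>i. U i) = carrier G \<and>
    (\<forall>i. subgroup (U i) G \<and> openin T (U i) \<and>
         compactly_generated (G\<lparr>carrier := U i\<rparr>) (subtopology T (U i)))"

text \<open>
  The graph of the decomposition rank, as the least relation closed under the three clauses that
  characterise it.
\<close>

inductive has_decomposition_rank :: "'a monoid \<Rightarrow> 'a topology \<Rightarrow> countable_ord \<Rightarrow> bool"
  where
    trivial: "carrier G = {\<one>\<^bsub>G\<^esub>} \<Longrightarrow> has_decomposition_rank G T 1"
  | compactly_generated:
      "carrier G \<noteq> {\<one>\<^bsub>G\<^esub>} \<Longrightarrow> compactly_generated G T \<Longrightarrow>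
       has_decomposition_rank (G\<lparr>carrier := discrete_residual G T\<rparr>)
         (subtopology T (discrete_residual G T)) \<beta> \<Longrightarrow>
       has_decomposition_rank G T (\<beta> + 1)"
  | exhaustion:
      "carrier G \<noteq> {\<one>\<^bsub>G\<^esub>} \<Longrightarrow> compactly_generated_exhaustion G T U \<Longrightarrow>
       (\<And>i. has_decomposition_rank (G\<lparr>carrier := residual_in G T (U i)\<rparr>)
         (subtopology T (residual_in G T (U i))) (\<beta> i)) \<Longrightarrow>
       has_decomposition_rank G T ((SUP i. \<beta> i) + 1)"

definition decomposition_rank :: "'a monoid \<Rightarrow> 'a topology \<Rightarrow> countable_ord"
  where "decomposition_rank G T = (THE \<alpha>. has_decomposition_rank G T \<alpha>)"

text \<open>
  The three clauses as a condition on a function on elementary groups. The theorem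
  \<open>decomposition_rank_eq\<close> below shows that such a function coincides with
  \<^const>\<open>decomposition_rank\<close> on elementary groups.
\<close>

definition satisfies_rank_clauses ::
    "((nat \<Rightarrow> nat) monoid \<Rightarrow> (nat \<Rightarrow> nat) topology \<Rightarrow> countable_ord) \<Rightarrow> bool"
  where "satisfies_rank_clauses \<xi> \<longleftrightarrow>
    (\<forall>G T. elementary G T \<longrightarrow>
      (carrier G = {\<one>\<^bsub>G\<^esub>} \<longrightarrow> \<xi> G T = 1) \<and>
      (carrier G \<noteq> {\<one>\<^bsub>G\<^esub>} \<and> compactly_generated G T \<longrightarrow>
        \<xi> G T = \<xi> (G\<lparr>carrier := discrete_residual G T\<rparr>) (subtopology T (discrete_residual G T)) + 1) \<and>
      (\<forall>U. carrier G \<noteq> {\<one>\<^bsub>G\<^esub>} \<and> compactly_generated_exhaustion G T U \<longrightarrow>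
        \<xi> G T = (SUP i. \<xi> (G\<lparr>carrier := residual_in G T (U i)\<rparr>)
                          (subtopology T (residual_in G T (U i)))) + 1))"

context topological_group
begin

lemma continuous_map_left_mult:
  assumes "a \<in> carrier G"
  shows "continuous_map T T (\<lambda>x. a \<otimes> x)"
proof -
  have "continuous_map T (prod_topology T T) (\<lambda>x. (a, x))"
    using assms by (intro continuous_map_pairedI) (auto simp: topspace_eq_carrier)
  from continuous_map_compose[OF this continuous_map_mult] show ?thesis
    by (simp add: o_def)
qed

lemma openin_left_mult_vimage:
  assumes "a \<in> carrier G" "openin T U"
  shows "openin T {x \<in> carrier G. a \<otimes> x \<in> U}"
  using openin_continuous_map_preimage[OF continuous_map_left_mult[OF assms(1)] assms(2)]
  by (simp add: topspace_eq_carrier)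

lemma topological_group_subgroup:
  assumes "subgroup H G"
  shows "topological_group (G\<lparr>carrier := H\<rparr>) (subtopology T H)"
proof -
  interpret H: group "G\<lparr>carrier := H\<rparr>" using subgroup_imp_group[OF assms] .
  have sub: "H \<subseteq> carrier G" using subgroup.subset[OF assms] .
  show ?thesis
  proof
    show "topspace (subtopology T H) = carrier (G\<lparr>carrier := H\<rparr>)"
      using sub by (auto simp: topspace_eq_carrier)
    have "continuous_map (subtopology (prod_topology T T) (H \<times> H)) T (\<lambda>(x, y). x \<otimes> y)"
      using continuous_map_mult by (rule continuous_map_from_subtopology)
    then show "continuous_map (prod_topology (subtopology T H) (subtopology T H)) (subtopology T H)
        (\<lambda>(x, y). x \<otimes>\<^bsub>G\<lparr>carrier := H\<rparr>\<^esub> y)"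
      unfolding subtopology_Times[symmetric]
      by (auto simp: continuous_map_in_subtopology subgroup.m_closed[OF assms])
    have "continuous_map (subtopology T H) T (\<lambda>x. inv x)"
      using continuous_map_inv by (rule continuous_map_from_subtopology)
    then have "continuous_map (subtopology T H) (subtopology T H) (\<lambda>x. inv x)"
      by (auto simp: continuous_map_in_subtopology subgroup.m_inv_closed[OF assms])
    then show "continuous_map (subtopology T H) (subtopology T H) (\<lambda>x. inv\<^bsub>G\<lparr>carrier := H\<rparr>\<^esub> x)"
      by (rule continuous_map_eq) (simp add: assms)
  qed
qed

lemma open_subgroup_closed:
  assumes "subgroup H G" "openin T H"
  shows "closedin T H"
proof -
  have sub: "H \<subseteq> carrier G" using subgroup.subset[OF assms(1)] .
  have "openin T (carrier G - H)"
  proof (subst openin_subopen, intro ballI)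
    fix x assume x: "x \<in> carrier G - H"
    define V where "V = {y \<in> carrier G. inv x \<otimes> y \<in> H}"
    have "openin T V" unfolding V_def using x assms(2) by (intro openin_left_mult_vimage) auto
    moreover have "x \<in> V" using x by (simp add: V_def subgroup.one_closed[OF assms(1)])
    moreover have "V \<subseteq> carrier G - H"
    proof
      fix y assume "y \<in> V"
      then have y: "y \<in> carrier G" "inv x \<otimes> y \<in> H" by (simp_all add: V_def)
      have "y \<notin> H"
      proof
        assume "y \<in> H"
        then have "inv (inv x \<otimes> y \<otimes> inv y) \<in> H"
          using subgroup.m_closed[OF assms(1)] subgroup.m_inv_closed[OF assms(1)] y(2) by simp
        moreover have "inv (inv x \<otimes> y \<otimes> inv y) = x"
          using x y by (simp add: m_assoc)
        ultimately show False using x by simp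
      qed
      with y(1) show "y \<in> carrier G - H" by simp
    qed
    ultimately show "\<exists>V. openin T V \<and> x \<in> V \<and> V \<subseteq> carrier G - H" by (intro exI conjI)
  qed
  then show ?thesis using sub by (simp add: closedin_def topspace_eq_carrier)
qed

lemma subgroup_open_if_nbhd:
  assumes "subgroup H G" "openin T V" "\<one> \<in> V" "V \<subseteq> H"
  shows "openin T H"
proof (subst openin_subopen, intro ballI)
  fix x assume x: "x \<in> H"
  then have xG: "x \<in> carrier G" using subgroup.subset[OF assms(1)] by blast
  define W where "W = {y \<in> carrier G. inv x \<otimes> y \<in> V}"
  have "openin T W" unfolding W_def using xG assms(2) by (intro openin_left_mult_vimage) auto
  moreover have "x \<in> W" using xG assms(3) by (simp add: W_def)
  moreover have "W \<subseteq> H"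
  proof
    fix y assume "y \<in> W"
    then have y: "y \<in> carrier G" "inv x \<otimes> y \<in> H" using assms(4) by (auto simp: W_def)
    have "x \<otimes> (inv x \<otimes> y) \<in> H"
      using x y(2) by (rule subgroup.m_closed[OF assms(1)])
    then show "y \<in> H" using y(1) xG by (simp add: m_assoc[symmetric])
  qed
  ultimately show "\<exists>W. openin T W \<and> x \<in> W \<and> W \<subseteq> H" by (intro exI conjI)
qed

lemma discrete_residual_subgroup: "subgroup (discrete_residual G T) G"
  and discrete_residual_closed: "closedin T (discrete_residual G T)"
proof -
  have "openin T (carrier G)" using openin_topspace[of T] by (simp add: topspace_eq_carrier)
  moreover have "carrier G \<lhd> G"
    using normal_inv_iff subgroup_self by blast
  ultimately have ne: "{N. N \<lhd> G \<and> openin T N} \<noteq> {}"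
    by auto
  have "subgroup N G \<and> closedin T N" if "N \<lhd> G" "openin T N" for N
    using that normal_imp_subgroup[OF that(1)] open_subgroup_closed[of N] by simp
  then show "subgroup (discrete_residual G T) G" "closedin T (discrete_residual G T)"
    unfolding discrete_residual_def using ne
    by (auto intro!: subgroups_Inter closedin_Inter)
qed

lemma residual_in_subgroup:
  assumes "subgroup H G"
  shows "subgroup (residual_in G T H) G"
  unfolding residual_in_def
  by (rule incl_subgroup[OF assms],
      rule topological_group.discrete_residual_subgroup[OF topological_group_subgroup[OF assms]])

lemma residual_in_closed:
  assumes "subgroup H G" "openin T H"
  shows "closedin T (residual_in G T H)"
  unfolding residual_in_def
  by (rule closedin_trans_full[OF _ open_subgroup_closed[OF assms]],
      rule topological_group.discrete_residual_closed[OF topological_group_subgroup[OF assms(1)]])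

end

lemma (in tdlcsc_group) tdlcsc_group_closed_subgroup:
  assumes "subgroup H G" "closedin T H"
  shows "tdlcsc_group (G\<lparr>carrier := H\<rparr>) (subtopology T H)"
proof -
  have "tdlcsc_group_axioms (subtopology T H)"
  proof
    show "Hausdorff_space (subtopology T H)" using Hausdorff by (rule Hausdorff_space_subtopology)
    show "\<exists>x. C \<subseteq> {x}" if "connectedin (subtopology T H) C" for C
      using that totally_disconnected by (simp add: connectedin_subtopology)
    show "locally_compact_space (subtopology T H)"
      using locally_compact assms(2) by (rule locally_compact_space_closed_subset)
    show "second_countable (subtopology T H)"
      using second_countable by (rule second_countable_subtopology)
  qed
  with topological_group_subgroup[OF assms(1)] show ?thesis by (rule tdlcsc_group.intro)
qed

lemma (in group) tdlcsc_group_discrete: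
  assumes "countable (carrier G)"
  shows "tdlcsc_group G (discrete_topology (carrier G))"
proof
  show "continuous_map (prod_topology (discrete_topology (carrier G)) (discrete_topology (carrier G)))
      (discrete_topology (carrier G)) (\<lambda>(x, y). x \<otimes> y)"
    by (simp add: prod_topology_discrete_topology[symmetric] Pi_def)
  show "\<exists>x. C \<subseteq> {x}" if "connectedin (discrete_topology (carrier G)) C" for C
    using that by (auto simp: connectedin_discrete_topology)
  show "locally_compact_space (discrete_topology (carrier G))"
    by (simp add: locally_compact_space_discrete_topology)
qed (use assms in \<open>auto simp: second_countable_discrete_topology Hausdorff_space_discrete_topology\<close>)

lemma elementary_imp_tdlcsc_group: "elementary G T \<Longrightarrow> tdlcsc_group G T"
  by (induction rule: elementary.induct)
    (simp_all add: group.tdlcsc_group_discrete tdlcsc_group.tdlcsc_group_closed_subgroup)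

lemma elementary_discrete_residual:
  assumes "elementary G T"
  shows "elementary (G\<lparr>carrier := discrete_residual G T\<rparr>) (subtopology T (discrete_residual G T))"
proof -
  interpret tdlcsc_group G T using elementary_imp_tdlcsc_group[OF assms] .
  show ?thesis
    using assms discrete_residual_subgroup discrete_residual_closed by (rule closed_subgroup)
qed

lemma elementary_residual_in:
  assumes "elementary G T" "subgroup H G" "openin T H"
  shows "elementary (G\<lparr>carrier := residual_in G T H\<rparr>) (subtopology T (residual_in G T H))"
proof -
  interpret tdlcsc_group G T using elementary_imp_tdlcsc_group[OF assms(1)] .
  show ?thesis
    using assms(1) residual_in_subgroup[OF assms(2)] residual_in_closed[OF assms(2,3)]
    by (rule closed_subgroup)
qed

lemma (in tdlcsc_group) ex_compactly_generated_exhaustion: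
  "\<exists>U. compactly_generated_exhaustion G T U"
proof -
  obtain V K where V: "openin T V" "compactin T K" "\<one> \<in> V" "V \<subseteq> K"
    using locally_compact one_closed
    unfolding locally_compact_space_def topspace_eq_carrier by meson
  define L where "L x = {y \<in> carrier G. inv x \<otimes> y \<in> V}" for x
  have L: "openin T (L x)" "x \<in> L x" if "x \<in> carrier G" for x
    using that V openin_left_mult_vimage[of "inv x" V] by (simp_all add: L_def)
  have "\<Union>(L ` carrier G) = topspace T"
  proof
    show "\<Union>(L ` carrier G) \<subseteq> topspace T" by (auto simp: topspace_eq_carrier L_def)
    show "topspace T \<subseteq> \<Union>(L ` carrier G)" using L(2) by (auto simp only: topspace_eq_carrier)
  qed
  moreover have "\<forall>W \<in> L ` carrier G. openin T W" using L(1) by blast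
  ultimately obtain \<V> where \<V>: "countable \<V>" "\<V> \<subseteq> L ` carrier G" "\<Union>\<V> = topspace T"
    using second_countable_imp_Lindelof_space[OF second_countable]
    unfolding Lindelof_space_def by meson
  then obtain D where D: "countable D" "D \<subseteq> carrier G" "\<V> = L ` D"
    by (metis countable_subset_image)
  define d where "d = from_nat_into (insert \<one> D)"
  have d: "range d = insert \<one> D" "range d \<subseteq> carrier G"
    using D by (auto simp: d_def range_from_nat_into)
  define S where "S n = K \<union> d ` {..n}" for n :: nat
  define U where "U n = generate G (S n)" for n
  have SG: "S n \<subseteq> carrier G" for n
    using compactin_subset_topspace[OF V(2)] d(2) by (auto simp: S_def topspace_eq_carrier)
  have sub: "subgroup (U n) G" for n
    unfolding U_def using SG by (rule generate_is_subgroup)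
  have SU: "S n \<subseteq> U n" for n
    by (auto simp: U_def intro: generate.incl)
  have "incseq U"
    unfolding incseq_def U_def S_def by (intro allI impI mono_generate) auto
  moreover have "openin T (U n)" for n
    using sub V(1,3) by (rule subgroup_open_if_nbhd) (use V(4) SU in \<open>auto simp: S_def\<close>)
  moreover have "compactly_generated (G\<lparr>carrier := U n\<rparr>) (subtopology T (U n))" for n
  proof -
    have "compactin T (S n)"
      unfolding S_def using d(2)
      by (intro compactin_Un[OF V(2)] finite_imp_compactin) (auto simp: topspace_eq_carrier)
    then have "compactin (subtopology T (U n)) (S n)"
      using SU by (simp add: compactin_subtopology)
    moreover have "generate (G\<lparr>carrier := U n\<rparr>) (S n) = U n"
      using generate_consistent[OF SU sub] by (simp add: U_def)
    ultimately show ?thesis unfolding compactly_generated_def by auto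
  qed
  moreover have "(\<Union>n. U n) = carrier G"
  proof
    show "(\<Union>n. U n) \<subseteq> carrier G" using sub subgroup.subset by blast
    show "carrier G \<subseteq> (\<Union>n. U n)"
    proof
      fix y assume y: "y \<in> carrier G"
      then obtain x where x: "x \<in> D" "inv x \<otimes> y \<in> V"
        using \<V>(3) D(3) by (auto simp: topspace_eq_carrier L_def)
      then obtain n where n: "x = d n" using d(1) by (metis insertI2 rangeE)
      have "x \<in> U n" "inv x \<otimes> y \<in> U n"
        using SU[of n] x(2) V(4) n by (auto simp: S_def)
      then have "x \<otimes> (inv x \<otimes> y) \<in> U n" by (rule subgroup.m_closed[OF sub])
      moreover have "x \<otimes> (inv x \<otimes> y) = y"
        using y x(1) D(2) by (metis inv_closed m_assoc r_inv l_one subsetD)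
      ultimately show "y \<in> (\<Union>n. U n)" by auto
    qed
  qed
  ultimately have "compactly_generated_exhaustion G T U"
    unfolding compactly_generated_exhaustion_def using sub by (intro conjI allI)
  then show ?thesis by (rule exI[of _ U])
qed

lemma has_decomposition_rank_imp_eq:
  assumes "satisfies_rank_clauses \<xi>" "has_decomposition_rank G T \<alpha>" "elementary G T"
  shows "\<xi> G T = \<alpha>"
  using assms(2,3)
proof (induction rule: has_decomposition_rank.induct)
  case (trivial G T)
  then show ?case using assms(1) by (simp add: satisfies_rank_clauses_def)
next
  case (compactly_generated G T \<beta>)
  then show ?case
    using assms(1) elementary_discrete_residual by (simp add: satisfies_rank_clauses_def)
next
  case (exhaustion G T U \<beta>)
  then have "\<xi> (G\<lparr>carrier := residual_in G T (U i)\<rparr>) (subtopology T (residual_in G T (U i))) = \<beta> i" for i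
    using elementary_residual_in by (simp add: compactly_generated_exhaustion_def)
  then show ?case
    using exhaustion.hyps exhaustion.prems assms(1) by (simp add: satisfies_rank_clauses_def)
qed

lemma has_decomposition_rank_if_satisfies_rank_clauses:
  assumes "satisfies_rank_clauses \<xi>" "elementary G T"
  shows "has_decomposition_rank G T (\<xi> G T)"
  using assms(2)
proof (induction "\<xi> G T" arbitrary: G T rule: less_induct)
  case less
  show ?case
  proof (cases "carrier G = {\<one>\<^bsub>G\<^esub>}")
    case True
    then show ?thesis
      using assms(1) less.prems by (simp add: satisfies_rank_clauses_def has_decomposition_rank.trivial)
  next
    case False
    interpret tdlcsc_group G T using elementary_imp_tdlcsc_group[OF less.prems] .
    obtain U where U: "compactly_generated_exhaustion G T U"
      using ex_compactly_generated_exhaustion by blast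
    define R where "R i = G\<lparr>carrier := residual_in G T (U i)\<rparr>" for i
    define S where "S i = subtopology T (residual_in G T (U i))" for i
    have eq: "\<xi> G T = (SUP i. \<xi> (R i) (S i)) + 1"
      using assms(1) less.prems False U by (simp add: satisfies_rank_clauses_def R_def S_def)
    have "\<xi> (R i) (S i) < \<xi> G T" for i
    proof -
      have "\<xi> (R i) (S i) \<le> (SUP i. \<xi> (R i) (S i))"
        by (rule cSUP_upper) (simp_all add: countable_ord_bdd_above)
      then show ?thesis by (simp add: eq ord_add_1 less_ord_succ_iff)
    qed
    moreover have "elementary (R i) (S i)" for i
      using U less.prems elementary_residual_in
      by (simp add: R_def S_def compactly_generated_exhaustion_def)
    ultimately have "has_decomposition_rank (R i) (S i) (\<xi> (R i) (S i))" for i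
      by (rule less.hyps)
    then have "has_decomposition_rank G T ((SUP i. \<xi> (R i) (S i)) + 1)"
      using False U by (intro has_decomposition_rank.exhaustion) (auto simp: R_def S_def)
    then show ?thesis by (simp add: eq)
  qed
qed

theorem decomposition_rank_eq:
  assumes "satisfies_rank_clauses \<xi>" "elementary G T"
  shows "decomposition_rank G T = \<xi> G T"
  unfolding decomposition_rank_def
proof (rule the_equality)
  show "has_decomposition_rank G T (\<xi> G T)"
    using assms by (rule has_decomposition_rank_if_satisfies_rank_clauses)
  show "\<alpha> = \<xi> G T" if "has_decomposition_rank G T \<alpha>" for \<alpha>
    using has_decomposition_rank_imp_eq[OF assms(1) that assms(2)] by (rule sym)
qed

end

theory Submission
  imports Defs
begin

text \<open>
  The rank does not increase when passing to closed subgroups, and the successor ordinals below the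
  rank of an elementary group are ranks of closed subgroups of it. So it suffices to find one
  elementary group whose rank exceeds \<open>\<omega>\<^sup>n\<close> for every \<open>n\<close>.

  Let \<open>G\<close> be a permutation group with a compact open subgroup \<open>U\<close> fixing \<open>0\<close>. If \<open>U\<close>
  normally generates \<open>G\<close> and a compactly generated group \<open>C\<close> moves copies of \<open>G\<close> to
  infinitely many places, then the residual of the group generated by \<open>C\<close> and one copy of \<open>G\<close>
  still contains that copy. Hence \<open>k\<close>-fold iterated wreath products of \<open>G\<close> have rank at least
  \<open>\<theta> \<cdot> k\<close>, where \<open>\<theta>\<close> is a lower bound attached to \<open>G\<close>. A generalised wreath product
  along three copies of the ordered set of integers, with local actions in \<open>U\<close> at all but finitely
  many sites, contains all of them. The affine symmetric group on three letters acts on the three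
  chains; it makes the group compactly generated, and because it is normally generated by a single
  reflection, a compact open subgroup is again normally generating. So the construction can be
  repeated, and each step multiplies the lower bound by \<open>\<omega>\<close>. A generalised wreath product with
  all the groups obtained in this way as local groups contains each of them.
\<close>

section \<open>Functoriality of the discrete residual\<close>

text \<open>\<open>decomposition_rank\<close> is a definite description, so a value of the relation
  must exist before a bound has any meaning. Uniqueness is monotonicity applied to the identity.
  Existence is carried along as \<open>ranked\<close>, which passes to closed subgroups, extensions
  and increasing unions of open subgroups; hence each group is assembled by these operations from
  compact and countable discrete pieces, with an explicit continuous section for each extension.

  The number three comes from normal generation. Translations of a single chain of levels form a
  torsion-free group, so a compact subgroup has trivial image in it and cannot generate it normally;
  reflections are needed. With two letters the simple reflections are not conjugate and no finite
  subgroup of the infinite dihedral group generates it normally. With three letters the braid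
  relations make all simple reflections conjugate. Reflections do not preserve the usual order of
  the integers, so levels are compared only within a residue class mod 3.\<close>

lemma compactin_subset_incseq:
  fixes U :: "nat \<Rightarrow> 'a set"
  assumes "compactin T K" "incseq U" "\<And>i. openin T (U i)" "K \<subseteq> (\<Union>i. U i)"
  shows "\<exists>i. K \<subseteq> U i"
proof -
  obtain \<F> where F: "finite \<F>" "\<F> \<subseteq> range U" "K \<subseteq> \<Union>\<F>"
    using compactinD[OF assms(1), of "range U"] assms(3,4) by blast
  then obtain I where I: "finite I" "\<F> = U ` I"
    by (meson finite_subset_image)
  show ?thesis
  proof (cases "I = {}")
    case True
    then show ?thesis using F(3) I(2) by auto
  next
    case False
    have "U i \<subseteq> U (Max I)" if "i \<in> I" for i
      using assms(2) I(1) that by (simp add: incseqD)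
    then show ?thesis using F(3) I(2) by blast
  qed
qed

text \<open>The image of a compact generating set is compact, so one term of the exhaustion contains
  it, and that term is a subgroup. This is how exhaustions of different groups are compared.\<close>

lemma hom_compactly_generated_into_exhaustion:
  assumes "topological_group G T" "topological_group H S" "compactly_generated H S"
    and "\<phi> \<in> hom H G" "continuous_map S T \<phi>" "compactly_generated_exhaustion G T U"
  shows "\<exists>i. \<phi> ` carrier H \<subseteq> U i"
proof -
  interpret G: topological_group G T by fact
  interpret H: topological_group H S by fact
  interpret group_hom H G \<phi>
    using assms(4) by unfold_locales
  obtain K where K: "compactin S K" "generate H K = carrier H"
    using assms(3) by (auto simp: compactly_generated_def)
  have KH: "K \<subseteq> carrier H"
    using compactin_subset_topspace[OF K(1)] by (simp add: H.topspace_eq_carrier)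
  have U: "incseq U" "\<And>i. openin T (U i)" "(\<Union>i. U i) = carrier G" "\<And>i. subgroup (U i) G"
    using assms(6) by (auto simp: compactly_generated_exhaustion_def)
  have "\<phi> ` K \<subseteq> (\<Union>i. U i)" using KH by (auto simp: U(3))
  then obtain i where "\<phi> ` K \<subseteq> U i"
    using compactin_subset_incseq[OF image_compactin[OF K(1) assms(5)] U(1,2)] by blast
  then have "generate G (\<phi> ` K) \<subseteq> U i"
    using G.generate_subgroup_incl U(4) by blast
  then show ?thesis
    using generate_img[OF KH] K(2) by auto
qed

text \<open>Preimages of open normal subgroups are open and normal.\<close>

lemma hom_discrete_residual:
  assumes "topological_group Q R" "topological_group H S"
    and "\<phi> \<in> hom H Q" "continuous_map S R \<phi>"
  shows "\<phi> ` discrete_residual H S \<subseteq> discrete_residual Q R"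
proof
  interpret Q: topological_group Q R by fact
  interpret H: topological_group H S by fact
  interpret group_hom H Q \<phi> using assms(3) by unfold_locales
  fix y assume "y \<in> \<phi> ` discrete_residual H S"
  then obtain x where x: "x \<in> discrete_residual H S" "y = \<phi> x" by blast
  show "y \<in> discrete_residual Q R"
    unfolding discrete_residual_def
  proof (rule InterI)
    fix N assume "N \<in> {N. N \<lhd> Q \<and> openin R N}"
    then have N: "N \<lhd> Q" "openin R N" by auto
    define M where "M = {x \<in> carrier H. \<phi> x \<in> N}"
    interpret N: normal N Q by fact
    have "subgroup M H"
      by (rule H.subgroupI) (auto simp: M_def intro!: exI[of _ "\<one>\<^bsub>H\<^esub>"])
    moreover have "g \<otimes>\<^bsub>H\<^esub> h \<otimes>\<^bsub>H\<^esub> inv\<^bsub>H\<^esub> g \<in> M" if "g \<in> carrier H" "h \<in> M" for g h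
      using that by (auto simp: M_def N.inv_op_closed2)
    ultimately have "M \<lhd> H"
      by (simp add: H.normal_inv_iff)
    moreover have "openin S M"
      using openin_continuous_map_preimage[OF assms(4) N(2)]
      by (simp add: M_def H.topspace_eq_carrier)
    ultimately have "x \<in> M" using x(1) by (auto simp: discrete_residual_def)
    then show "y \<in> N" using x(2) by (simp add: M_def)
  qed
qed

context topological_group
begin

lemma residual_in_subset: "residual_in G T H \<subseteq> H" if "subgroup H G"
proof -
  interpret K: topological_group "G\<lparr>carrier := H\<rparr>" "subtopology T H"
    using topological_group_subgroup[OF that] .
  show ?thesis
    using subgroup.subset[OF K.discrete_residual_subgroup] by (simp add: residual_in_def)
qed

lemma topological_group_residual_in:
  assumes "subgroup H G"
  shows "topological_group (G\<lparr>carrier := residual_in G T H\<rparr>) (subtopology T (residual_in G T H))"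
  by (rule topological_group_subgroup[OF residual_in_subgroup[OF assms]])

lemma residual_in_carrier: "residual_in G T (carrier G) = discrete_residual G T"
proof -
  have "G\<lparr>carrier := carrier G\<rparr> = G" by simp
  moreover have "subtopology T (carrier G) = T"
    using topspace_eq_carrier subtopology_topspace by metis
  ultimately show ?thesis by (simp add: residual_in_def)
qed

lemma compactly_generated_imp_exhaustion:
  assumes "compactly_generated G T"
  shows "compactly_generated_exhaustion G T (\<lambda>_. carrier G)"
proof -
  have "subtopology T (carrier G) = T"
    using topspace_eq_carrier subtopology_topspace by metis
  moreover have "openin T (carrier G)" using openin_topspace[of T] by (simp add: topspace_eq_carrier)
  ultimately show ?thesis
    using assms by (auto simp: compactly_generated_exhaustion_def subgroup_self)
qed

end

lemma hom_residual_in: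
  assumes "topological_group Q R" "topological_group H S"
    and "\<phi> \<in> hom H Q" "continuous_map S R \<phi>"
    and "subgroup C H" "subgroup D Q" "\<phi> ` C \<subseteq> D"
  shows "\<phi> ` residual_in H S C \<subseteq> residual_in Q R D"
proof -
  interpret Q: topological_group Q R by fact
  interpret H: topological_group H S by fact
  have "\<phi> \<in> hom (H\<lparr>carrier := C\<rparr>) (Q\<lparr>carrier := D\<rparr>)"
    using assms(3,7) subgroup.subset[OF assms(5)] by (auto simp: hom_def Pi_iff image_subset_iff subset_iff)
  moreover have "continuous_map (subtopology S C) (subtopology R D) \<phi>"
    using assms(4,7)
    by (auto simp: continuous_map_in_subtopology intro: continuous_map_from_subtopology)
  ultimately show ?thesis
    unfolding residual_in_def
    by (intro hom_discrete_residual Q.topological_group_subgroup H.topological_group_subgroup assms)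
qed

section \<open>Monotonicity of the decomposition rank\<close>

lemma ord_less_Sup_iff:
  fixes \<beta> :: "nat \<Rightarrow> countable_ord"
  shows "x < (SUP i. \<beta> i) + 1 \<longleftrightarrow> x \<le> (SUP i. \<beta> i)"
  by (simp add: ord_add_1 less_ord_succ_iff)

lemma ord_le_SUP: "\<beta> i \<le> (SUP i. \<beta> i)" for \<beta> :: "nat \<Rightarrow> countable_ord"
  by (rule cSUP_upper) (simp_all add: countable_ord_bdd_above)

lemma ord_SUP_le_iff: "(SUP i. \<beta> i) \<le> u \<longleftrightarrow> (\<forall>i. \<beta> i \<le> u)" for \<beta> :: "nat \<Rightarrow> countable_ord"
  by (subst ord_Sup_le_iff) auto

lemma ord_less_SUP_iff: "u < (SUP i. \<beta> i) \<longleftrightarrow> (\<exists>i. u < \<beta> i)" for \<beta> :: "nat \<Rightarrow> countable_ord"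
  using ord_SUP_le_iff[of \<beta> u] by (auto simp: not_le[symmetric])

text \<open>The clause for compactly generated groups is the exhaustion clause for a constant
  sequence, so later case analyses have only two cases.\<close>

lemma has_decomposition_rank_cases_exhaustion:
  assumes "topological_group G T" "has_decomposition_rank G T \<alpha>"
  obtains "carrier G = {\<one>\<^bsub>G\<^esub>}" "\<alpha> = 1"
  | U \<beta> where "carrier G \<noteq> {\<one>\<^bsub>G\<^esub>}" "compactly_generated_exhaustion G T U"
      "\<And>i. has_decomposition_rank (G\<lparr>carrier := residual_in G T (U i)\<rparr>)
         (subtopology T (residual_in G T (U i))) (\<beta> i)"
      "\<alpha> = (SUP i. \<beta> i) + 1"
  using assms(2)
proof (cases rule: has_decomposition_rank.cases)
  case trivial
  then show ?thesis using that(1) by blast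
next
  case (compactly_generated \<beta>)
  interpret topological_group G T by fact
  show ?thesis
  proof (rule that(2))
    show "compactly_generated_exhaustion G T (\<lambda>_. carrier G)"
      using compactly_generated by (intro compactly_generated_imp_exhaustion)
    show "has_decomposition_rank (G\<lparr>carrier := residual_in G T (carrier G)\<rparr>)
         (subtopology T (residual_in G T (carrier G))) ((\<lambda>_. \<beta>) i)" for i :: nat
      using compactly_generated by (simp add: residual_in_carrier)
    show "\<alpha> = (SUP i :: nat. (\<lambda>_. \<beta>) i) + 1"
      using compactly_generated by simp
  qed (use compactly_generated in simp)
next
  case (exhaustion U \<beta>)
  then show ?thesis using that(2) by blast
qed

lemma has_decomposition_rank_ge_1:
  assumes "topological_group G T" "has_decomposition_rank G T \<alpha>"
  shows "1 \<le> \<alpha>"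
  using assms
proof (cases rule: has_decomposition_rank_cases_exhaustion)
  case 2
  then show ?thesis
    by (simp add: ord_zero_less_iff[symmetric] ord_add_1 less_ord_succ_iff)
qed simp

text \<open>Each term of the exhaustion of H is compactly generated, so it maps into one term of the
  exhaustion of Q, and its residual into the residual of that term, whose rank is smaller than
  \<alpha>. Injectivity prevents a non-trivial H from mapping to a trivial Q. With the identity for
  \<phi>, the theorem says that the rank is unique.\<close>

theorem has_decomposition_rank_mono:
  assumes "has_decomposition_rank Q R \<alpha>" "has_decomposition_rank H S \<beta>"
    and "topological_group Q R" "topological_group H S"
    and "\<phi> \<in> hom H Q" "inj_on \<phi> (carrier H)" "continuous_map S R \<phi>"
  shows "\<beta> \<le> \<alpha>"
  using assms
proof (induction \<alpha> arbitrary: Q R H S \<beta> rule: less_induct)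
  case (less \<alpha>)
  interpret Q: topological_group Q R by fact
  interpret H: topological_group H S by fact
  interpret group_hom H Q \<phi> using less.prems(5) by unfold_locales
  show ?case using less.prems(4,2)
  proof (cases rule: has_decomposition_rank_cases_exhaustion)
    case 1
    then show ?thesis using has_decomposition_rank_ge_1 less.prems(1,3) by blast
  next
    case H: (2 V \<beta>')
    show ?thesis using less.prems(3,1)
    proof (cases rule: has_decomposition_rank_cases_exhaustion)
      case 1
      then have "x = \<one>\<^bsub>H\<^esub>" if "x \<in> carrier H" for x
        using that less.prems(6) hom_closed hom_one H.one_closed by (metis inj_onD singletonD)
      then show ?thesis using H(1) H.one_closed by blast
    next
      case Q: (2 U \<alpha>')
      have "\<beta>' j \<le> (SUP i. \<alpha>' i)" for j
      proof -
        have V: "subgroup (V j) H"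
            "compactly_generated (H\<lparr>carrier := V j\<rparr>) (subtopology S (V j))"
          using H(2) by (auto simp: compactly_generated_exhaustion_def)
        have hom: "\<phi> \<in> hom (H\<lparr>carrier := K\<rparr>) Q" if "K \<subseteq> carrier H" for K
          using that less.prems(5) by (auto simp: hom_def Pi_iff subset_iff)
        obtain i where i: "\<phi> ` V j \<subseteq> U i"
          using hom_compactly_generated_into_exhaustion[OF less.prems(3)
              H.topological_group_subgroup[OF V(1)] V(2) hom[OF subgroup.subset[OF V(1)]] _ Q(2)]
            continuous_map_from_subtopology[OF less.prems(7)] by auto
        have U: "subgroup (U i) Q" using Q(2) by (auto simp: compactly_generated_exhaustion_def)
        have im: "\<phi> ` residual_in H S (V j) \<subseteq> residual_in Q R (U i)"
          using hom_residual_in less.prems(3-5,7) V(1) U i by blast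
        have sub: "residual_in H S (V j) \<subseteq> carrier H"
          using H.residual_in_subset[OF V(1)] subgroup.subset[OF V(1)] by blast
        have "\<beta>' j \<le> \<alpha>' i"
        proof (rule less.IH[OF _ Q(3)[of i] H(3)[of j]])
          show "\<alpha>' i < \<alpha>" using Q(4) by (simp add: ord_less_Sup_iff ord_le_SUP)
          show "\<phi> \<in> hom (H\<lparr>carrier := residual_in H S (V j)\<rparr>) (Q\<lparr>carrier := residual_in Q R (U i)\<rparr>)"
            using im hom[OF sub] by (auto simp: hom_def)
          show "inj_on \<phi> (carrier (H\<lparr>carrier := residual_in H S (V j)\<rparr>))"
            using less.prems(6) sub by (auto intro: inj_on_subset)
          show "continuous_map (subtopology S (residual_in H S (V j)))
             (subtopology R (residual_in Q R (U i))) \<phi>"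
            using im less.prems(7)
            by (auto simp: continuous_map_in_subtopology intro: continuous_map_from_subtopology)
        qed (intro Q.topological_group_residual_in H.topological_group_residual_in U V(1))+
        then show ?thesis using ord_le_SUP order_trans by blast
      qed
      then have "(SUP i. \<beta>' i) \<le> (SUP i. \<alpha>' i)" by (simp add: ord_SUP_le_iff)
      then show ?thesis using Q(4) H(4) by (simp add: ord_add_1 ord_succ_le_iff less_ord_succ_iff)
    qed
  qed
qed

corollary decomposition_rank_eqI:
  assumes "topological_group G T" "has_decomposition_rank G T \<alpha>"
  shows "decomposition_rank G T = \<alpha>"
  unfolding decomposition_rank_def
proof (rule the_equality)
  show "\<beta> = \<alpha>" if "has_decomposition_rank G T \<beta>" for \<beta>
    using has_decomposition_rank_mono[OF assms(2) that assms(1,1), of id]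
      has_decomposition_rank_mono[OF that assms(2) assms(1,1), of id]
    by (simp add: hom_def)
qed fact

text \<open>
  If \<open>\<beta> + 1\<close> is below the rank of \<open>G\<close>, it is at most the rank of one of the residuals in the
  supremum that computes the rank of \<open>G\<close>, and these are closed subgroups. So a single elementary
  group of large rank realises all smaller successor ordinals.
\<close>

theorem elementary_successor_rank_below:
  assumes "elementary G T" "has_decomposition_rank G T \<alpha>" "\<beta> + 1 \<le> \<alpha>"
  shows "\<exists>H S. elementary H S \<and> has_decomposition_rank H S (\<beta> + 1)"
  using assms
proof (induction \<alpha> arbitrary: G T rule: less_induct)
  case (less \<alpha>)
  interpret tdlcsc_group G T using elementary_imp_tdlcsc_group[OF less.prems(1)] .
  show ?case
  proof (cases "\<beta> + 1 = \<alpha>")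
    case True
    then show ?thesis using less.prems by blast
  next
    case False
    show ?thesis using topological_group_axioms less.prems(2)
    proof (cases rule: has_decomposition_rank_cases_exhaustion)
      case 1
      moreover have "1 \<le> \<beta> + 1"
        by (simp add: ord_zero_less_iff[symmetric] ord_add_1 less_ord_succ_iff)
      ultimately have "\<beta> + 1 = \<alpha>"
        using less.prems(3) by (metis order_antisym)
      with False show ?thesis by simp
    next
      case (2 U \<gamma>)
      have "\<beta> \<le> (SUP i. \<gamma> i)"
        using less.prems(3) unfolding 2(4) ord_add_1 ord_succ_le_iff less_ord_succ_iff .
      moreover have "\<beta> \<noteq> (SUP i. \<gamma> i)" using False 2(4) by blast
      ultimately have "\<beta> < (SUP i. \<gamma> i)" by (rule le_neq_trans)
      then obtain i where i: "\<beta> < \<gamma> i" by (auto simp: ord_less_SUP_iff)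
      have U: "subgroup (U i) G" "openin T (U i)"
        using 2(2) by (auto simp: compactly_generated_exhaustion_def)
      have "\<gamma> i < \<alpha>" using 2(4) by (simp add: ord_less_Sup_iff ord_le_SUP)
      then show ?thesis
        using less.IH[OF _ elementary_residual_in[OF less.prems(1) U] 2(3)] i
        by (simp add: ord_add_1 ord_succ_le_iff)
    qed
  qed
qed

section \<open>Existence of the decomposition rank\<close>

definition ranked :: "'a monoid \<Rightarrow> 'a topology \<Rightarrow> bool"
  where "ranked G T \<longleftrightarrow> (\<exists>\<alpha>. has_decomposition_rank G T \<alpha>)"

lemma (in tdlcsc_group) tdlcsc_group_residual_in:
  assumes "subgroup H G" "openin T H"
  shows "tdlcsc_group (G\<lparr>carrier := residual_in G T H\<rparr>) (subtopology T (residual_in G T H))"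
  using tdlcsc_group_closed_subgroup residual_in_subgroup residual_in_closed assms by blast

lemma ranked_exhaustionI:
  assumes "tdlcsc_group G T" "compactly_generated_exhaustion G T U"
    and "\<And>i. ranked (G\<lparr>carrier := residual_in G T (U i)\<rparr>) (subtopology T (residual_in G T (U i)))"
  shows "ranked G T"
proof (cases "carrier G = {\<one>\<^bsub>G\<^esub>}")
  case True
  then show ?thesis using has_decomposition_rank.trivial unfolding ranked_def by blast
next
  case False
  obtain \<beta> where "\<And>i. has_decomposition_rank (G\<lparr>carrier := residual_in G T (U i)\<rparr>)
      (subtopology T (residual_in G T (U i))) (\<beta> i)"
    using assms(3) unfolding ranked_def by metis
  then have "has_decomposition_rank G T ((SUP i. \<beta> i) + 1)"
    by (rule has_decomposition_rank.exhaustion[OF False assms(2)])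
  then show ?thesis unfolding ranked_def ..
qed

text \<open>Induction on the rank of Q: residuals of the exhaustion of H map to residuals in Q of
  smaller rank. The last hypothesis ranges over all closed subgroups inside the kernel, not just the
  kernel, because the kernel shrinks together with H; in this form the residuals inherit it.
  Injective homomorphisms and extensions are both instances.\<close>

lemma ranked_hom_aux:
  assumes "has_decomposition_rank Q R \<alpha>" "topological_group Q R"
    and "tdlcsc_group H S" "\<phi> \<in> hom H Q" "continuous_map S R \<phi>"
    and "\<And>K. subgroup K H \<Longrightarrow> closedin S K \<Longrightarrow> \<phi> ` K \<subseteq> {\<one>\<^bsub>Q\<^esub>} \<Longrightarrow>
      ranked (H\<lparr>carrier := K\<rparr>) (subtopology S K)"
  shows "ranked H S"
  using assms
proof (induction \<alpha> arbitrary: Q R H S rule: less_induct)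
  case (less \<alpha>)
  interpret Q: topological_group Q R by fact
  interpret H: tdlcsc_group H S by fact
  interpret group_hom H Q \<phi> using less.prems(4) by unfold_locales
  show ?case using less.prems(2,1)
  proof (cases rule: has_decomposition_rank_cases_exhaustion)
    case 1
    have "\<phi> ` carrier H \<subseteq> {\<one>\<^bsub>Q\<^esub>}" using hom_closed 1(1) by blast
    moreover have "closedin S (carrier H)" using closedin_topspace H.topspace_eq_carrier by metis
    ultimately have "ranked (H\<lparr>carrier := carrier H\<rparr>) (subtopology S (carrier H))"
      using less.prems(6) H.subgroup_self by blast
    moreover have "subtopology S (carrier H) = S"
      using H.topspace_eq_carrier subtopology_topspace by metis
    ultimately show ?thesis by simp
  next
    case Q: (2 U \<alpha>')
    obtain V where V: "compactly_generated_exhaustion H S V"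
      using H.ex_compactly_generated_exhaustion by blast
    show ?thesis
    proof (rule ranked_exhaustionI[OF less.prems(3) V])
      fix j
      let ?K = "residual_in H S (V j)"
      have Vj: "subgroup (V j) H" "openin S (V j)"
          "compactly_generated (H\<lparr>carrier := V j\<rparr>) (subtopology S (V j))"
        using V by (auto simp: compactly_generated_exhaustion_def)
      have hom: "\<phi> \<in> hom (H\<lparr>carrier := K\<rparr>) Q" if "K \<subseteq> carrier H" for K
        using that less.prems(4) by (auto simp: hom_def Pi_iff subset_iff)
      obtain i where i: "\<phi> ` V j \<subseteq> U i"
        using hom_compactly_generated_into_exhaustion[OF less.prems(2)
            H.topological_group_subgroup[OF Vj(1)] Vj(3) hom[OF subgroup.subset[OF Vj(1)]] _ Q(2)]
          continuous_map_from_subtopology[OF less.prems(5)] by auto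
      have U: "subgroup (U i) Q" using Q(2) by (auto simp: compactly_generated_exhaustion_def)
      have im: "\<phi> ` ?K \<subseteq> residual_in Q R (U i)"
        using hom_residual_in H.topological_group_axioms less.prems(2,4,5) Vj(1) U i by blast
      have sub: "?K \<subseteq> carrier H"
        using H.residual_in_subset[OF Vj(1)] subgroup.subset[OF Vj(1)] by blast
      have closed: "closedin S ?K" "subgroup ?K H"
        using H.residual_in_closed H.residual_in_subgroup Vj by auto
      show "ranked (H\<lparr>carrier := ?K\<rparr>) (subtopology S ?K)"
      proof (rule less.IH[OF _ Q(3)[of i]])
        show "\<alpha>' i < \<alpha>" using Q(4) by (simp add: ord_less_Sup_iff ord_le_SUP)
        show "topological_group (Q\<lparr>carrier := residual_in Q R (U i)\<rparr>)
            (subtopology R (residual_in Q R (U i)))"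
          by (intro Q.topological_group_residual_in U)
        show "tdlcsc_group (H\<lparr>carrier := ?K\<rparr>) (subtopology S ?K)"
          by (intro H.tdlcsc_group_residual_in Vj)
        show "\<phi> \<in> hom (H\<lparr>carrier := ?K\<rparr>) (Q\<lparr>carrier := residual_in Q R (U i)\<rparr>)"
          using im hom[OF sub] by (auto simp: hom_def)
        show "continuous_map (subtopology S ?K) (subtopology R (residual_in Q R (U i))) \<phi>"
          using im less.prems(5)
          by (auto simp: continuous_map_in_subtopology intro: continuous_map_from_subtopology)
        fix L assume L: "subgroup L (H\<lparr>carrier := ?K\<rparr>)" "closedin (subtopology S ?K) L"
          "\<phi> ` L \<subseteq> {\<one>\<^bsub>Q\<lparr>carrier := residual_in Q R (U i)\<rparr>\<^esub>}"
        then have "L \<subseteq> ?K" using subgroup.subset by fastforce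
        moreover have "subgroup L H"
          using L(1) closed(2) H.incl_subgroup by blast
        moreover have "closedin S L"
          using L(2) closed(1) closedin_trans_full by blast
        ultimately have "ranked (H\<lparr>carrier := L\<rparr>) (subtopology S L)"
          using less.prems(6) L(3) by simp
        with \<open>L \<subseteq> ?K\<close> show "ranked ((H\<lparr>carrier := ?K\<rparr>)\<lparr>carrier := L\<rparr>)
            (subtopology (subtopology S ?K) L)"
          by (simp add: subtopology_subtopology Int_absorb1)
      qed
    qed
  qed
qed

lemma ranked_injective_hom:
  assumes "ranked Q R" "topological_group Q R"
    and "tdlcsc_group H S" "\<phi> \<in> hom H Q" "continuous_map S R \<phi>" "inj_on \<phi> (carrier H)"
  shows "ranked H S"
proof -
  obtain \<alpha> where \<alpha>: "has_decomposition_rank Q R \<alpha>" using assms(1) by (auto simp: ranked_def)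
  interpret Q: topological_group Q R by fact
  interpret H: tdlcsc_group H S by fact
  interpret group_hom H Q \<phi> using assms(4) by unfold_locales
  show ?thesis
  proof (rule ranked_hom_aux[OF \<alpha> assms(2-5)])
    fix K assume K: "subgroup K H" "\<phi> ` K \<subseteq> {\<one>\<^bsub>Q\<^esub>}"
    have "K \<subseteq> {\<one>\<^bsub>H\<^esub>}"
    proof
      fix x assume x: "x \<in> K"
      then have "x \<in> carrier H" using subgroup.subset[OF K(1)] by blast
      moreover have "\<phi> x = \<phi> \<one>\<^bsub>H\<^esub>" using x K(2) hom_one by auto
      ultimately show "x \<in> {\<one>\<^bsub>H\<^esub>}" using assms(6) H.one_closed by (simp add: inj_on_def)
    qed
    then have "K = {\<one>\<^bsub>H\<^esub>}" using subgroup.one_closed[OF K(1)] by blast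
    then show "ranked (H\<lparr>carrier := K\<rparr>) (subtopology S K)"
      unfolding ranked_def using has_decomposition_rank.trivial[of "H\<lparr>carrier := K\<rparr>"] by auto
  qed
qed

lemma ranked_closed_subgroup:
  assumes "ranked G T" "tdlcsc_group G T" "subgroup H G" "closedin T H"
  shows "ranked (G\<lparr>carrier := H\<rparr>) (subtopology T H)"
proof -
  interpret tdlcsc_group G T by fact
  show ?thesis
    by (rule ranked_injective_hom[OF assms(1) topological_group_axioms
          tdlcsc_group_closed_subgroup[OF assms(3,4)], of id])
      (use subgroup.subset[OF assms(3)] in \<open>auto simp: hom_def continuous_map_from_subtopology\<close>)
qed

lemma ranked_extension:
  assumes "ranked Q R" "topological_group Q R" "Hausdorff_space R"
    and "tdlcsc_group H S" "\<phi> \<in> hom H Q" "continuous_map S R \<phi>"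
    and "ranked (H\<lparr>carrier := kernel H Q \<phi>\<rparr>) (subtopology S (kernel H Q \<phi>))"
  shows "ranked H S"
proof -
  obtain \<alpha> where \<alpha>: "has_decomposition_rank Q R \<alpha>" using assms(1) by (auto simp: ranked_def)
  interpret Q: topological_group Q R by fact
  interpret H: tdlcsc_group H S by fact
  interpret group_hom H Q \<phi> using assms(5) by unfold_locales
  let ?N = "kernel H Q \<phi>"
  have "closedin R {\<one>\<^bsub>Q\<^esub>}"
    using assms(3) Q.one_closed by (simp add: closedin_Hausdorff_singleton Q.topspace_eq_carrier)
  from closedin_continuous_map_preimage[OF assms(6) this] have N: "closedin S ?N"
    by (simp add: kernel_def H.topspace_eq_carrier)
  show ?thesis
  proof (rule ranked_hom_aux[OF \<alpha> assms(2,4-6)])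
    fix K assume K: "subgroup K H" "closedin S K" "\<phi> ` K \<subseteq> {\<one>\<^bsub>Q\<^esub>}"
    have KN: "K \<subseteq> ?N"
      using K(3) subgroup.subset[OF K(1)] by (auto simp: kernel_def)
    have "ranked ((H\<lparr>carrier := ?N\<rparr>)\<lparr>carrier := K\<rparr>) (subtopology (subtopology S ?N) K)"
    proof (rule ranked_closed_subgroup[OF assms(7) H.tdlcsc_group_closed_subgroup[OF subgroup_kernel N]])
      show "subgroup K (H\<lparr>carrier := ?N\<rparr>)"
        using H.subgroup_incl[OF K(1) subgroup_kernel KN] .
      show "closedin (subtopology S ?N) K"
        using K(2) KN by (metis closedin_subtopology_Int_closed inf.absorb_iff2 inf_commute closedin_subset_topspace)
    qed
    with KN show "ranked (H\<lparr>carrier := K\<rparr>) (subtopology S K)"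
      by (simp add: subtopology_subtopology Int_absorb1)
  qed
qed

text \<open>A compactly generated open subgroup lies in some W i, so its residual is a closed
  subgroup of a ranked group.\<close>

lemma ranked_increasing_union:
  assumes "tdlcsc_group G T" "incseq W" "(\<Union>i :: nat. W i) = carrier G"
    and "\<And>i. subgroup (W i) G" "\<And>i. openin T (W i)"
    and "\<And>i. ranked (G\<lparr>carrier := W i\<rparr>) (subtopology T (W i))"
  shows "ranked G T"
proof -
  interpret tdlcsc_group G T by fact
  obtain V where V: "compactly_generated_exhaustion G T V"
    using ex_compactly_generated_exhaustion by blast
  show ?thesis
  proof (rule ranked_exhaustionI[OF assms(1) V])
    fix j
    have Vj: "subgroup (V j) G" "openin T (V j)"
        "compactly_generated (G\<lparr>carrier := V j\<rparr>) (subtopology T (V j))"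
      using V by (auto simp: compactly_generated_exhaustion_def)
    obtain K where K: "compactin (subtopology T (V j)) K" "generate (G\<lparr>carrier := V j\<rparr>) K = V j"
      using Vj(3) by (auto simp: compactly_generated_def)
    have KV: "compactin T K" "K \<subseteq> V j" using K(1) by (auto simp: compactin_subtopology)
    have "K \<subseteq> (\<Union>i. W i)" using KV(2) subgroup.subset[OF Vj(1)] assms(3) by blast
    then obtain i where i: "K \<subseteq> W i"
      using compactin_subset_incseq[OF KV(1) assms(2,5)] by blast
    have "V j = generate G K" using generate_consistent[OF KV(2) Vj(1)] K(2) by simp
    then have VW: "V j \<subseteq> W i" using generate_subgroup_incl[OF i assms(4)] by simp
    let ?K = "residual_in G T (V j)"
    have KW: "?K \<subseteq> W i" using residual_in_subset[OF Vj(1)] VW by blast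
    have "closedin T ?K" "subgroup ?K G"
      using residual_in_closed residual_in_subgroup Vj by auto
    moreover have "closedin T (W i)" using open_subgroup_closed assms(4,5) by blast
    ultimately have "ranked ((G\<lparr>carrier := W i\<rparr>)\<lparr>carrier := ?K\<rparr>) (subtopology (subtopology T (W i)) ?K)"
      using KW assms(4,6) ranked_closed_subgroup[OF assms(6) tdlcsc_group_closed_subgroup]
      by (simp add: subgroup_incl closedin_subset_topspace)
    with KW show "ranked (G\<lparr>carrier := ?K\<rparr>) (subtopology T ?K)"
      by (simp add: subtopology_subtopology Int_absorb1)
  qed
qed

text \<open>By the Hausdorff property the residual of G is trivial, hence so is that of each term of
  an exhaustion, and the rank is at most 2. This covers the compact and the discrete building
  blocks.\<close>

lemma ranked_if_open_normal_basis:
  assumes "tdlcsc_group G T"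
    and "\<And>U. openin T U \<Longrightarrow> \<one>\<^bsub>G\<^esub> \<in> U \<Longrightarrow> \<exists>N. N \<lhd> G \<and> openin T N \<and> N \<subseteq> U"
  shows "ranked G T"
proof -
  interpret tdlcsc_group G T by fact
  obtain V where V: "compactly_generated_exhaustion G T V"
    using ex_compactly_generated_exhaustion by blast
  have sub: "discrete_residual G T \<subseteq> {\<one>\<^bsub>G\<^esub>}"
  proof
    fix x assume x: "x \<in> discrete_residual G T"
    show "x \<in> {\<one>\<^bsub>G\<^esub>}"
    proof (rule ccontr)
      assume nx: "x \<notin> {\<one>\<^bsub>G\<^esub>}"
      have "x \<in> carrier G" using x subgroup.subset[OF discrete_residual_subgroup] by blast
      then have "closedin T {x}"
        using Hausdorff by (simp add: closedin_Hausdorff_singleton topspace_eq_carrier)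
      then have "openin T (carrier G - {x})"
        by (metis openin_closedin_eq openin_diff openin_topspace topspace_eq_carrier)
      then obtain N where "N \<lhd> G" "openin T N" "N \<subseteq> carrier G - {x}"
        using assms(2)[of "carrier G - {x}"] nx by auto
      then show False using x by (auto simp: discrete_residual_def)
    qed
  qed
  show ?thesis
  proof (rule ranked_exhaustionI[OF assms(1) V])
    fix j
    have Vj: "subgroup (V j) G" using V by (auto simp: compactly_generated_exhaustion_def)
    have "id ` residual_in G T (V j) \<subseteq> residual_in G T (carrier G)"
      by (rule hom_residual_in)
        (use Vj subgroup.subset[OF Vj] subgroup_self topological_group_axioms in \<open>auto simp: hom_def\<close>)
    then have "residual_in G T (V j) \<subseteq> {\<one>\<^bsub>G\<^esub>}" using sub by (simp add: residual_in_carrier)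
    then have "residual_in G T (V j) = {\<one>\<^bsub>G\<^esub>}"
      using subgroup.one_closed[OF residual_in_subgroup[OF Vj]] by blast
    then show "ranked (G\<lparr>carrier := residual_in G T (V j)\<rparr>) (subtopology T (residual_in G T (V j)))"
      unfolding ranked_def using has_decomposition_rank.trivial[of "G\<lparr>carrier := residual_in G T (V j)\<rparr>"]
      by auto
  qed
qed

section \<open>Lower bounds for the decomposition rank\<close>

text \<open>
  An infinite orbit of \<open>0\<close> is what allows \<open>C\<close> to displace the subgroups that a subgroup fixing
  \<open>0\<close> would leave in place.
\<close>

inductive height_ge ::
    "(nat \<Rightarrow> nat) monoid \<Rightarrow> (nat \<Rightarrow> nat) topology \<Rightarrow> (nat \<Rightarrow> nat) set \<Rightarrow> countable_ord \<Rightarrow> bool"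
  for G T
  where
    height_geI: "subgroup B G \<Longrightarrow>
      (\<And>\<gamma>. \<gamma> < \<theta> \<Longrightarrow> \<exists>C. subgroup C G \<and> C \<subseteq> B \<and>
        compactly_generated (G\<lparr>carrier := C\<rparr>) (subtopology T C) \<and> infinite ((\<lambda>c. c 0) ` C) \<and>
        height_ge G T (residual_in G T C) \<gamma>) \<Longrightarrow>
      height_ge G T B \<theta>"

lemma height_ge_subgroup: "height_ge G T B \<theta> \<Longrightarrow> subgroup B G"
  by (erule height_ge.cases) simp

lemma height_geE:
  assumes "height_ge G T B \<theta>" "\<gamma> < \<theta>"
  obtains C where "subgroup C G" "C \<subseteq> B" "compactly_generated (G\<lparr>carrier := C\<rparr>) (subtopology T C)"
    "infinite ((\<lambda>c. c 0) ` C)" "height_ge G T (residual_in G T C) \<gamma>"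
  using assms(1)
proof (cases rule: height_ge.cases)
  case height_geI
  then show ?thesis using assms(2) that by blast
qed

lemma height_ge_mono:
  assumes "height_ge G T B \<theta>" "subgroup B' G" "B \<subseteq> B'" "\<theta>' \<le> \<theta>"
  shows "height_ge G T B' \<theta>'"
proof (rule height_geI[OF assms(2)])
  fix \<gamma> assume "\<gamma> < \<theta>'"
  then have "\<gamma> < \<theta>" using assms(4) by (rule less_le_trans)
  with assms(1) obtain C where C: "subgroup C G" "C \<subseteq> B"
    "compactly_generated (G\<lparr>carrier := C\<rparr>) (subtopology T C)"
    "infinite ((\<lambda>c. c 0) ` C)" "height_ge G T (residual_in G T C) \<gamma>" by (rule height_geE)
  then show "\<exists>C. subgroup C G \<and> C \<subseteq> B' \<and>
        compactly_generated (G\<lparr>carrier := C\<rparr>) (subtopology T C) \<and> infinite ((\<lambda>c. c 0) ` C) \<and>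
        height_ge G T (residual_in G T C) \<gamma>"
    using assms(3) by blast
qed

text \<open>If the supremum \<sigma> of the ranks \<beta> i were below \<theta>, the definition of
  height would give a compactly generated C in B whose residual has height at least \<sigma>. The
  image of C lies in some U i, so the induction hypothesis puts \<sigma> strictly below \<beta> i,
  which is absurd. For a trivial Q, the infinite orbit of C contradicts injectivity unless \<theta>
  is 0.\<close>

theorem height_less_decomposition_rank:
  assumes "has_decomposition_rank Q R \<alpha>" "height_ge G T B \<theta>"
    and "topological_group G T" "topological_group Q R"
    and "\<phi> \<in> hom (G\<lparr>carrier := B\<rparr>) Q" "inj_on \<phi> B" "continuous_map (subtopology T B) R \<phi>"
  shows "\<theta> < \<alpha>"
  using assms
proof (induction \<alpha> arbitrary: Q R B \<theta> rule: less_induct)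
  case (less \<alpha>)
  interpret G: topological_group G T by fact
  interpret Q: topological_group Q R by fact
  have B: "subgroup B G" using less.prems(2) by (rule height_ge_subgroup)
  interpret B: topological_group "G\<lparr>carrier := B\<rparr>" "subtopology T B"
    using G.topological_group_subgroup[OF B] .
  interpret group_hom "G\<lparr>carrier := B\<rparr>" Q \<phi> using less.prems(5) by unfold_locales
  show ?case using less.prems(4,1)
  proof (cases rule: has_decomposition_rank_cases_exhaustion)
    case 1
    have "\<not> 0 < \<theta>"
    proof
      assume "0 < \<theta>"
      with less.prems(2) obtain C where C: "C \<subseteq> B" "infinite ((\<lambda>c. c 0) ` C)"
        by (rule height_geE)
      have "\<phi> c = \<one>\<^bsub>Q\<^esub>" if "c \<in> B" for c
        using hom_closed[of c] that 1(1) by simp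
      then have "c = d" if "c \<in> B" "d \<in> B" for c d
        using that less.prems(6) by (metis inj_onD)
      then have "C \<subseteq> {c}" if "c \<in> C" for c
        using that C(1) by blast
      then have "finite C" by (metis finite.emptyI finite_insert finite_subset subsetI)
      then show False using C(2) by blast
    qed
    moreover have "0 < \<theta> \<or> \<theta> = 0" using zero_le_ord[of \<theta>] by (auto simp: order_le_less)
    ultimately show ?thesis using 1(2) by (simp add: ord_zero_less_iff)
  next
    case (2 U \<beta>)
    have "\<not> (SUP i. \<beta> i) < \<theta>"
    proof
      assume "(SUP i. \<beta> i) < \<theta>"
      with less.prems(2) obtain C where C: "subgroup C G" "C \<subseteq> B"
        "compactly_generated (G\<lparr>carrier := C\<rparr>) (subtopology T C)"
        "height_ge G T (residual_in G T C) (SUP i. \<beta> i)" by (rule height_geE)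
      have hom: "\<phi> \<in> hom (G\<lparr>carrier := K\<rparr>) Q" if "K \<subseteq> B" for K
        using that less.prems(5) by (auto simp: hom_def Pi_iff subset_iff)
      have cont: "continuous_map (subtopology T K) R \<phi>" if "K \<subseteq> B" for K
        using continuous_map_from_subtopology[OF less.prems(7), of K] that
        by (simp add: subtopology_subtopology Int_absorb1)
      obtain i where i: "\<phi> ` C \<subseteq> U i"
        using hom_compactly_generated_into_exhaustion[OF less.prems(4)
            G.topological_group_subgroup[OF C(1)] C(3) hom[OF C(2)] cont[OF C(2)] 2(2)] by auto
      have U: "subgroup (U i) Q" using 2(2) by (auto simp: compactly_generated_exhaustion_def)
      have CB: "subgroup C (G\<lparr>carrier := B\<rparr>)" using G.subgroup_incl[OF C(1) B C(2)] .
      have res: "residual_in (G\<lparr>carrier := B\<rparr>) (subtopology T B) C = residual_in G T C"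
        using C(2) by (simp add: residual_in_def subtopology_subtopology Int_absorb1)
      have im: "\<phi> ` residual_in G T C \<subseteq> residual_in Q R (U i)"
        using hom_residual_in[OF less.prems(4) B.topological_group_axioms less.prems(5,7) CB U i]
        by (simp add: res)
      have sub: "residual_in G T C \<subseteq> B"
        using G.residual_in_subset[OF C(1)] C(2) by blast
      have "(SUP i. \<beta> i) < \<beta> i"
      proof (rule less.IH[OF _ 2(3)[of i] C(4) G.topological_group_axioms])
        show "\<beta> i < \<alpha>" using 2(4) by (simp add: ord_less_Sup_iff ord_le_SUP)
        show "topological_group (Q\<lparr>carrier := residual_in Q R (U i)\<rparr>)
            (subtopology R (residual_in Q R (U i)))"
          by (rule Q.topological_group_residual_in[OF U])
        show "\<phi> \<in> hom (G\<lparr>carrier := residual_in G T C\<rparr>) (Q\<lparr>carrier := residual_in Q R (U i)\<rparr>)"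
          using im hom[OF sub] by (auto simp: hom_def)
        show "inj_on \<phi> (residual_in G T C)" using less.prems(6) sub by (rule inj_on_subset)
        show "continuous_map (subtopology T (residual_in G T C))
            (subtopology R (residual_in Q R (U i))) \<phi>"
          using im cont[OF sub] by (auto simp: continuous_map_in_subtopology)
      qed
      then show False using ord_le_SUP[of \<beta> i] by simp
    qed
    then show ?thesis using 2(4) by (simp add: ord_less_Sup_iff)
  qed
qed

lemma compactly_generated_generate:
  assumes tg: "topological_group G T" "topological_group G' T'"
    and \<epsilon>: "\<epsilon> \<in> hom G G'" "continuous_map T T' \<epsilon>"
    and H: "subgroup H G'" "compactly_generated (G'\<lparr>carrier := H\<rparr>) (subtopology T' H)"
    and C: "subgroup C G" "compactly_generated (G\<lparr>carrier := C\<rparr>) (subtopology T C)"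
  defines "K \<equiv> generate G' (H \<union> \<epsilon> ` C)"
  shows "compactly_generated (G'\<lparr>carrier := K\<rparr>) (subtopology T' K)"
proof -
  interpret G: topological_group G T by fact
  interpret G': topological_group G' T' by fact
  interpret group_hom G G' \<epsilon> using \<epsilon>(1) by unfold_locales
  have "H \<union> \<epsilon> ` C \<subseteq> carrier G'"
    using subgroup.subset[OF H(1)] subgroup.subset[OF C(1)] by auto
  then have K: "subgroup K G'" "H \<subseteq> K" "\<epsilon> ` C \<subseteq> K"
    using G'.generate_is_subgroup by (auto simp: K_def intro: generate.incl)
  obtain P where P: "compactin (subtopology T' H) P" "generate (G'\<lparr>carrier := H\<rparr>) P = H"
    using H(2) by (auto simp: compactly_generated_def)
  obtain Q where Q: "compactin (subtopology T C) Q" "generate (G\<lparr>carrier := C\<rparr>) Q = C"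
    using C(2) by (auto simp: compactly_generated_def)
  have PQ: "compactin T' P" "P \<subseteq> H" "compactin T Q" "Q \<subseteq> C"
    using P(1) Q(1) by (auto simp: compactin_subtopology)
  have "compactin T' (P \<union> \<epsilon> ` Q)"
    using PQ \<epsilon>(2) by (intro compactin_Un image_compactin)
  moreover have PQK: "P \<union> \<epsilon> ` Q \<subseteq> K" using PQ K(2,3) by blast
  ultimately have "compactin (subtopology T' K) (P \<union> \<epsilon> ` Q)"
    by (simp add: compactin_subtopology)
  moreover have "generate (G'\<lparr>carrier := K\<rparr>) (P \<union> \<epsilon> ` Q) = K"
  proof -
    have PQG: "P \<union> \<epsilon> ` Q \<subseteq> carrier G'" using PQK subgroup.subset[OF K(1)] by blast
    have s: "subgroup (generate G' (P \<union> \<epsilon> ` Q)) G'"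
      using G'.generate_is_subgroup[OF PQG] .
    have "H = generate G' P"
      using G'.generate_consistent[OF PQ(2) H(1)] P(2) by simp
    then have "H \<subseteq> generate G' (P \<union> \<epsilon> ` Q)" using G'.mono_generate[of P "P \<union> \<epsilon> ` Q"] by simp
    moreover have "\<epsilon> ` C = generate G' (\<epsilon> ` Q)"
      using G.generate_consistent[OF PQ(4) C(1)] Q(2)
        generate_img[of Q] PQ(4) subgroup.subset[OF C(1)] by simp
    then have "\<epsilon> ` C \<subseteq> generate G' (P \<union> \<epsilon> ` Q)"
      using G'.mono_generate[of "\<epsilon> ` Q" "P \<union> \<epsilon> ` Q"] by simp
    ultimately have "K \<subseteq> generate G' (P \<union> \<epsilon> ` Q)"
      unfolding K_def by (intro G'.generate_subgroup_incl[OF _ s]) simp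
    moreover have "generate G' (P \<union> \<epsilon> ` Q) \<subseteq> K"
      using G'.generate_subgroup_incl[OF PQK K(1)] .
    ultimately show ?thesis
      using G'.generate_consistent[OF PQK K(1)] by simp
  qed
  ultimately show ?thesis unfolding compactly_generated_def by auto
qed

text \<open>
  Suppose that \<open>C\<close> contains elements conjugating \<open>W\<close> into any given neighbourhood of the
  identity. Then every open normal subgroup of the group generated by \<open>H\<close> and \<open>C\<close> contains \<open>W\<close>,
  hence \<open>H\<close>; so passing to the residual of this group costs nothing in \<open>H\<close>.
\<close>

theorem height_ge_generate:
  assumes tg: "topological_group G T" "topological_group G' T'"
    and \<epsilon>: "\<epsilon> \<in> hom G G'" "continuous_map T T' \<epsilon>"
    and H: "subgroup H G'" "compactly_generated (G'\<lparr>carrier := H\<rparr>) (subtopology T' H)"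
    and W: "W \<subseteq> H" "\<And>N. N \<lhd> G'\<lparr>carrier := H\<rparr> \<Longrightarrow> W \<subseteq> N \<Longrightarrow> H \<subseteq> N"
    and displace: "\<And>C Y. subgroup C G \<Longrightarrow> infinite ((\<lambda>c. c 0) ` C) \<Longrightarrow> openin T' Y \<Longrightarrow>
      \<one>\<^bsub>G'\<^esub> \<in> Y \<Longrightarrow> \<exists>c\<in>C. \<forall>w\<in>W. \<epsilon> c \<otimes>\<^bsub>G'\<^esub> w \<otimes>\<^bsub>G'\<^esub> inv\<^bsub>G'\<^esub> \<epsilon> c \<in> Y"
    and orbit: "\<And>C. subgroup C G \<Longrightarrow> infinite ((\<lambda>c. c 0) ` C) \<Longrightarrow> infinite ((\<lambda>c. \<epsilon> c 0) ` C)"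
    and height: "height_ge G' T' H \<delta>" "height_ge G T B \<theta>"
  shows "height_ge G' T' (generate G' (H \<union> \<epsilon> ` B)) (\<delta> + \<theta>)"
  using height(2)
proof (induction \<theta> arbitrary: B rule: less_induct)
  case (less \<theta>)
  interpret G: topological_group G T by fact
  interpret G': topological_group G' T' by fact
  interpret group_hom G G' \<epsilon> using \<epsilon>(1) by unfold_locales
  have HG: "H \<subseteq> carrier G'" using subgroup.subset[OF H(1)] .
  have B: "subgroup B G" using less.prems by (rule height_ge_subgroup)
  have sub: "H \<union> \<epsilon> ` C \<subseteq> carrier G'" if "subgroup C G" for C
    using HG subgroup.subset[OF that] by auto
  have gen: "subgroup (generate G' (H \<union> \<epsilon> ` C)) G'" if "subgroup C G" for C
    using G'.generate_is_subgroup[OF sub[OF that]] .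
  have incl: "H \<subseteq> generate G' (H \<union> \<epsilon> ` C)" "\<epsilon> ` C \<subseteq> generate G' (H \<union> \<epsilon> ` C)" for C
    by (auto intro: generate.incl)
  show ?case
  proof (rule height_geI[OF gen[OF B]])
    fix \<gamma> assume \<gamma>: "\<gamma> < \<delta> + \<theta>"
    show "\<exists>C. subgroup C G' \<and> C \<subseteq> generate G' (H \<union> \<epsilon> ` B) \<and>
        compactly_generated (G'\<lparr>carrier := C\<rparr>) (subtopology T' C) \<and> infinite ((\<lambda>c. c 0) ` C) \<and>
        height_ge G' T' (residual_in G' T' C) \<gamma>"
    proof (cases "\<gamma> < \<delta>")
      case True
      obtain C where "subgroup C G'" "C \<subseteq> H"
        "compactly_generated (G'\<lparr>carrier := C\<rparr>) (subtopology T' C)"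
        "infinite ((\<lambda>c. c 0) ` C)" "height_ge G' T' (residual_in G' T' C) \<gamma>"
        by (rule height_geE[OF height(1) True])
      then show ?thesis using incl(1)[of B] by blast
    next
      case False
      \<comment> \<open>As H survives in every residual taken along B, its height \<delta> is still
        available when that of B is used up; this is why \<delta> is the left summand. A \<gamma>
        below \<delta> + \<theta> but not below \<delta> is bounded by some \<delta> + \<eta>, and C
        is chosen for this \<eta>.\<close>
      have "\<exists>\<eta><\<theta>. \<gamma> \<le> \<delta> + \<eta>"
      proof (rule ccontr)
        assume "\<not> ?thesis"
        then have "ord_succ (\<delta> + \<eta>) \<le> \<gamma>" if "\<eta> < \<theta>" for \<eta>
          using that by (auto simp: ord_succ_le_iff not_le[symmetric])
        then have "\<delta> + \<theta> \<le> \<gamma>"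
          using False by (simp add: ord_add_le_iff[of \<delta> \<theta>])
        with \<gamma> show False by simp
      qed
      then obtain \<eta> where \<eta>: "\<eta> < \<theta>" "\<gamma> \<le> \<delta> + \<eta>" by blast
      obtain C where C: "subgroup C G" "C \<subseteq> B"
        "compactly_generated (G\<lparr>carrier := C\<rparr>) (subtopology T C)"
        "infinite ((\<lambda>c. c 0) ` C)" "height_ge G T (residual_in G T C) \<eta>"
        by (rule height_geE[OF less.prems \<eta>(1)])
      define K where "K = generate G' (H \<union> \<epsilon> ` C)"
      have K: "subgroup K G'" "H \<subseteq> K" "\<epsilon> ` C \<subseteq> K"
        using gen[OF C(1)] incl by (auto simp: K_def)
      interpret K: topological_group "G'\<lparr>carrier := K\<rparr>" "subtopology T' K"
        using G'.topological_group_subgroup[OF K(1)] .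
      have res: "subgroup (residual_in G' T' K) G'" using G'.residual_in_subgroup[OF K(1)] .
      have RC: "subgroup (residual_in G T C) G" using G.residual_in_subgroup[OF C(1)] .
      have "H \<subseteq> residual_in G' T' K"
        unfolding residual_in_def discrete_residual_def
      proof (rule Inter_greatest)
        fix N assume "N \<in> {N. N \<lhd> G'\<lparr>carrier := K\<rparr> \<and> openin (subtopology T' K) N}"
        then have N: "N \<lhd> G'\<lparr>carrier := K\<rparr>" "openin (subtopology T' K) N" by auto
        interpret N: normal N "G'\<lparr>carrier := K\<rparr>" by fact
        obtain O' where O': "openin T' O'" "N = O' \<inter> K"
          using N(2) by (auto simp: openin_subtopology)
        have one: "\<one>\<^bsub>G'\<^esub> \<in> O'" using N.one_closed O'(2) by simp
        obtain c where c: "c \<in> C" "\<And>w. w \<in> W \<Longrightarrow> \<epsilon> c \<otimes>\<^bsub>G'\<^esub> w \<otimes>\<^bsub>G'\<^esub> inv\<^bsub>G'\<^esub> \<epsilon> c \<in> O'"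
          using displace[OF C(1,4) O'(1) one] by blast
        have cK: "\<epsilon> c \<in> K" using c(1) K(3) by blast
        have "W \<subseteq> N"
        proof
          fix w assume w: "w \<in> W"
          have wK: "w \<in> K" using w W(1) K(2) by blast
          have cG: "\<epsilon> c \<in> carrier G'" "w \<in> carrier G'"
            using cK wK subgroup.subset[OF K(1)] by auto
          let ?v = "\<epsilon> c \<otimes>\<^bsub>G'\<^esub> w \<otimes>\<^bsub>G'\<^esub> inv\<^bsub>G'\<^esub> \<epsilon> c"
          have "?v \<in> K"
            using subgroup.m_closed[OF K(1)] subgroup.m_inv_closed[OF K(1)] cK wK by blast
          then have v: "?v \<in> N" using c(2)[OF w] O'(2) by simp
          have "inv\<^bsub>G'\<^esub> \<epsilon> c \<otimes>\<^bsub>G'\<^esub> ?v \<otimes>\<^bsub>G'\<^esub> \<epsilon> c \<in> N"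
            using N.inv_op_closed1[OF _ v, of "\<epsilon> c"] cK by (simp add: G'.m_inv_consistent[OF K(1)])
          moreover have "inv\<^bsub>G'\<^esub> \<epsilon> c \<otimes>\<^bsub>G'\<^esub> ?v \<otimes>\<^bsub>G'\<^esub> \<epsilon> c = w"
            using cG by (simp add: G'.m_assoc G'.inv_solve_left')
          ultimately show "w \<in> N" by simp
        qed
        moreover have "N \<inter> H \<lhd> (G'\<lparr>carrier := K\<rparr>)\<lparr>carrier := H\<rparr>"
          using K.normal_Int_subgroup[OF G'.subgroup_incl[OF H(1) K(1,2)] N(1)] .
        ultimately have "H \<subseteq> N \<inter> H" using W(2)[of "N \<inter> H"] W(1) by simp
        then show "H \<subseteq> N" by blast
      qed
      moreover have "\<epsilon> ` residual_in G T C \<subseteq> residual_in G' T' K"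
        using hom_residual_in[OF tg(2,1) \<epsilon> C(1) K(1,3)] .
      ultimately have le: "generate G' (H \<union> \<epsilon> ` residual_in G T C) \<subseteq> residual_in G' T' K"
        by (intro G'.generate_subgroup_incl[OF _ res] Un_least)
      have "height_ge G' T' (residual_in G' T' K) \<gamma>"
        by (rule height_ge_mono[OF less.IH[OF \<eta>(1) C(5)] res le \<eta>(2)])
      moreover have "compactly_generated (G'\<lparr>carrier := K\<rparr>) (subtopology T' K)"
        unfolding K_def using compactly_generated_generate[OF tg \<epsilon> H C(1,3)] .
      moreover have "infinite ((\<lambda>c. c 0) ` K)"
      proof -
        have "(\<lambda>c. \<epsilon> c 0) ` C \<subseteq> (\<lambda>c. c 0) ` K" using K(3) by blast
        then show ?thesis using orbit[OF C(1,4)] finite_subset by blast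
      qed
      moreover have "K \<subseteq> generate G' (H \<union> \<epsilon> ` B)"
        unfolding K_def by (rule G'.mono_generate) (use C(2) in blast)
      ultimately show ?thesis using K(1) by blast
    qed
  qed
qed

section \<open>Elementary groups with a decomposition rank\<close>

definition ranked_elementary :: "(nat \<Rightarrow> nat) monoid \<Rightarrow> (nat \<Rightarrow> nat) topology \<Rightarrow> bool"
  where "ranked_elementary G T \<longleftrightarrow> elementary G T \<and> ranked G T"

lemma ranked_elementary_imp_tdlcsc_group: "ranked_elementary G T \<Longrightarrow> tdlcsc_group G T"
  by (simp add: ranked_elementary_def elementary_imp_tdlcsc_group)

lemma ranked_elementary_closed_subgroup:
  assumes "ranked_elementary G T" "subgroup H G" "closedin T H"
  shows "ranked_elementary (G\<lparr>carrier := H\<rparr>) (subtopology T H)"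
  using assms ranked_closed_subgroup elementary.closed_subgroup elementary_imp_tdlcsc_group
  unfolding ranked_elementary_def by blast

lemma ranked_elementary_increasing_union:
  assumes "tdlcsc_group G T" "incseq W" "(\<Union>i :: nat. W i) = carrier G"
    and "\<And>i. subgroup (W i) G" "\<And>i. openin T (W i)"
    and "\<And>i. ranked_elementary (G\<lparr>carrier := W i\<rparr>) (subtopology T (W i))"
  shows "ranked_elementary G T"
  unfolding ranked_elementary_def
proof
  show "elementary G T"
    by (rule elementary.increasing_union[OF assms(1) _ assms(2,3)])
      (use assms in \<open>auto simp: ranked_elementary_def\<close>)
  show "ranked G T"
    by (rule ranked_increasing_union[OF assms(1-5)])
      (use assms(6) in \<open>auto simp: ranked_elementary_def\<close>)
qed

lemma ranked_elementary_compact: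
  assumes "tdlcsc_group G T" "compact_space T"
    and "\<And>U. openin T U \<Longrightarrow> \<one>\<^bsub>G\<^esub> \<in> U \<Longrightarrow> \<exists>N. N \<lhd> G \<and> openin T N \<and> N \<subseteq> U"
  shows "ranked_elementary G T"
  unfolding ranked_elementary_def
  using ranked_if_open_normal_basis[OF assms(1,3)] elementary.profinite[OF assms(1,2)] by blast

lemma ranked_elementary_discrete:
  assumes "group G" "countable (carrier G)"
  shows "ranked_elementary G (discrete_topology (carrier G))"
  unfolding ranked_elementary_def
proof
  interpret group G by fact
  show "elementary G (discrete_topology (carrier G))" using assms by (simp add: elementary.discrete)
  show "ranked G (discrete_topology (carrier G))"
    by (rule ranked_if_open_normal_basis[OF tdlcsc_group_discrete[OF assms(2)]])
      (use one_is_normal in \<open>auto intro!: exI[of _ "{\<one>\<^bsub>G\<^esub>}"]\<close>)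
qed

text \<open>A continuous section makes \<phi> a retraction, hence a quotient map; the bijection
  induced on cosets is then a homeomorphism. It supplies the copy of the quotient that the rule
  \<open>elementary.extension\<close> asks for.\<close>

lemma topological_group_iso_if_section:
  assumes tg: "topological_group H S" "topological_group Q R"
    and \<phi>: "\<phi> \<in> hom H Q" "continuous_map S R \<phi>"
    and \<psi>: "continuous_map R S \<psi>" "\<And>q. q \<in> carrier Q \<Longrightarrow> \<phi> (\<psi> q) = q"
  shows "topological_group_iso (H Mod kernel H Q \<phi>) (coset_topology H S (kernel H Q \<phi>)) Q R"
proof -
  interpret H: topological_group H S by fact
  interpret Q: topological_group Q R by fact
  interpret group_hom H Q \<phi> using \<phi>(1) by unfold_locales
  let ?N = "kernel H Q \<phi>"
  let ?h = "\<lambda>Y. the_elem (\<phi> ` Y)"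
  have N: "subgroup ?N H" by (rule subgroup_kernel)
  have "\<psi> q \<in> carrier H" if "q \<in> carrier Q" for q
    using \<psi>(1) that by (auto simp: continuous_map_def H.topspace_eq_carrier Q.topspace_eq_carrier)
  then have "\<phi> ` carrier H = carrier Q"
    using \<psi>(2) hom_closed by (metis image_eqI subsetI image_subset_iff subset_antisym)
  then have iso: "?h \<in> iso (H Mod ?N) Q" by (rule FactGroup_iso_set)
  have "retraction_map S R \<phi>"
    unfolding retraction_map_def retraction_maps_def using \<phi>(2) \<psi> by (auto simp: Q.topspace_eq_carrier)
  then have quot: "quotient_map S R \<phi>" by (rule retraction_imp_quotient_map)
  have eq: "?h (?N #>\<^bsub>H\<^esub> x) = \<phi> x" if "x \<in> carrier H" for x
  proof -
    have "\<phi> ` (?N #>\<^bsub>H\<^esub> x) = {\<phi> x}"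
      using that N by (auto simp: r_coset_def kernel_def image_iff intro!: exI[of _ "\<one>\<^bsub>H\<^esub>"])
    then show ?thesis by simp
  qed
  have q: "quotient_map S (coset_topology H S ?N) (\<lambda>x. ?N #>\<^bsub>H\<^esub> x)"
    using H.quotient_map_coset_topology[OF N] .
  have "quotient_map S R (?h \<circ> (\<lambda>x. ?N #>\<^bsub>H\<^esub> x))"
    using quot by (rule quotient_map_eq) (simp add: H.topspace_eq_carrier eq)
  then have "quotient_map (coset_topology H S ?N) R ?h"
    using quotient_map_compose_eq[OF q] by blast
  moreover have "topspace (coset_topology H S ?N) = carrier (H Mod ?N)"
    using quotient_imp_surjective_map[OF q]
    by (auto simp: FactGroup_def RCOSETS_def H.topspace_eq_carrier)
  then have "inj_on ?h (topspace (coset_topology H S ?N))"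
    using iso by (simp add: iso_def bij_betw_def)
  ultimately show ?thesis
    using iso unfolding topological_group_iso_def homeomorphic_map_def by blast
qed

lemma ranked_elementary_extension:
  assumes H: "tdlcsc_group H S" and Q: "ranked_elementary Q R"
    and \<phi>: "\<phi> \<in> hom H Q" "continuous_map S R \<phi>"
    and \<psi>: "continuous_map R S \<psi>" "\<And>q. q \<in> carrier Q \<Longrightarrow> \<phi> (\<psi> q) = q"
    and N: "ranked_elementary (H\<lparr>carrier := kernel H Q \<phi>\<rparr>) (subtopology S (kernel H Q \<phi>))"
  shows "ranked_elementary H S"
proof -
  interpret H: tdlcsc_group H S by fact
  interpret Q: tdlcsc_group Q R using ranked_elementary_imp_tdlcsc_group[OF Q] .
  interpret group_hom H Q \<phi> using \<phi>(1) by unfold_locales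
  have "closedin R {\<one>\<^bsub>Q\<^esub>}"
    using Q.Hausdorff Q.one_closed by (simp add: closedin_Hausdorff_singleton Q.topspace_eq_carrier)
  from closedin_continuous_map_preimage[OF \<phi>(2) this] have "closedin S (kernel H Q \<phi>)"
    by (simp add: kernel_def H.topspace_eq_carrier)
  then have "elementary H S"
    using elementary.extension[OF H normal_kernel] N Q
      topological_group_iso_if_section[OF H.topological_group_axioms Q.topological_group_axioms \<phi> \<psi>(1)] \<psi>(2)
    by (auto simp: ranked_elementary_def)
  moreover have "ranked H S"
    using ranked_extension[OF _ Q.topological_group_axioms Q.Hausdorff H \<phi>] N Q
    by (auto simp: ranked_elementary_def)
  ultimately show ?thesis by (simp add: ranked_elementary_def)
qed

section \<open>Permutation groups with a compact open subgroup\<close>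

abbreviation pinv :: "('a \<Rightarrow> 'a) \<Rightarrow> 'a \<Rightarrow> 'a"
  where "pinv \<equiv> inv_into UNIV"

definition pg :: "('a \<Rightarrow> 'a) set \<Rightarrow> ('a \<Rightarrow> 'a) monoid"
  where "pg P = \<lparr>carrier = P, monoid.mult = (\<circ>), one = id\<rparr>"

definition perm_group :: "('a \<Rightarrow> 'a) set \<Rightarrow> bool"
  where "perm_group P \<longleftrightarrow> id \<in> P \<and> (\<forall>g\<in>P. bij g \<and> pinv g \<in> P \<and> (\<forall>h\<in>P. g \<circ> h \<in> P))"

lemma pg_simps [simp]: "carrier (pg P) = P" "x \<otimes>\<^bsub>pg P\<^esub> y = x \<circ> y" "\<one>\<^bsub>pg P\<^esub> = id"
  "pg P\<lparr>carrier := Q\<rparr> = pg Q"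
  by (simp_all add: pg_def)

lemma perm_groupD:
  assumes "perm_group P"
  shows "id \<in> P" "g \<in> P \<Longrightarrow> bij g" "g \<in> P \<Longrightarrow> pinv g \<in> P" "g \<in> P \<Longrightarrow> h \<in> P \<Longrightarrow> g \<circ> h \<in> P"
  using assms by (auto simp: perm_group_def)

lemma bij_pinv_simps [simp]:
  assumes "bij g"
  shows "g (pinv g x) = x" "pinv g (g x) = x" "g \<circ> pinv g = id" "pinv g \<circ> g = id" "bij (pinv g)"
    "pinv (pinv g) = g"
  using assms
  by (auto simp: bij_is_inj bij_is_surj surj_f_inv_f inv_f_f bij_imp_bij_inv inv_inv_eq fun_eq_iff)

lemma group_pg:
  assumes "perm_group P"
  shows "group (pg P)"
proof (rule groupI)
  fix x assume "x \<in> carrier (pg P)"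
  then show "\<exists>y\<in>carrier (pg P). y \<otimes>\<^bsub>pg P\<^esub> x = \<one>\<^bsub>pg P\<^esub>"
    using perm_groupD[OF assms] by (intro bexI[of _ "pinv x"]) auto
qed (use perm_groupD[OF assms] in \<open>auto simp: comp_assoc\<close>)

lemma m_inv_pg [simp]:
  assumes "perm_group P" "g \<in> P"
  shows "inv\<^bsub>pg P\<^esub> g = pinv g"
  using group.inv_equality[OF group_pg[OF assms(1)], of "pinv g" g] perm_groupD[OF assms(1)] assms(2)
  by simp

lemma subgroup_pg_iff:
  assumes "perm_group P"
  shows "subgroup H (pg P) \<longleftrightarrow> H \<subseteq> P \<and> perm_group H"
proof
  assume H: "subgroup H (pg P)"
  then have HP: "H \<subseteq> P" using subgroup.subset by fastforce
  have "pinv g \<in> H" if "g \<in> H" for g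
    using subgroup.m_inv_closed[OF H that] HP that m_inv_pg[OF assms] by auto
  moreover have "g \<circ> h \<in> H" if "g \<in> H" "h \<in> H" for g h
    using subgroup.m_closed[OF H that] by simp
  moreover have "id \<in> H" using subgroup.one_closed[OF H] by simp
  ultimately show "H \<subseteq> P \<and> perm_group H"
    using HP perm_groupD(2)[OF assms] by (auto simp: perm_group_def)
next
  assume H: "H \<subseteq> P \<and> perm_group H"
  then show "subgroup H (pg P)"
    using perm_groupD[of H] m_inv_pg[OF assms] group.subgroupI[OF group_pg[OF assms], of H]
    by (metis empty_iff pg_simps(1,2) subset_iff)
qed

definition stab :: "(nat \<Rightarrow> nat) set \<Rightarrow> nat set \<Rightarrow> (nat \<Rightarrow> nat) set"
  where "stab U E = {u \<in> U. \<forall>x\<in>E. u x = x}"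

lemma stab_mono: "E \<subseteq> E' \<Longrightarrow> stab U E' \<subseteq> stab U E"
  by (auto simp: stab_def)

lemma stab_Un: "stab U (E \<union> E') = stab U E \<inter> stab U E'"
  by (auto simp: stab_def)

lemma perm_group_stab:
  assumes "perm_group U"
  shows "perm_group (stab U E)"
  unfolding perm_group_def
proof (intro conjI ballI)
  fix g assume g: "g \<in> stab U E"
  then have "bij g" using perm_groupD(2)[OF assms] by (auto simp: stab_def)
  then show "bij g" "pinv g \<in> stab U E"
    using g perm_groupD(3)[OF assms] by (auto simp: stab_def) (metis bij_pinv_simps(2))
qed (use perm_groupD[OF assms] in \<open>auto simp: stab_def\<close>)

text \<open>\<open>U\<close> carries the topology of pointwise convergence and is open in \<open>G\<close>.\<close>

definition ptop :: "(nat \<Rightarrow> nat) set \<Rightarrow> (nat \<Rightarrow> nat) set \<Rightarrow> (nat \<Rightarrow> nat) topology"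
  where "ptop G U = topology (\<lambda>Y. Y \<subseteq> G \<and> (\<forall>g\<in>Y. \<exists>E. finite E \<and> (\<forall>u\<in>stab U E. g \<circ> u \<in> Y)))"

lemma openin_ptop:
  "openin (ptop G U) Y \<longleftrightarrow> Y \<subseteq> G \<and> (\<forall>g\<in>Y. \<exists>E. finite E \<and> (\<forall>u\<in>stab U E. g \<circ> u \<in> Y))"
proof -
  let ?P = "\<lambda>Y. Y \<subseteq> G \<and> (\<forall>g\<in>Y. \<exists>E. finite E \<and> (\<forall>u\<in>stab U E. g \<circ> u \<in> Y))"
  have "istopology ?P"
    unfolding istopology_def
  proof (intro conjI allI impI ballI)
    fix S T g assume S: "?P S" and T: "?P T" and g: "g \<in> S \<inter> T"
    obtain E where "finite E" "\<forall>u\<in>stab U E. g \<circ> u \<in> S" using S g by blast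
    moreover obtain E' where "finite E'" "\<forall>u\<in>stab U E'. g \<circ> u \<in> T" using T g by blast
    ultimately show "\<exists>E. finite E \<and> (\<forall>u\<in>stab U E. g \<circ> u \<in> S \<inter> T)"
      by (intro exI[of _ "E \<union> E'"]) (simp add: stab_Un)
  next
    fix \<K> g assume K: "\<forall>K\<in>\<K>. ?P K" and g: "g \<in> \<Union>\<K>"
    then obtain K where "K \<in> \<K>" "g \<in> K" by blast
    with K obtain E where "finite E" "\<forall>u\<in>stab U E. g \<circ> u \<in> K" by blast
    with \<open>K \<in> \<K>\<close> show "\<exists>E. finite E \<and> (\<forall>u\<in>stab U E. g \<circ> u \<in> \<Union>\<K>)" by blast
  qed blast+
  then show ?thesis by (simp add: ptop_def topology_inverse')
qed

lemma topspace_ptop [simp]: "U \<subseteq> G \<Longrightarrow> perm_group G \<Longrightarrow> topspace (ptop G U) = G"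
proof -
  assume "U \<subseteq> G" "perm_group G"
  then have "openin (ptop G U) G"
    by (auto simp: openin_ptop stab_def dest: perm_groupD(4))
  then show ?thesis
    by (meson openin_ptop openin_subset openin_topspace subset_antisym)
qed

lemma subtopology_ptop:
  assumes "perm_group G" "U \<subseteq> G" "perm_group U" "perm_group H" "H \<subseteq> G"
  shows "subtopology (ptop G U) H = ptop H (U \<inter> H)"
proof (rule topology_eq[THEN iffD2], intro allI iffI)
  fix Y assume "openin (subtopology (ptop G U) H) Y"
  then obtain Z where Z: "openin (ptop G U) Z" "Y = Z \<inter> H" by (auto simp: openin_subtopology)
  have "\<exists>E. finite E \<and> (\<forall>u\<in>stab (U \<inter> H) E. g \<circ> u \<in> Y)" if g: "g \<in> Y" for g
  proof -
    obtain E where "finite E" "\<forall>u\<in>stab U E. g \<circ> u \<in> Z"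
      using Z g by (auto simp: openin_ptop)
    then show ?thesis
      using g Z(2) perm_groupD(4)[OF assms(4)] by (intro exI[of _ E]) (auto simp: stab_def)
  qed
  then show "openin (ptop H (U \<inter> H)) Y" using Z(2) by (auto simp: openin_ptop)
next
  fix Y assume Y: "openin (ptop H (U \<inter> H)) Y"
  then obtain E where E: "\<And>g. g \<in> Y \<Longrightarrow> finite (E g)"
    "\<And>g u. g \<in> Y \<Longrightarrow> u \<in> stab (U \<inter> H) (E g) \<Longrightarrow> g \<circ> u \<in> Y" "Y \<subseteq> H"
    by (auto simp: openin_ptop) metis
  \<comment> \<open>A union of cosets of stabilisers in all of U. If g composed with u lies in H,
    then so does u, because g does; this gives back Y on intersecting with H.\<close>
  define Z where "Z = {g \<circ> u | g u. g \<in> Y \<and> u \<in> stab U (E g)}"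
  have "openin (ptop G U) Z"
    unfolding openin_ptop
  proof (intro conjI ballI)
    show "Z \<subseteq> G"
      using subsetD[OF E(3)] subsetD[OF assms(2)] subsetD[OF assms(5)] perm_groupD(4)[OF assms(1)]
      by (auto simp: Z_def stab_def)
    fix k assume "k \<in> Z"
    then obtain g u where k: "k = g \<circ> u" "g \<in> Y" "u \<in> stab U (E g)" by (auto simp: Z_def)
    have "k \<circ> v \<in> Z" if "v \<in> stab U (E g)" for v
    proof -
      have "u \<circ> v \<in> stab U (E g)"
        using perm_groupD(4)[OF perm_group_stab[OF assms(3)]] k(3) that .
      then show ?thesis using k by (auto simp: Z_def comp_assoc)
    qed
    then show "\<exists>E. finite E \<and> (\<forall>u\<in>stab U E. k \<circ> u \<in> Z)" using E(1)[OF k(2)] by blast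
  qed
  moreover have "Y = Z \<inter> H"
  proof
    show "Y \<subseteq> Z \<inter> H"
    proof
      fix g assume g: "g \<in> Y"
      then have "g \<circ> id \<in> Z"
        using perm_groupD(1)[OF perm_group_stab[OF assms(3)]] unfolding Z_def by blast
      then show "g \<in> Z \<inter> H" using g E(3) by auto
    qed
    show "Z \<inter> H \<subseteq> Y"
    proof
      fix k assume "k \<in> Z \<inter> H"
      then obtain g u where k: "k = g \<circ> u" "g \<in> Y" "u \<in> stab U (E g)" "k \<in> H"
        by (auto simp: Z_def)
      have gH: "g \<in> H" using k(2) E(3) by blast
      have "pinv g \<circ> k \<in> H" using perm_groupD(3,4)[OF assms(4)] k(4) gH by blast
      moreover have "pinv g \<circ> k = u"
        using perm_groupD(2)[OF assms(4) gH] k(1) by (simp add: comp_assoc[symmetric])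
      ultimately have "u \<in> stab (U \<inter> H) (E g)" using k(3) by (simp add: stab_def)
      then show "k \<in> Y" using E(2) k by blast
    qed
  qed
  ultimately show "openin (subtopology (ptop G U) H) Y" by (auto simp: openin_subtopology)
qed

text \<open>The basic neighbourhoods of g are its left cosets of stabilisers, so continuity reduces
  to continuity at the identity.\<close>

lemma continuous_map_ptop:
  assumes "perm_group H" "V \<subseteq> H" "perm_group G" "U \<subseteq> G"
    and hom: "\<And>g. g \<in> H \<Longrightarrow> \<phi> g \<in> G" "\<And>g h. g \<in> H \<Longrightarrow> h \<in> V \<Longrightarrow> \<phi> (g \<circ> h) = \<phi> g \<circ> \<phi> h"
    and nhd: "\<And>E. finite E \<Longrightarrow> \<exists>F. finite F \<and> (\<forall>v\<in>stab V F. \<phi> v \<in> stab U E)"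
  shows "continuous_map (ptop H V) (ptop G U) \<phi>"
  unfolding continuous_map
proof (intro conjI allI impI)
  show "\<phi> ` topspace (ptop H V) \<subseteq> topspace (ptop G U)" using assms by auto
  fix Y assume Y: "openin (ptop G U) Y"
  have "\<exists>F. finite F \<and> (\<forall>v\<in>stab V F. g \<circ> v \<in> {x \<in> topspace (ptop H V). \<phi> x \<in> Y})"
    if g: "g \<in> H" "\<phi> g \<in> Y" for g
  proof -
    obtain E where E: "finite E" "\<forall>u\<in>stab U E. \<phi> g \<circ> u \<in> Y"
      using Y g(2) by (auto simp: openin_ptop)
    obtain F where F: "finite F" "\<forall>v\<in>stab V F. \<phi> v \<in> stab U E" using nhd[OF E(1)] by blast
    have "g \<circ> v \<in> H \<and> \<phi> (g \<circ> v) \<in> Y" if "v \<in> stab V F" for v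
    proof -
      have "v \<in> V" using that by (simp add: stab_def)
      then show ?thesis
        using that E(2) F(2) hom(2)[OF g(1), of v] perm_groupD(4)[OF assms(1) g(1)] assms(2) by auto
    qed
    then show ?thesis using F(1) assms(1,2) by auto
  qed
  then show "openin (ptop H V) {x \<in> topspace (ptop H V). \<phi> x \<in> Y}"
    using assms(1,2) by (auto simp: openin_ptop)
qed

lemma open_cylinder: "finite E \<Longrightarrow> open {k :: nat \<Rightarrow> nat. \<forall>x\<in>E. k x = g x}"
proof -
  assume "finite E"
  moreover have "{k :: nat \<Rightarrow> nat. \<forall>x\<in>E. k x = g x} = (\<Inter>x\<in>E. (\<lambda>k. k x) -` {g x})" by auto
  moreover have "open ((\<lambda>k :: nat \<Rightarrow> nat. k x) -` {g x})" for x
    by (rule open_vimage) (auto intro: continuous_on_product_coordinates open_discrete)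
  ultimately show ?thesis by (simp add: open_INT)
qed

lemma compact_if_finite_orbits:
  fixes U :: "(nat \<Rightarrow> nat) set"
  assumes "closed U" "\<And>x. finite ((\<lambda>u. u x) ` U)"
  shows "compact U"
proof -
  let ?P = "PiE UNIV (\<lambda>x. (\<lambda>u. u x) ` U)"
  have "compactin (product_topology (\<lambda>_. euclidean) UNIV) ?P"
    using assms(2) by (subst compactin_PiE) (auto intro: finite_imp_compact)
  then have "compact ?P" by (simp add: euclidean_product_topology)
  moreover have "U \<subseteq> ?P" by auto
  ultimately show ?thesis using assms(1) by (metis closed_Int_compact inf.absorb1)
qed

text \<open>\<open>commensurated\<close> makes conjugation continuous at the identity, and with it
  multiplication and inversion. \<open>countable_index\<close> expresses, by a function that
  separates the left cosets of U, that there are countably many of them; this yields second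
  countability. \<open>closed\<close> and \<open>finite_orbits\<close> make U compact.\<close>

locale lc_perm_group =
  fixes G U :: "(nat \<Rightarrow> nat) set"
  assumes perm_group: "perm_group G" "perm_group U" "U \<subseteq> G"
    and commensurated: "g \<in> G \<Longrightarrow> \<exists>E. finite E \<and> (\<forall>u\<in>stab U E. pinv g \<circ> u \<circ> g \<in> U)"
    and countable_index: "\<exists>c :: (nat \<Rightarrow> nat) \<Rightarrow> nat. \<forall>g\<in>G. \<forall>h\<in>G. c g = c h \<longrightarrow> pinv g \<circ> h \<in> U"
    and closed: "closed U"
    and finite_orbits: "finite ((\<lambda>u. u x) ` U)"
begin

lemmas G = perm_groupD[OF perm_group(1)]
lemmas U = perm_groupD[OF perm_group(2)]

lemma conj_stab:
  assumes "h \<in> G" "finite E"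
  shows "\<exists>F. finite F \<and> (\<forall>u\<in>stab U F. pinv h \<circ> u \<circ> h \<in> stab U E)"
proof -
  obtain F where F: "finite F" "\<forall>u\<in>stab U F. pinv h \<circ> u \<circ> h \<in> U"
    using commensurated[OF assms(1)] by blast
  have "\<forall>u\<in>stab U (F \<union> h ` E). pinv h \<circ> u \<circ> h \<in> stab U E"
    using F(2) G(2)[OF assms(1)] by (auto simp: stab_def)
  then show ?thesis using F(1) assms(2) by (intro exI[of _ "F \<union> h ` E"]) simp
qed

lemma openin_coset:
  assumes "g \<in> G" "finite E"
  shows "openin (ptop G U) {g \<circ> u | u. u \<in> stab U E}"
  unfolding openin_ptop
proof (intro conjI ballI)
  show "{g \<circ> u | u. u \<in> stab U E} \<subseteq> G"
    using assms G(4) perm_group(3) by (auto simp: stab_def)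
  fix k assume "k \<in> {g \<circ> u | u. u \<in> stab U E}"
  then obtain u where u: "k = g \<circ> u" "u \<in> stab U E" by blast
  have "k \<circ> v \<in> {g \<circ> u | u. u \<in> stab U E}" if "v \<in> stab U E" for v
  proof -
    have "u \<circ> v \<in> stab U E"
      using perm_groupD(4)[OF perm_group_stab[OF perm_group(2)] u(2) that] .
    then show ?thesis using u(1) by (auto simp: comp_assoc)
  qed
  then show "\<exists>F. finite F \<and> (\<forall>v\<in>stab U F. k \<circ> v \<in> {g \<circ> u | u. u \<in> stab U E})"
    using assms(2) by blast
qed

lemma topspace [simp]: "topspace (ptop G U) = G"
  using perm_group by simp

lemma topological_group: "topological_group (pg G) (ptop G U)"
proof -
  interpret group "pg G" using group_pg[OF perm_group(1)] .
  let ?T = "ptop G U"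
  have id: "id \<in> stab U E" for E by (simp add: stab_def U(1))
  show ?thesis
  proof
    show "topspace ?T = carrier (pg G)" by simp
    show "continuous_map (prod_topology ?T ?T) ?T (\<lambda>(x, y). x \<otimes>\<^bsub>pg G\<^esub> y)"
      unfolding continuous_map
    proof (intro conjI allI impI)
      show "(\<lambda>(x, y). x \<otimes>\<^bsub>pg G\<^esub> y) ` topspace (prod_topology ?T ?T) \<subseteq> topspace ?T"
        using G(4) by auto
      fix Y assume Y: "openin ?T Y"
      let ?P = "{z \<in> topspace (prod_topology ?T ?T). (case z of (x, y) \<Rightarrow> x \<otimes>\<^bsub>pg G\<^esub> y) \<in> Y}"
      show "openin (prod_topology ?T ?T) ?P"
        unfolding openin_prod_topology_alt
      proof (intro allI impI)
        fix g h assume "(g, h) \<in> ?P"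
        then have gh: "g \<in> G" "h \<in> G" "g \<circ> h \<in> Y" by auto
        obtain E where E: "finite E" "\<forall>u\<in>stab U E. g \<circ> h \<circ> u \<in> Y"
          using Y gh(3) by (auto simp: openin_ptop)
        obtain F where F: "finite F" "\<forall>u\<in>stab U F. pinv h \<circ> u \<circ> h \<in> stab U E"
          using conj_stab[OF gh(2) E(1)] by blast
        have "g \<circ> u \<circ> (h \<circ> v) \<in> Y" if "u \<in> stab U F" "v \<in> stab U E" for u v
        proof -
          have "pinv h \<circ> u \<circ> h \<circ> v \<in> stab U E"
            using perm_groupD(4)[OF perm_group_stab[OF perm_group(2)]] F(2) that by blast
          then have "g \<circ> h \<circ> (pinv h \<circ> u \<circ> h \<circ> v) \<in> Y" using E(2) by blast
          moreover have "g \<circ> h \<circ> (pinv h \<circ> u \<circ> h \<circ> v) = g \<circ> u \<circ> (h \<circ> v)"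
            using G(2)[OF gh(2)] by (simp add: fun_eq_iff)
          ultimately show ?thesis by simp
        qed
        moreover have "g \<circ> u \<in> G" "h \<circ> u \<in> G" if "u \<in> stab U E'" for u E'
          using that gh G(4) perm_group(3) by (auto simp: stab_def)
        moreover have "g \<in> {g \<circ> u | u. u \<in> stab U F}" "h \<in> {h \<circ> u | u. u \<in> stab U E}"
          using id by (metis (mono_tags, lifting) comp_id mem_Collect_eq)+
        ultimately show "\<exists>A B. openin ?T A \<and> openin ?T B \<and> g \<in> A \<and> h \<in> B \<and> A \<times> B \<subseteq> ?P"
          using openin_coset[OF gh(1) F(1)] openin_coset[OF gh(2) E(1)]
          by (intro exI[of _ "{g \<circ> u | u. u \<in> stab U F}"] exI[of _ "{h \<circ> u | u. u \<in> stab U E}"]) auto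
      qed
    qed
    show "continuous_map ?T ?T (\<lambda>x. inv\<^bsub>pg G\<^esub> x)"
      unfolding continuous_map
    proof (intro conjI allI impI)
      show "(\<lambda>x. inv\<^bsub>pg G\<^esub> x) ` topspace ?T \<subseteq> topspace ?T"
        using G(3) m_inv_pg[OF perm_group(1)] by auto
      fix Y assume Y: "openin ?T Y"
      have "\<exists>F. finite F \<and> (\<forall>u\<in>stab U F. pinv (g \<circ> u) \<in> Y)" if g: "g \<in> G" "pinv g \<in> Y" for g
      proof -
        obtain E where E: "finite E" "\<forall>u\<in>stab U E. pinv g \<circ> u \<in> Y"
          using Y g(2) by (auto simp: openin_ptop)
        obtain F where F: "finite F" "\<forall>u\<in>stab U F. pinv (pinv g) \<circ> u \<circ> pinv g \<in> stab U E"
          using conj_stab[OF G(3)[OF g(1)] E(1)] by blast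
        have "pinv (g \<circ> u) \<in> Y" if u: "u \<in> stab U F" for u
        proof -
          have bu: "bij u" "bij g" using u U(2) G(2) g(1) by (auto simp: stab_def)
          have "pinv u \<in> stab U F"
            using perm_groupD(3)[OF perm_group_stab[OF perm_group(2)] u] .
          then have "pinv g \<circ> (pinv (pinv g) \<circ> pinv u \<circ> pinv g) \<in> Y" using E(2) F(2) by blast
          moreover have "pinv g \<circ> (pinv (pinv g) \<circ> pinv u \<circ> pinv g) = pinv (g \<circ> u)"
            using bu by (simp add: o_inv_distrib fun_eq_iff)
          ultimately show ?thesis by simp
        qed
        then show ?thesis using F(1) by blast
      qed
      moreover have "g \<circ> u \<in> G" if "g \<in> G" "u \<in> stab U F" for g u F
        using that G(4) perm_group(3) by (auto simp: stab_def)
      ultimately show "openin ?T {x \<in> topspace ?T. inv\<^bsub>pg G\<^esub> x \<in> Y}"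
        using m_inv_pg[OF perm_group(1)] by (auto simp: openin_ptop)
    qed
  qed
qed

lemma openin_value: "openin (ptop G U) {g \<in> G. Q (g x)}"
  unfolding openin_ptop
proof (intro conjI ballI)
  fix g assume "g \<in> {g \<in> G. Q (g x)}"
  then show "\<exists>E. finite E \<and> (\<forall>u\<in>stab U E. g \<circ> u \<in> {g \<in> G. Q (g x)})"
    using G(4) perm_group(3) by (intro exI[of _ "{x}"]) (auto simp: stab_def)
qed auto

lemma closedin_values: "closedin (ptop G U) {g \<in> G. \<forall>x. Q x (g x)}"
proof -
  have "openin (ptop G U) (\<Union>x. {g \<in> G. \<not> Q x (g x)})"
    using openin_value[of "\<lambda>y. \<not> Q _ y"] by (intro openin_Union) auto
  moreover have "G - {g \<in> G. \<forall>x. Q x (g x)} = (\<Union>x. {g \<in> G. \<not> Q x (g x)})" by auto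
  ultimately show ?thesis by (auto simp: closedin_def)
qed

lemma openin_stab: "finite E \<Longrightarrow> openin (ptop G U) (stab U E)"
  using openin_coset[OF G(1), of E] by simp

text \<open>In the topology of pointwise convergence U is a closed subset of the product of its
  finite orbits, hence compact; the identity from there to \<open>ptop G U\<close> is
  continuous.\<close>

lemma compactin: "compactin (ptop G U) U"
proof -
  have "continuous_map (top_of_set U) (ptop G U) id"
    unfolding continuous_map
  proof (intro conjI allI impI)
    show "id ` topspace (top_of_set U) \<subseteq> topspace (ptop G U)" using perm_group(3) by auto
    fix Y assume Y: "openin (ptop G U) Y"
    have "\<exists>V. open V \<and> g \<in> V \<and> V \<inter> U \<subseteq> Y" if g: "g \<in> U" "g \<in> Y" for g
    proof -
      obtain E where E: "finite E" "\<forall>u\<in>stab U E. g \<circ> u \<in> Y"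
        using Y g(2) by (auto simp: openin_ptop)
      have "k \<in> Y" if k: "k \<in> U" "\<forall>x\<in>E. k x = g x" for k
      proof -
        have bg: "bij g" using U(2) g(1) by blast
        have "pinv g \<circ> k \<in> stab U E" using k g(1) U(3,4) bg by (auto simp: stab_def)
        then have "g \<circ> (pinv g \<circ> k) \<in> Y" using E(2) by blast
        then show ?thesis using bg by (simp add: comp_assoc[symmetric])
      qed
      then show ?thesis
        using open_cylinder[OF E(1), of g] by (intro exI[of _ "{k. \<forall>x\<in>E. k x = g x}"]) auto
    qed
    then have "openin (top_of_set U) (U \<inter> Y)"
      by (subst openin_subopen) (metis (no_types, lifting) Int_iff Int_commute inf.cobounded1
          le_inf_iff openin_open_Int)
    moreover have "{x \<in> topspace (top_of_set U). id x \<in> Y} = U \<inter> Y" by auto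
    ultimately show "openin (top_of_set U) {x \<in> topspace (top_of_set U). id x \<in> Y}" by simp
  qed
  moreover have "compactin (top_of_set U) U"
    using compact_if_finite_orbits[OF closed finite_orbits]
    by (simp add: compactin_subtopology)
  ultimately show ?thesis using image_compactin by fastforce
qed

theorem tdlcsc_group: "tdlcsc_group (pg G) (ptop G U)"
proof -
  let ?T = "ptop G U"
  interpret topological_group "pg G" ?T by (rule topological_group)
  show ?thesis
  proof
    have sep: "\<exists>x. g x \<noteq> h x" if "g \<noteq> h" for g h :: "nat \<Rightarrow> nat" using that by auto
    show "Hausdorff_space ?T"
      unfolding Hausdorff_space_def
    proof (intro allI impI)
      fix g h assume "g \<in> topspace ?T \<and> h \<in> topspace ?T \<and> g \<noteq> h"
      moreover then obtain x where "g x \<noteq> h x" using sep by blast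
      ultimately show "\<exists>A B. openin ?T A \<and> openin ?T B \<and> g \<in> A \<and> h \<in> B \<and> disjnt A B"
        using openin_value[of "\<lambda>y. y = g x" x] openin_value[of "\<lambda>y. y \<noteq> g x" x]
        by (intro exI[of _ "{k \<in> G. k x = g x}"] exI[of _ "{k \<in> G. k x \<noteq> g x}"])
          (auto simp: disjnt_def)
    qed
    show "\<exists>x. C \<subseteq> {x}" if C: "connectedin ?T C" for C
    proof (rule ccontr)
      assume "\<not> ?thesis"
      then obtain g h where gh: "g \<in> C" "h \<in> C" "g \<noteq> h" by blast
      then obtain x where x: "g x \<noteq> h x" using sep by blast
      have CG: "C \<subseteq> G" using connectedin_subset_topspace[OF C] by simp
      define A B where AB: "A = {k \<in> G. k x = g x}" "B = {k \<in> G. k x \<noteq> g x}"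
      have "openin ?T A" "openin ?T B" unfolding AB by (rule openin_value)+
      moreover have "C \<subseteq> A \<union> B" "A \<inter> B \<inter> C = {}" using CG by (auto simp: AB)
      moreover have "g \<in> A \<inter> C" "h \<in> B \<inter> C" using gh(1,2) x CG by (auto simp: AB)
      ultimately show False using C unfolding connectedin by (metis empty_iff)
    qed
    show "locally_compact_space ?T"
      unfolding locally_compact_space_def
    proof (intro ballI)
      fix g assume "g \<in> topspace ?T"
      then have g: "g \<in> G" by simp
      have eq: "{g \<circ> u | u. u \<in> stab U {}} = (\<lambda>x. g \<otimes>\<^bsub>pg G\<^esub> x) ` U"
        by (auto simp: stab_def)
      have "compactin ?T ((\<lambda>x. g \<otimes>\<^bsub>pg G\<^esub> x) ` U)"
        using image_compactin[OF compactin continuous_map_left_mult] g by simp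
      moreover have "openin ?T ((\<lambda>x. g \<otimes>\<^bsub>pg G\<^esub> x) ` U)"
        using openin_coset[OF g, of "{}"] by (simp add: eq)
      moreover have "g \<in> (\<lambda>x. g \<otimes>\<^bsub>pg G\<^esub> x) ` U"
        using U(1) by (intro image_eqI[of _ _ id]) auto
      ultimately show "\<exists>V K. openin ?T V \<and> compactin ?T K \<and> g \<in> V \<and> V \<subseteq> K" by blast
    qed
    obtain c :: "(nat \<Rightarrow> nat) \<Rightarrow> nat" where c: "\<forall>g\<in>G. \<forall>h\<in>G. c g = c h \<longrightarrow> pinv g \<circ> h \<in> U"
      using countable_index by blast
    \<comment> \<open>A basic set prescribes a left coset of U, by the value of c on it, and
      finitely many values of the permutation; there are countably many such data.\<close>
    define B where "B = (\<lambda>(n, w). {g \<in> G. \<exists>h\<in>G. c h = n \<and> pinv h \<circ> g \<in> U \<and> (\<forall>(x, y)\<in>w. g x = y)})"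
    show "second_countable ?T"
      unfolding second_countable_def
    proof (intro exI[of _ "B ` (UNIV \<times> Collect finite)"] conjI ballI allI impI)
      show "countable (B ` (UNIV \<times> Collect finite))"
        using countable_Collect_finite by (intro countable_image countable_SIGMA) auto
    next
      fix V assume "V \<in> B ` (UNIV \<times> Collect finite)"
      then obtain n w where w: "finite w" "V = B (n, w)" by auto
      show "openin ?T V"
        unfolding openin_ptop
      proof (intro conjI ballI)
        show "V \<subseteq> G" using w(2) by (auto simp: B_def)
        fix g assume "g \<in> V"
        then obtain h where h: "g \<in> G" "h \<in> G" "c h = n" "pinv h \<circ> g \<in> U" "\<forall>(x, y)\<in>w. g x = y"
          using w(2) by (auto simp: B_def)
        have "g \<circ> u \<in> V" if u: "u \<in> stab U (fst ` w)" for u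
        proof -
          have uU: "u \<in> U" using u by (simp add: stab_def)
          have "\<forall>(x, y)\<in>w. (g \<circ> u) x = y" using h(5) u by (force simp: stab_def)
          moreover have "g \<circ> u \<in> G" using G(4) h(1) uU perm_group(3) by blast
          moreover have "pinv h \<circ> (g \<circ> u) \<in> U" using U(4)[OF h(4) uU] by (simp add: comp_assoc)
          ultimately show ?thesis unfolding w(2) B_def using h(2,3) by auto
        qed
        then show "\<exists>E. finite E \<and> (\<forall>u\<in>stab U E. g \<circ> u \<in> V)" using w(1) by blast
      qed
    next
      fix Y g assume "openin ?T Y \<and> g \<in> Y"
      then obtain E where E: "finite E" "\<forall>u\<in>stab U E. g \<circ> u \<in> Y" and g: "g \<in> G"
        unfolding openin_ptop by blast
      have bg: "bij g" using G(2)[OF g] .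
      let ?w = "(\<lambda>x. (x, g x)) ` E"
      have "g \<in> B (c g, ?w)" unfolding B_def using g bg U(1) by auto
      moreover have "B (c g, ?w) \<subseteq> Y"
      proof
        fix k assume "k \<in> B (c g, ?w)"
        then obtain h where h: "k \<in> G" "h \<in> G" "c h = c g" "pinv h \<circ> k \<in> U" "\<forall>x\<in>E. k x = g x"
          by (auto simp: B_def)
        have bh: "bij h" using G(2)[OF h(2)] .
        have "pinv g \<circ> h \<circ> (pinv h \<circ> k) \<in> U" using U(4) c g h(2-4) by metis
        then have "pinv g \<circ> k \<in> U" using bh by (simp add: o_def)
        then have "pinv g \<circ> k \<in> stab U E" using h(5) bg by (simp add: stab_def)
        then have "g \<circ> (pinv g \<circ> k) \<in> Y" using E(2) by blast
        then show "k \<in> Y" using bg by (simp add: o_def)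
      qed
      ultimately show "\<exists>V\<in>B ` (UNIV \<times> Collect finite). g \<in> V \<and> V \<subseteq> Y" using E(1) by blast
    qed
  qed
qed

lemma subgroup_iff: "subgroup H (pg G) \<longleftrightarrow> H \<subseteq> G \<and> perm_group H"
  using subgroup_pg_iff[OF perm_group(1)] .

lemma subtopology: "perm_group H \<Longrightarrow> H \<subseteq> G \<Longrightarrow> subtopology (ptop G U) H = ptop H (U \<inter> H)"
  using subtopology_ptop perm_group by blast

lemma lc_perm_group_open_subgroup:
  assumes "perm_group H" "U \<subseteq> H" "H \<subseteq> G"
  shows "lc_perm_group H U"
proof
  show "\<exists>c :: (nat \<Rightarrow> nat) \<Rightarrow> nat. \<forall>g\<in>H. \<forall>h\<in>H. c g = c h \<longrightarrow> pinv g \<circ> h \<in> U"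
    using countable_index assms(3) by blast
qed (use assms perm_group commensurated closed finite_orbits in auto)

text \<open>The stabilised set is a union of orbits of U, hence invariant under U. It is finite when
  E is, so these stabilisers form a basis of open normal subgroups of U.\<close>

lemma stab_orbit_normal: "stab U ((\<lambda>(u, x). u x) ` (U \<times> E)) \<lhd> pg U"
proof -
  let ?N = "stab U ((\<lambda>(u, x). u x) ` (U \<times> E))"
  interpret group "pg U" using group_pg[OF perm_group(2)] .
  have "subgroup ?N (pg U)"
    unfolding subgroup_pg_iff[OF perm_group(2)]
    by (intro conjI perm_group_stab perm_group(2)) (auto simp: stab_def)
  moreover have "g \<circ> n \<circ> pinv g \<in> ?N" if g: "g \<in> U" and n: "n \<in> ?N" for g n
  proof -
    have bg: "bij g" using U(2)[OF g] .
    have "(g \<circ> n \<circ> pinv g) (u x) = u x" if "u \<in> U" "x \<in> E" for u x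
    proof -
      have "pinv g \<circ> u \<in> U" using U(3,4) g that(1) by blast
      then have "n ((pinv g \<circ> u) x) = (pinv g \<circ> u) x" using n that(2) by (force simp: stab_def)
      then show ?thesis using bg by simp
    qed
    moreover have "g \<circ> n \<circ> pinv g \<in> U" using U(3,4) g n by (auto simp: stab_def)
    ultimately show ?thesis by (auto simp: stab_def)
  qed
  ultimately show ?thesis
    by (simp add: normal_inv_iff m_inv_pg[OF perm_group(2)])
qed

lemma ranked_elementary_compact_open: "ranked_elementary (pg U) (ptop U U)"
proof -
  have sub: "subtopology (ptop G U) U = ptop U U" using subtopology perm_group by simp
  interpret T: tdlcsc_group "pg G" "ptop G U" by (rule tdlcsc_group)
  have "openin (ptop G U) U" using openin_stab[of "{}"] by (simp add: stab_def)
  then have "closedin (ptop G U) U"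
    using T.open_subgroup_closed perm_group subgroup_iff by blast
  then have "tdlcsc_group (pg G\<lparr>carrier := U\<rparr>) (subtopology (ptop G U) U)"
    using T.tdlcsc_group_closed_subgroup perm_group subgroup_iff by blast
  then have tdlcsc: "tdlcsc_group (pg U) (ptop U U)" by (simp add: sub)
  interpret U: lc_perm_group U U
    using lc_perm_group_open_subgroup[of U] perm_group by blast
  show ?thesis
  proof (rule ranked_elementary_compact[OF tdlcsc])
    show "compact_space (ptop U U)"
      using compactin by (simp add: compact_space_subtopology sub[symmetric])
    fix Y assume Y: "openin (ptop U U) Y" "\<one>\<^bsub>pg U\<^esub> \<in> Y"
    then have "\<exists>E. finite E \<and> (\<forall>u\<in>stab U E. id \<circ> u \<in> Y)"
      unfolding openin_ptop by (metis pg_simps(3))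
    then obtain E where E: "finite E" "stab U E \<subseteq> Y" by auto
    let ?F = "(\<lambda>(u, x). u x) ` (U \<times> E)"
    have "?F = (\<Union>x\<in>E. (\<lambda>u. u x) ` U)" by auto
    then have "finite ?F" using E(1) finite_orbits by simp
    then have "openin (ptop U U) (stab U ?F)" by (rule U.openin_stab)
    moreover have "E \<subseteq> ?F"
      using U(1) by (auto intro!: image_eqI[of _ _ "(id, _)"])
    then have "stab U ?F \<subseteq> Y" using E(2) stab_mono by blast
    ultimately show "\<exists>N. N \<lhd> pg U \<and> openin (ptop U U) N \<and> N \<subseteq> Y"
      using stab_orbit_normal by blast
  qed
qed

end

section \<open>Closed subgroups, unions and extensions of permutation groups\<close>

context lc_perm_group
begin

definition closed_perm_subgroup :: "(nat \<Rightarrow> nat) set \<Rightarrow> bool"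
  where "closed_perm_subgroup H \<longleftrightarrow> H \<subseteq> G \<and> perm_group H \<and> closedin (ptop G U) H"

definition ranked_elementary_sub :: "(nat \<Rightarrow> nat) set \<Rightarrow> bool"
  where "ranked_elementary_sub H \<longleftrightarrow> ranked_elementary (pg H) (ptop H (U \<inter> H))"

lemma closed_perm_subgroupD:
  assumes "closed_perm_subgroup H"
  shows "H \<subseteq> G" "perm_group H" "closedin (ptop G U) H" "subgroup H (pg G)"
    "subtopology (ptop G U) H = ptop H (U \<inter> H)" "tdlcsc_group (pg H) (ptop H (U \<inter> H))"
proof -
  interpret tdlcsc_group "pg G" "ptop G U" by (rule tdlcsc_group)
  show 1: "H \<subseteq> G" "perm_group H" "closedin (ptop G U) H"
    using assms by (auto simp: closed_perm_subgroup_def)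
  then show 2: "subgroup H (pg G)" "subtopology (ptop G U) H = ptop H (U \<inter> H)"
    using subgroup_iff subtopology by auto
  show "tdlcsc_group (pg H) (ptop H (U \<inter> H))"
    using tdlcsc_group_closed_subgroup[OF 2(1) 1(3)] 2(2) by simp
qed

lemma closed_perm_subgroup_self: "closed_perm_subgroup G"
  using closedin_topspace[of "ptop G U"] perm_group by (simp add: closed_perm_subgroup_def)

lemma closed_perm_subgroup_values:
  assumes "closed_perm_subgroup H" "perm_group K" "K = {g \<in> H. \<forall>x. Q x (g x)}"
  shows "closed_perm_subgroup K"
proof -
  have "K = H \<inter> {g \<in> G. \<forall>x. Q x (g x)}" using closed_perm_subgroupD(1)[OF assms(1)] assms(3) by auto
  then have "closedin (ptop G U) K"
    using closedin_Int[OF closed_perm_subgroupD(3)[OF assms(1)] closedin_values] by simp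
  then show ?thesis
    using closed_perm_subgroupD(1)[OF assms(1)] assms(2,3) by (auto simp: closed_perm_subgroup_def)
qed

lemma openin_ptop_if_contains:
  assumes "perm_group K" "K \<subseteq> H" "V \<subseteq> K"
  shows "openin (ptop H V) K"
  unfolding openin_ptop
proof (intro conjI ballI)
  fix g assume g: "g \<in> K"
  have "g \<circ> u \<in> K" if "u \<in> stab V {}" for u
    using perm_groupD(4)[OF assms(1) g] assms(3) that by (auto simp: stab_def)
  then show "\<exists>E. finite E \<and> (\<forall>u\<in>stab V E. g \<circ> u \<in> K)" by blast
qed fact

lemma closed_perm_subgroup_open:
  assumes "closed_perm_subgroup H" "perm_group K" "K \<subseteq> H" "U \<inter> H \<subseteq> K"
  shows "closed_perm_subgroup K"
proof -
  note H = closed_perm_subgroupD[OF assms(1)]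
  interpret tdlcsc_group "pg H" "ptop H (U \<inter> H)" by (rule H(6))
  have "openin (ptop H (U \<inter> H)) K" using openin_ptop_if_contains assms(2-4) .
  moreover have "subgroup K (pg H)" using subgroup_pg_iff[OF H(2)] assms(2,3) by blast
  ultimately have "closedin (ptop H (U \<inter> H)) K" by (intro open_subgroup_closed)
  then have "closedin (ptop G U) K" using closedin_trans_full[of "ptop G U" H K] H(3,5) by simp
  then show ?thesis using assms(2,3) H(1) by (auto simp: closed_perm_subgroup_def)
qed

lemma ranked_elementary_sub_closed:
  assumes "ranked_elementary_sub H" "closed_perm_subgroup H" "closed_perm_subgroup K" "K \<subseteq> H"
  shows "ranked_elementary_sub K"
proof -
  note H = closed_perm_subgroupD[OF assms(2)] and K = closed_perm_subgroupD[OF assms(3)]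
  have UH: "perm_group (U \<inter> H)"
    using perm_groupD[OF H(2)] U by (auto simp: perm_group_def)
  have sub: "subtopology (ptop H (U \<inter> H)) K = ptop K (U \<inter> K)"
    using subtopology_ptop[OF H(2) _ UH K(2) assms(4)] assms(4) by (simp add: Int_assoc Int_absorb1)
  have "closedin (ptop H (U \<inter> H)) K"
    using K(3) assms(4) H(5) by (metis closedin_subset_topspace)
  then have "ranked_elementary (pg H\<lparr>carrier := K\<rparr>) (subtopology (ptop H (U \<inter> H)) K)"
    using assms(1) subgroup_pg_iff[OF H(2)] K(2) assms(4)
    by (intro ranked_elementary_closed_subgroup) (auto simp: ranked_elementary_sub_def)
  then show ?thesis by (simp add: ranked_elementary_sub_def sub)
qed

lemma ranked_elementary_sub_union:
  fixes W :: "nat \<Rightarrow> (nat \<Rightarrow> nat) set"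
  assumes "closed_perm_subgroup H" "incseq W" "(\<Union>i. W i) = H"
    and "\<And>i. perm_group (W i)" "\<And>i. U \<inter> H \<subseteq> W i" "\<And>i. ranked_elementary_sub (W i)"
  shows "ranked_elementary_sub H"
  unfolding ranked_elementary_sub_def
proof (rule ranked_elementary_increasing_union)
  note H = closed_perm_subgroupD[OF assms(1)]
  have UH: "perm_group (U \<inter> H)"
    using perm_groupD[OF H(2)] U by (auto simp: perm_group_def)
  show "tdlcsc_group (pg H) (ptop H (U \<inter> H))" by (rule H(6))
  fix i
  have W: "W i \<subseteq> H" using assms(3) by blast
  show "subgroup (W i) (pg H)" using subgroup_pg_iff[OF H(2)] assms(4) W by blast
  show "openin (ptop H (U \<inter> H)) (W i)" using openin_ptop_if_contains[OF assms(4) W assms(5)] .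
  have "subtopology (ptop H (U \<inter> H)) (W i) = ptop (W i) (U \<inter> W i)"
    using subtopology_ptop[OF H(2) _ UH assms(4) W] W by (simp add: Int_assoc Int_absorb1)
  then show "ranked_elementary (pg H\<lparr>carrier := W i\<rparr>) (subtopology (ptop H (U \<inter> H)) (W i))"
    using assms(6)[of i] by (simp add: ranked_elementary_sub_def)
qed (use assms in auto)

lemma ranked_elementary_sub_extension:
  assumes "closed_perm_subgroup H"
    and Q: "ranked_elementary (pg Q) (ptop Q UQ)" "perm_group Q" "UQ \<subseteq> Q"
    and \<phi>: "\<And>g. g \<in> H \<Longrightarrow> \<phi> g \<in> Q" "\<And>g h. g \<in> H \<Longrightarrow> h \<in> H \<Longrightarrow> \<phi> (g \<circ> h) = \<phi> g \<circ> \<phi> h"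
      "\<And>E. finite E \<Longrightarrow> \<exists>F. finite F \<and> (\<forall>v\<in>stab (U \<inter> H) F. \<phi> v \<in> stab UQ E)"
    and \<psi>: "\<And>q. q \<in> Q \<Longrightarrow> \<psi> q \<in> H" "\<And>q r. q \<in> Q \<Longrightarrow> r \<in> Q \<Longrightarrow> \<psi> (q \<circ> r) = \<psi> q \<circ> \<psi> r"
      "\<And>E. finite E \<Longrightarrow> \<exists>F. finite F \<and> (\<forall>v\<in>stab UQ F. \<psi> v \<in> stab U E)"
    and \<phi>\<psi>: "\<And>q. q \<in> Q \<Longrightarrow> \<phi> (\<psi> q) = q"
    and ker: "ranked_elementary_sub {h \<in> H. \<phi> h = id}"
  shows "ranked_elementary_sub H"
proof -
  note H = closed_perm_subgroupD[OF assms(1)]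
  interpret Q: group "pg Q" using group_pg[OF Q(2)] .
  interpret H: tdlcsc_group "pg H" "ptop H (U \<inter> H)" by (rule H(6))
  have hom: "\<phi> \<in> hom (pg H) (pg Q)" using \<phi>(1,2) by (simp add: hom_def)
  interpret group_hom "pg H" "pg Q" \<phi> using hom by unfold_locales
  have UH: "perm_group (U \<inter> H)"
    using perm_groupD[OF H(2)] U by (auto simp: perm_group_def)
  have ker_eq: "kernel (pg H) (pg Q) \<phi> = {h \<in> H. \<phi> h = id}" by (simp add: kernel_def)
  then have "perm_group {h \<in> H. \<phi> h = id}"
    using subgroup_kernel subgroup_pg_iff[OF H(2)] by simp
  then have sub: "subtopology (ptop H (U \<inter> H)) {h \<in> H. \<phi> h = id} =
      ptop {h \<in> H. \<phi> h = id} (U \<inter> {h \<in> H. \<phi> h = id})"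
    using subtopology_ptop[OF H(2) _ UH, of "{h \<in> H. \<phi> h = id}"] by (simp add: Int_assoc Int_absorb1)
  show ?thesis
    unfolding ranked_elementary_sub_def
  proof (rule ranked_elementary_extension[OF H(6) Q(1) hom])
    show "continuous_map (ptop H (U \<inter> H)) (ptop Q UQ) \<phi>"
      using H(2) Q(2,3) \<phi> by (intro continuous_map_ptop) auto
    show "continuous_map (ptop Q UQ) (ptop H (U \<inter> H)) \<psi>"
    proof (rule continuous_map_ptop[OF Q(2,3) H(2)])
      fix E :: "nat set" assume "finite E"
      then obtain F where "finite F" "\<forall>v\<in>stab UQ F. \<psi> v \<in> stab U E" using \<psi>(3) by blast
      moreover have "\<psi> v \<in> H" if "v \<in> stab UQ F" for v F
        using \<psi>(1) that Q(3) by (auto simp: stab_def)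
      ultimately show "\<exists>F. finite F \<and> (\<forall>v\<in>stab UQ F. \<psi> v \<in> stab (U \<inter> H) E)"
        by (auto simp: stab_def)
    qed (use \<psi> Q(3) in auto)
    show "ranked_elementary (pg H\<lparr>carrier := kernel (pg H) (pg Q) \<phi>\<rparr>)
        (subtopology (ptop H (U \<inter> H)) (kernel (pg H) (pg Q) \<phi>))"
      using ker by (simp add: ker_eq sub ranked_elementary_sub_def)
  qed (use \<phi>\<psi> in simp)
qed

end

section \<open>Generalised wreath products\<close>

definition fin_supp :: "(int \<Rightarrow> nat) set"
  where "fin_supp = {f. finite {i. f i \<noteq> 0}}"

lemma countable_fin_supp: "countable fin_supp"
proof -
  let ?h = "\<lambda>f :: int \<Rightarrow> nat. {(i, f i) | i. f i \<noteq> 0}"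
  have "?h ` fin_supp \<subseteq> Collect finite"
    by (auto simp: fin_supp_def)
  then have "countable (?h ` fin_supp)" using countable_Collect_finite countable_subset by blast
  moreover have "inj_on ?h fin_supp"
  proof (rule inj_onI, rule ext)
    fix f g i assume eq: "?h f = ?h g"
    have "f i \<noteq> 0 \<Longrightarrow> g i = f i" "g i \<noteq> 0 \<Longrightarrow> f i = g i" for i
      using eq by (auto simp: set_eq_iff)
    then show "f i = g i" by (metis (full_types))
  qed
  ultimately show ?thesis using countable_image_inj_on by blast
qed

text \<open>The transposition makes 0 the code of the zero function, so that it can serve as the
  base point which compact open subgroups fix and whose orbit \<open>height_ge\<close>
  inspects.\<close>

lemma ex_co: "\<exists>d :: nat \<Rightarrow> int \<Rightarrow> nat. bij_betw d UNIV fin_supp \<and> d 0 = (\<lambda>_. 0)"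
proof -
  let ?s = "\<lambda>n :: nat. (\<lambda>_ :: int. 0 :: nat)(0 := n)"
  have "inj ?s" by (rule injI) (metis fun_upd_same)
  moreover have "range ?s \<subseteq> fin_supp"
    by (auto simp: fin_supp_def split: if_splits intro!: finite_subset[of _ "{0}"])
  ultimately have "infinite fin_supp" using infinite_iff_countable_subset by blast
  then have bij: "bij_betw (from_nat_into fin_supp) UNIV fin_supp"
    using countable_fin_supp by (rule bij_betw_from_nat_into[rotated])
  have "(\<lambda>_. 0) \<in> fin_supp" by (simp add: fin_supp_def)
  then obtain m where m: "from_nat_into fin_supp m = (\<lambda>_. 0)"
    using bij by (metis bij_betw_imp_surj_on imageE)
  have "bij_betw (from_nat_into fin_supp \<circ> Transposition.transpose 0 m) UNIV fin_supp"
    using bij by (intro bij_betw_trans[of _ _ UNIV]) (auto simp: bij_betw_def)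
  then show ?thesis using m by (intro exI[of _ "from_nat_into fin_supp \<circ> Transposition.transpose 0 m"]) simp
qed

text \<open>
  A fixed enumeration \<open>co\<close> of the finitely supported functions from \<open>int\<close> to \<open>nat\<close>, so that a
  permutation of these functions becomes a function from \<open>nat\<close> to \<open>nat\<close>.
\<close>

definition co :: "nat \<Rightarrow> int \<Rightarrow> nat"
  where "co = (SOME d. bij_betw d UNIV fin_supp \<and> d 0 = (\<lambda>_. 0))"

definition enc :: "(int \<Rightarrow> nat) \<Rightarrow> nat"
  where "enc = inv_into UNIV co"

lemma bij_co: "bij_betw co UNIV fin_supp" and co_zero [simp]: "co 0 = (\<lambda>_. 0)"
  using someI_ex[OF ex_co] by (simp_all add: co_def)

lemma co_enc: "finite {i. f i \<noteq> 0} \<Longrightarrow> co (enc f) = f"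
  using bij_co by (simp add: enc_def bij_betw_def f_inv_into_f fin_supp_def)

lemma enc_co [simp]: "enc (co f) = f"
  using bij_co by (simp add: enc_def bij_betw_def)

lemma finite_co: "finite {i. co f i \<noteq> 0}"
  using bij_co by (auto simp: bij_betw_def fin_supp_def)

lemma finite_co' [simp]: "finite {i. 0 < co f i}"
  using finite_co[of f] by simp

lemma co_eqI: "(\<And>i. co f i = co h i) \<Longrightarrow> f = h"
  by (metis enc_co ext)

definition upd :: "nat \<Rightarrow> int \<Rightarrow> nat \<Rightarrow> nat"
  where "upd f i x = enc ((co f)(i := x))"

lemma co_upd [simp]: "co (upd f i x) = (co f)(i := x)"
  unfolding upd_def
  by (rule co_enc, rule finite_subset[of _ "insert i {j. co f j \<noteq> 0}"]) auto

definition loc :: "(nat \<Rightarrow> nat) \<Rightarrow> int \<Rightarrow> nat \<Rightarrow> nat \<Rightarrow> nat"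
  where "loc g i k = (\<lambda>x. co (g (upd k i x)) i)"

text \<open>
  The levels are the integers, ordered by \<open>\<sqsubset>\<close>. A site at level \<open>i\<close> is a finitely supported
  function on the levels above \<open>i\<close>; it carries a copy of \<open>Gs i\<close>, which changes the value at \<open>i\<close> of
  the functions that extend the site. The value of \<open>loc g i k\<close> is the local action of \<open>g\<close> there.
\<close>

locale wreath =
  fixes lt :: "int \<Rightarrow> int \<Rightarrow> bool" (infix "\<sqsubset>" 50)
    and Gs Us :: "int \<Rightarrow> (nat \<Rightarrow> nat) set"
  assumes lt_less: "i \<sqsubset> j \<Longrightarrow> i < j"
    and lt_trans: "i \<sqsubset> j \<Longrightarrow> j \<sqsubset> k \<Longrightarrow> i \<sqsubset> k"
    and lc: "lc_perm_group (Gs i) (Us i)"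
    and fix_zero: "u \<in> Us i \<Longrightarrow> u 0 = 0"
begin

definition tr :: "int \<Rightarrow> nat \<Rightarrow> nat"
  where "tr i f = enc (\<lambda>j. if i \<sqsubset> j then co f j else 0)"

definition site :: "int \<Rightarrow> nat set"
  where "site i = {k. \<forall>j. \<not> i \<sqsubset> j \<longrightarrow> co k j = 0}"

text \<open>These are the elements of the unrestricted generalised wreath product, apart from
  bijectivity: the new value at level i is determined by the site and the old value at i.\<close>

definition local :: "(nat \<Rightarrow> nat) \<Rightarrow> bool"
  where "local g \<longleftrightarrow> (\<forall>i f. co (g f) i = loc g i (tr i f) (co f i)) \<and> (\<forall>i. \<forall>k\<in>site i. loc g i k \<in> Gs i)"

definition sing :: "(nat \<Rightarrow> nat) \<Rightarrow> (int \<times> nat) set"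
  where "sing g = {(i, k). k \<in> site i \<and> loc g i k \<notin> Us i}"

text \<open>Local actions outside \<open>Us\<close> are allowed at finitely many sites only; this
  makes \<open>V\<close>, which allows none, commensurated and of countable index.\<close>

definition L :: "(nat \<Rightarrow> nat) set"
  where "L = {g. bij g \<and> local g \<and> finite (sing g)}"

definition V :: "(nat \<Rightarrow> nat) set"
  where "V = {g \<in> L. sing g = {}}"

lemmas Gs = perm_groupD[OF lc_perm_group.perm_group(1)[OF lc]]
lemmas Us = perm_groupD[OF lc_perm_group.perm_group(2)[OF lc]]

lemma Us_Gs: "u \<in> Us i \<Longrightarrow> u \<in> Gs i"
  using lc_perm_group.perm_group(3)[OF lc] by blast

lemma irrefl [simp]: "\<not> i \<sqsubset> i"
  using lt_less by fastforce

lemma co_tr [simp]: "co (tr i f) j = (if i \<sqsubset> j then co f j else 0)"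
proof -
  have "finite {j. (if i \<sqsubset> j then co f j else 0) \<noteq> 0}"
    by (rule finite_subset[OF _ finite_co[of f]]) auto
  then show ?thesis by (simp add: tr_def co_enc)
qed

lemma tr_site [simp]: "tr i f \<in> site i"
  by (simp add: site_def)

lemma tr_id [simp]: "k \<in> site i \<Longrightarrow> tr i k = k"
  by (rule co_eqI) (simp add: site_def)

lemma tr_eq_iff: "tr i f = tr i h \<longleftrightarrow> (\<forall>j. i \<sqsubset> j \<longrightarrow> co f j = co h j)"
proof
  assume "tr i f = tr i h"
  then have "co (tr i f) j = co (tr i h) j" for j by simp
  then show "\<forall>j. i \<sqsubset> j \<longrightarrow> co f j = co h j" by (metis co_tr)
next
  assume "\<forall>j. i \<sqsubset> j \<longrightarrow> co f j = co h j"
  then show "tr i f = tr i h" by - (rule co_eqI, simp)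
qed

lemma tr_eq_lt: "tr i f = tr i h \<Longrightarrow> i \<sqsubset> j \<Longrightarrow> tr j f = tr j h"
  using lt_trans by (auto simp: tr_eq_iff)

lemma tr_upd [simp]: "tr i (upd f i x) = tr i f"
  by (simp add: tr_eq_iff)

lemma localD:
  assumes "local g"
  shows "co (g f) i = loc g i (tr i f) (co f i)" "k \<in> site i \<Longrightarrow> loc g i k \<in> Gs i"
    "k \<in> site i \<Longrightarrow> bij (loc g i k)"
  using assms Gs(2)[of _ i] by (auto simp: local_def)

lemma local_tr: "local g \<Longrightarrow> tr i f = tr i h \<Longrightarrow> tr i (g f) = tr i (g h)"
  using tr_eq_lt[of i f h] localD(1)[of g] by (simp add: tr_eq_iff[of i])

text \<open>By finite support, f and h differ at finitely many levels. Take the greatest level above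
  i where they do: since \<open>\<sqsubset>\<close> is contained in \<open><\<close>, they agree on
  everything above it and lie on the same site, whose local action is injective.\<close>

lemma local_tr_cancel:
  assumes "local g" "tr i (g f) = tr i (g h)"
  shows "tr i f = tr i h"
proof (rule ccontr)
  assume "tr i f \<noteq> tr i h"
  define D where "D = {j. i \<sqsubset> j \<and> co f j \<noteq> co h j}"
  have "D \<subseteq> {j. co f j \<noteq> 0} \<union> {j. co h j \<noteq> 0}" by (auto simp: D_def)
  then have fin: "finite D" by (rule finite_subset) simp
  have "D \<noteq> {}" using \<open>tr i f \<noteq> tr i h\<close> by (auto simp: D_def tr_eq_iff)
  define m where "m = Max D"
  have m: "m \<in> D" using fin \<open>D \<noteq> {}\<close> by (simp add: m_def)
  have "co f j = co h j" if "m \<sqsubset> j" for j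
  proof (rule ccontr)
    assume "co f j \<noteq> co h j"
    then have "j \<in> D" using that m lt_trans by (auto simp: D_def)
    then show False using lt_less[OF that] fin by (simp add: m_def) (meson Max_ge leD)
  qed
  then have "tr m f = tr m h" by (simp add: tr_eq_iff)
  moreover have "co (g f) m = co (g h) m" using assms(2) m by (auto simp: D_def tr_eq_iff)
  ultimately have "loc g m (tr m f) (co f m) = loc g m (tr m f) (co h m)"
    using localD(1)[OF assms(1)] by metis
  then have "co f m = co h m"
    using localD(3)[OF assms(1) tr_site] by (metis bij_pinv_simps(2))
  then show False using m by (simp add: D_def)
qed

lemma local_inj:
  assumes "local g"
  shows "inj g"
proof (rule injI, rule co_eqI)
  fix f h i assume "g f = g h"
  then have "tr i f = tr i h" using local_tr_cancel[OF assms] by metis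
  then have "loc g i (tr i f) (co f i) = loc g i (tr i f) (co h i)"
    using localD(1)[OF assms] \<open>g f = g h\<close> by metis
  then show "co f i = co h i"
    using localD(3)[OF assms tr_site] by (metis bij_pinv_simps(2))
qed

lemma loc_id [simp]: "loc id i k = id"
  by (simp add: loc_def fun_eq_iff)

lemma local_id: "local id"
  using Gs(1) by (simp add: local_def)

text \<open>The cocycle rule: h first carries the site k to \<open>tr i (h k)\<close>, where g then
  acts.\<close>

lemma loc_comp:
  assumes "local g" "local h" "k \<in> site i"
  shows "loc (g \<circ> h) i k = loc g i (tr i (h k)) \<circ> loc h i k"
proof
  fix x
  have "tr i (h (upd k i x)) = tr i (h k)" by (rule local_tr[OF assms(2)]) simp
  then show "loc (g \<circ> h) i k x = (loc g i (tr i (h k)) \<circ> loc h i k) x"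
    using localD(1)[OF assms(1), of "h (upd k i x)" i] by (simp add: loc_def)
qed

lemma local_comp:
  assumes "local g" "local h"
  shows "local (g \<circ> h)"
  unfolding local_def
proof (intro conjI allI ballI)
  fix i f
  have "tr i (h (tr i f)) = tr i (h f)" by (rule local_tr[OF assms(2)]) simp
  then show "co ((g \<circ> h) f) i = loc (g \<circ> h) i (tr i f) (co f i)"
    using localD(1)[OF assms(1), of "h f" i] localD(1)[OF assms(2), of f i]
    by (simp add: loc_comp[OF assms])
next
  fix i k assume "k \<in> site i"
  then show "loc (g \<circ> h) i k \<in> Gs i"
    using loc_comp[OF assms] Gs(4) localD(2)[OF assms(1)] localD(2)[OF assms(2)] by simp
qed

lemma loc_pinv:
  assumes "local g" "bij g" "k \<in> site i"
  shows "loc (pinv g) i k = pinv (loc g i (tr i (pinv g k)))"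
proof
  fix x
  let ?h = "pinv g (upd k i x)" and ?l = "tr i (pinv g k)"
  have "tr i (g ?h) = tr i (g (pinv g k))" using assms(2,3) by simp
  then have l: "tr i ?h = ?l" using local_tr_cancel[OF assms(1)] by blast
  have "x = loc g i ?l (co ?h i)"
    using localD(1)[OF assms(1), of ?h i] assms(2) l by simp
  then have "pinv (loc g i ?l) x = co ?h i"
    using localD(3)[OF assms(1) tr_site] bij_pinv_simps(2) by metis
  then show "loc (pinv g) i k x = pinv (loc g i ?l) x" by (simp add: loc_def)
qed

lemma local_pinv:
  assumes "local g" "bij g"
  shows "local (pinv g)"
  unfolding local_def
proof (intro conjI allI ballI)
  fix i f
  let ?h = "pinv g f" and ?k = "tr i f"
  have "tr i (g (pinv g ?k)) = tr i (g ?h)" using assms(2) by simp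
  then have l: "tr i (pinv g ?k) = tr i ?h" using local_tr_cancel[OF assms(1)] by blast
  have "co f i = loc g i (tr i ?h) (co ?h i)"
    using localD(1)[OF assms(1), of ?h i] assms(2) by simp
  then have "pinv (loc g i (tr i ?h)) (co f i) = co ?h i"
    using localD(3)[OF assms(1) tr_site] bij_pinv_simps(2) by metis
  then show "co (pinv g f) i = loc (pinv g) i (tr i f) (co f i)"
    using loc_pinv[OF assms, of ?k i] l by simp
next
  fix i k assume "k \<in> site i"
  then show "loc (pinv g) i k \<in> Gs i"
    using loc_pinv[OF assms] Gs(3) localD(2)[OF assms(1)] by simp
qed

lemma sing_comp:
  assumes "local g" "local h"
  shows "sing (g \<circ> h) \<subseteq> sing h \<union> {(i, k). k \<in> site i \<and> (i, tr i (h k)) \<in> sing g}"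
  using loc_comp[OF assms] Us(4) by (fastforce simp: sing_def)

lemma sing_pinv:
  assumes "local g" "bij g"
  shows "sing (pinv g) \<subseteq> {(i, k). k \<in> site i \<and> (i, tr i (pinv g k)) \<in> sing g}"
  using loc_pinv[OF assms] Us(3) by (fastforce simp: sing_def)

lemma site_cancel:
  assumes "local h" "k \<in> site i" "l \<in> site i" "tr i (h k) = tr i (h l)"
  shows "k = l"
  using local_tr_cancel[OF assms(1,4)] assms(2,3) by simp

lemma finite_site_vimage:
  assumes "local h" "finite S"
  shows "finite {(i, k). k \<in> site i \<and> (i, tr i (h k)) \<in> S}"
proof -
  let ?A = "{(i, k). k \<in> site i}" and ?t = "\<lambda>(i, k). (i, tr i (h k))"
  have "inj_on ?t ?A" using site_cancel[OF assms(1)] by (auto intro!: inj_onI)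
  moreover have "{(i, k). k \<in> site i \<and> (i, tr i (h k)) \<in> S} = ?t -` S \<inter> ?A" by auto
  ultimately show ?thesis using finite_vimage_IntI[OF assms(2)] by simp
qed

lemma LD: "g \<in> L \<Longrightarrow> bij g" "g \<in> L \<Longrightarrow> local g" "g \<in> L \<Longrightarrow> finite (sing g)"
  by (simp_all add: L_def)

lemma sing_id [simp]: "sing id = {}"
  using Us(1) by (simp add: sing_def)

lemma perm_group_L: "perm_group L"
  unfolding perm_group_def
proof (intro conjI ballI)
  show "id \<in> L" using local_id by (simp add: L_def)
  fix g assume g: "g \<in> L"
  then show "bij g" by (rule LD)
  note g' = LD(2)[OF g] LD(1)[OF g]
  have "finite (sing (pinv g))"
    using finite_subset[OF sing_pinv[OF g'] finite_site_vimage[OF local_pinv[OF g'] LD(3)[OF g]]] .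
  then show "pinv g \<in> L" using g local_pinv by (simp add: L_def)
  fix h assume h: "h \<in> L"
  have "finite (sing (g \<circ> h))"
    using finite_subset[OF sing_comp[OF LD(2)[OF g] LD(2)[OF h]]]
      finite_site_vimage[OF LD(2)[OF h] LD(3)[OF g]] LD(3)[OF h] by simp
  then show "g \<circ> h \<in> L" using g h local_comp by (simp add: L_def bij_comp)
qed

lemmas L = perm_groupD[OF perm_group_L]

lemma VD: "v \<in> V \<Longrightarrow> v \<in> L" "v \<in> V \<Longrightarrow> k \<in> site i \<Longrightarrow> loc v i k \<in> Us i"
  by (auto simp: V_def sing_def)

lemma perm_group_V: "perm_group V"
  unfolding perm_group_def
proof (intro conjI ballI)
  show "id \<in> V" using L(1) by (simp add: V_def)
  fix g assume g: "g \<in> V"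
  then show "bij g" using LD VD by blast
  show "pinv g \<in> V" using g sing_pinv[of g] L(3) by (auto simp: V_def LD)
  fix h assume h: "h \<in> V"
  then show "g \<circ> h \<in> V" using g sing_comp[of g h] L(4) by (auto simp: V_def LD)
qed

lemma V_co:
  assumes "v \<in> V"
  shows "co (v f) i \<in> (\<lambda>u. u (co f i)) ` Us i"
proof -
  have "local v" using VD(1)[OF assms] by (rule LD)
  then show ?thesis using localD(1)[of v f i] VD(2)[OF assms, of "tr i f" i] by auto
qed

lemma V_zero:
  assumes "v \<in> V"
  shows "v 0 = 0"
proof (rule co_eqI)
  fix i
  obtain u where "u \<in> Us i" "co (v 0) i = u (co 0 i)" using V_co[OF assms, of 0 i] by blast
  then show "co (v 0) i = co 0 i" using fix_zero by simp
qed

text \<open>The product of the orbits of the coordinates of f. It is finite because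
  \<open>Us i\<close> fixes 0, so only the support of f contributes non-trivial factors.\<close>

definition orbit_box :: "nat \<Rightarrow> nat set"
  where "orbit_box f = {h. \<forall>i. co h i \<in> (\<lambda>u. u (co f i)) ` Us i}"

lemma finite_orbit_box: "finite (orbit_box f)"
proof -
  let ?S = "{i. co f i \<noteq> 0}"
  have "(\<lambda>h. restrict (co h) ?S) ` orbit_box f \<subseteq> PiE ?S (\<lambda>i. (\<lambda>u. u (co f i)) ` Us i)"
    by (auto simp: orbit_box_def split: if_splits)
  moreover have "finite (PiE ?S (\<lambda>i. (\<lambda>u. u (co f i)) ` Us i))"
    using lc_perm_group.finite_orbits[OF lc] by (intro finite_PiE) auto
  ultimately have "finite ((\<lambda>h. restrict (co h) ?S) ` orbit_box f)" by (rule finite_subset)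
  moreover have "inj_on (\<lambda>h. restrict (co h) ?S) (orbit_box f)"
  proof (rule inj_onI, rule co_eqI)
    fix h h' i assume h: "h \<in> orbit_box f" "h' \<in> orbit_box f"
      and eq: "restrict (co h) ?S = restrict (co h') ?S"
    show "co h i = co h' i"
    proof (cases "co f i = 0")
      case True
      then have "co h i = 0" "co h' i = 0"
        using h fix_zero by (auto simp: orbit_box_def elim!: allE[of _ i])
      then show ?thesis by simp
    next
      case False
      then show ?thesis using fun_cong[OF eq, of i] by simp
    qed
  qed
  ultimately show ?thesis by (rule finite_imageD)
qed

lemma finite_orbits_V: "finite ((\<lambda>v. v f) ` V)"
proof (rule finite_subset[OF _ finite_orbit_box])
  show "(\<lambda>v. v f) ` V \<subseteq> orbit_box f" using V_co by (auto simp: orbit_box_def)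
qed

text \<open>When all local actions lie in \<open>Us\<close>, bijectivity is automatic: g is
  injective and maps each finite \<open>orbit_box\<close> to itself. So \<open>V\<close> is cut out
  by conditions on values and local actions alone, which are closed.\<close>

lemma V_eq:
  "V = {g. (\<forall>i f. co (g f) i = loc g i (tr i f) (co f i)) \<and> (\<forall>i. \<forall>k\<in>site i. loc g i k \<in> Us i)}"
    (is "V = ?R")
proof
  show "V \<subseteq> ?R" using VD LD localD(1) by fastforce
  show "?R \<subseteq> V"
  proof
    fix g assume g: "g \<in> ?R"
    then have loc: "local g" using Us_Gs by (auto simp: local_def)
    have sing: "sing g = {}" using g by (auto simp: sing_def)
    have "surj g"
    proof (rule surjI)
      fix f
      have "g ` orbit_box f \<subseteq> orbit_box f"
      proof
        fix y assume "y \<in> g ` orbit_box f"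
        then obtain h where h: "h \<in> orbit_box f" "y = g h" by blast
        have "co y i \<in> (\<lambda>u. u (co f i)) ` Us i" for i
        proof -
          obtain u where u: "u \<in> Us i" "co h i = u (co f i)" using h(1) by (auto simp: orbit_box_def)
          have "loc g i (tr i h) \<circ> u \<in> Us i" using g u(1) Us(4) by auto
          moreover have "co y i = (loc g i (tr i h) \<circ> u) (co f i)" using g h(2) u(2) by simp
          ultimately show ?thesis by blast
        qed
        then show "y \<in> orbit_box f" by (simp add: orbit_box_def)
      qed
      then have "g ` orbit_box f = orbit_box f"
        using local_inj[OF loc] finite_orbit_box by (intro endo_inj_surj) (auto intro: inj_on_subset)
      moreover have "co f i \<in> (\<lambda>u. u (co f i)) ` Us i" for i
        using Us(1) by (intro image_eqI[of _ _ id]) auto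
      then have "f \<in> orbit_box f" by (simp add: orbit_box_def)
      ultimately have "f \<in> range g" by blast
      then show "g (inv_into UNIV g f) = f" by (rule f_inv_into_f)
    qed
    then show "g \<in> V" using loc sing local_inj by (simp add: V_def L_def bij_def)
  qed
qed

lemma continuous_on_value: "continuous_on UNIV (\<lambda>g :: nat \<Rightarrow> nat. F (g a))"
  for F :: "nat \<Rightarrow> 'b :: topological_space"
proof -
  have "continuous_on UNIV F" by (simp add: continuous_on_def)
  from continuous_on_compose2[OF this continuous_on_product_coordinates] show ?thesis by simp
qed

lemma closed_V: "closed V"
proof -
  have "closed {g. co (g f) i = loc g i (tr i f) (co f i)}" for f i
    unfolding loc_def by (rule closed_Collect_eq; rule continuous_on_value)
  then have "closed {g. \<forall>i f. co (g f) i = loc g i (tr i f) (co f i)}"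
    by (intro closed_Collect_all)
  moreover have "closed {g. loc g i k \<in> Us i}" for i k
  proof -
    have "continuous_on UNIV (\<lambda>g. loc g i k)"
      unfolding loc_def by (intro continuous_on_coordinatewise_then_product continuous_on_value)
    then have "closed ((\<lambda>g. loc g i k) -` Us i)"
      using lc_perm_group.closed[OF lc] by (intro closed_vimage)
    then show ?thesis by (simp add: vimage_def)
  qed
  then have "closed {g. \<forall>i. \<forall>k\<in>site i. loc g i k \<in> Us i}"
    unfolding Ball_def by (intro closed_Collect_all closed_Collect_imp) auto
  ultimately show ?thesis unfolding V_eq by (intro closed_Collect_conj)
qed

text \<open>Let l be the site to which the conjugate of u carries k. Its local action at k is that
  of g at k, then that of u, then the inverse of that of g at l. If neither k nor l is singular for
  g, all three factors lie in \<open>Us i\<close>; only the finitely many singular sites have to be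
  controlled.\<close>

lemma commensurated_V:
  assumes "g \<in> L"
  shows "\<exists>E. finite E \<and> (\<forall>u\<in>stab V E. pinv g \<circ> u \<circ> g \<in> V)"
proof -
  have g: "bij g" "local g" "finite (sing g)" using assms LD by auto
  define Y where "Y i \<gamma> = (SOME E. finite E \<and> (\<forall>u\<in>stab (Us i) E. pinv \<gamma> \<circ> u \<circ> \<gamma> \<in> Us i))" for i \<gamma>
  have Y: "finite (Y i \<gamma>)" "u \<in> stab (Us i) (Y i \<gamma>) \<Longrightarrow> pinv \<gamma> \<circ> u \<circ> \<gamma> \<in> Us i"
    if "\<gamma> \<in> Gs i" for i \<gamma> u
    using someI_ex[OF lc_perm_group.commensurated[OF lc that]] by (simp_all add: Y_def)
  \<comment> \<open>For a singular site k, fixing g k forces l to equal k, and fixing the other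
    points forces the local action of u at the image of k to fix the finite set that commensuration
    in \<open>Gs i\<close> demands.\<close>
  define E where "E = (\<Union>(i, k)\<in>sing g. insert (g k) (upd (tr i (g k)) i ` Y i (loc g i k)))"
  have "finite E"
    unfolding E_def using g(3) Y(1) localD(2)[OF g(2)] by (auto simp: sing_def split_beta)
  moreover have "pinv g \<circ> u \<circ> g \<in> V" if u: "u \<in> stab V E" for u
  proof -
    have uV: "u \<in> V" and uE: "\<And>x. x \<in> E \<Longrightarrow> u x = x" using u by (auto simp: stab_def)
    have lu: "local u" "bij u" using uV VD LD by auto
    have lpg: "local (pinv g)" "bij (pinv g)" using local_pinv g by auto
    let ?w = "pinv g \<circ> u \<circ> g"
    have wL: "?w \<in> L" using L(4)[OF L(4)[OF L(3)[OF assms] VD(1)[OF uV]] assms] .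
    have "loc ?w i k \<in> Us i" if k: "k \<in> site i" for i k
    proof -
      define t where "t = tr i (g k)"
      define t' where "t' = tr i (u t)"
      define l where "l = tr i (pinv g t')"
      have sites: "t \<in> site i" "t' \<in> site i" "l \<in> site i" by (simp_all add: t_def t'_def l_def)
      have tt': "tr i (u (g k)) = t'" unfolding t'_def t_def by (rule local_tr[OF lu(1)]) simp
      have "tr i (g l) = tr i (g (pinv g t'))" unfolding l_def by (rule local_tr[OF g(2)]) simp
      then have gl: "tr i (g l) = t'" using g(1) sites by simp
      have w: "loc ?w i k = pinv (loc g i l) \<circ> loc u i t \<circ> loc g i k"
        using loc_comp[OF local_comp[OF lpg(1) lu(1)] g(2) k] loc_comp[OF lpg(1) lu(1) sites(1)]
          loc_pinv[OF g(2,1) sites(2)]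
        by (simp add: t_def[symmetric] t'_def[symmetric] l_def[symmetric])
      have ut: "loc u i t \<in> Us i" using VD(2)[OF uV sites(1)] .
      show ?thesis
      proof (cases "(i, k) \<in> sing g \<or> (i, l) \<in> sing g")
        case False
        then have kl: "loc g i k \<in> Us i" "loc g i l \<in> Us i" using k sites by (auto simp: sing_def)
        show ?thesis unfolding w using Us(4)[OF Us(4)[OF Us(3)[OF kl(2)] ut] kl(1)] .
      next
        case True
        then have kl: "k = l" "(i, k) \<in> sing g"
        proof -
          have "k = l"
          proof (cases "(i, k) \<in> sing g")
            case True
            then have "g k \<in> E" by (auto simp: E_def)
            then have "u (g k) = g k" by (rule uE)
            then have "tr i (g k) = tr i (g l)" using tt' gl by simp
            then show ?thesis using site_cancel[OF g(2) k sites(3)] by blast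
          next
            case False
            then have "g l \<in> E" using True by (auto simp: E_def)
            then have "u (g l) = g l" by (rule uE)
            moreover have "tr i (u (g l)) = tr i (u t')" using local_tr[OF lu(1)] gl sites(2) by (metis tr_id)
            ultimately have "tr i (u t') = tr i (u t)" using gl by (simp add: t'_def)
            then have "t' = t" using site_cancel[OF lu(1) sites(2,1)] by blast
            then have "tr i (g k) = tr i (g l)" using gl by (simp add: t_def)
            then show ?thesis using site_cancel[OF g(2) k sites(3)] by blast
          qed
          then show "k = l" "(i, k) \<in> sing g" using True by auto
        qed
        have \<gamma>: "loc g i k \<in> Gs i" using localD(2)[OF g(2) k] .
        have "loc u i t y = y" if "y \<in> Y i (loc g i k)" for y
        proof -
          have "upd t i y \<in> E" using kl(2) that by (force simp: E_def t_def)
          then have "u (upd t i y) = upd t i y" by (rule uE)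
          then show ?thesis by (simp add: loc_def)
        qed
        then have "loc u i t \<in> stab (Us i) (Y i (loc g i k))" using ut by (simp add: stab_def)
        then show ?thesis unfolding w kl(1)[symmetric] by (rule Y(2)[OF \<gamma>])
      qed
    qed
    then show ?thesis using wL by (auto simp: V_def sing_def)
  qed
  ultimately show ?thesis by blast
qed

lemma countable_index_V: "\<exists>c :: (nat \<Rightarrow> nat) \<Rightarrow> nat. \<forall>g\<in>L. \<forall>h\<in>L. c g = c h \<longrightarrow> pinv g \<circ> h \<in> V"
proof -
  obtain c :: "int \<Rightarrow> (nat \<Rightarrow> nat) \<Rightarrow> nat" where
    c: "\<And>i g h. g \<in> Gs i \<Longrightarrow> h \<in> Gs i \<Longrightarrow> c i g = c i h \<Longrightarrow> pinv g \<circ> h \<in> Us i"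
    using lc_perm_group.countable_index[OF lc] by metis
  \<comment> \<open>The code records the images of the singular sites, not the sites: right
    multiplication by \<open>V\<close> may move the sites, but changes neither their images nor the
    left cosets of the local actions.\<close>
  define \<Lambda> where "\<Lambda> g = (\<lambda>(i, k). (i, tr i (g k), c i (loc g i k))) ` sing g" for g
  define code where "code g = to_nat_on (Collect finite) (\<Lambda> g)" for g
  have "pinv g \<circ> h \<in> V" if gh: "g \<in> L" "h \<in> L" "code g = code h" for g h
  proof -
    have fin: "finite (\<Lambda> g)" "finite (\<Lambda> h)" using gh(1,2) LD(3) by (simp_all add: \<Lambda>_def)
    have "\<Lambda> g = \<Lambda> h"
      using gh(3) fin inj_on_to_nat_on[OF countable_Collect_finite]
      by (auto simp: code_def inj_on_def)
    have g: "bij g" "local g" and h: "bij h" "local h" using gh(1,2) LD by auto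
    have lpg: "local (pinv g)" using local_pinv g by blast
    have "loc (pinv g \<circ> h) i k \<in> Us i" if k: "k \<in> site i" for i k
    proof -
      define t where "t = tr i (h k)"
      define l where "l = tr i (pinv g t)"
      have sites: "t \<in> site i" "l \<in> site i" by (simp_all add: t_def l_def)
      have "tr i (g l) = tr i (g (pinv g t))" unfolding l_def by (rule local_tr[OF g(2)]) simp
      then have gl: "tr i (g l) = t" using g(1) sites by simp
      have eq: "loc (pinv g \<circ> h) i k = pinv (loc g i l) \<circ> loc h i k"
        using loc_comp[OF lpg h(2) k] loc_pinv[OF g(2,1) sites(1)] by (simp add: t_def l_def)
      show ?thesis
      proof (cases "(i, k) \<in> sing h")
        case True
        then have "(i, t, c i (loc h i k)) \<in> \<Lambda> h" by (force simp: \<Lambda>_def t_def)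
        then have "(i, t, c i (loc h i k)) \<in> \<Lambda> g" using \<open>\<Lambda> g = \<Lambda> h\<close> by simp
        then obtain l' where l': "(i, l') \<in> sing g" "tr i (g l') = t" "c i (loc g i l') = c i (loc h i k)"
          by (auto simp: \<Lambda>_def)
        have "l' = l" using site_cancel[OF g(2) _ sites(2)] l'(1,2) gl by (auto simp: sing_def)
        then show ?thesis
          unfolding eq using l'(3) c localD(2)[OF g(2) sites(2)] localD(2)[OF h(2) k] by metis
      next
        case False
        have "(i, l) \<notin> sing g"
        proof
          assume "(i, l) \<in> sing g"
          then have "(i, t, c i (loc g i l)) \<in> \<Lambda> g" using gl by (force simp: \<Lambda>_def)
          then have "(i, t, c i (loc g i l)) \<in> \<Lambda> h" using \<open>\<Lambda> g = \<Lambda> h\<close> by simp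
          then obtain k' where k': "(i, k') \<in> sing h" "tr i (h k') = t" by (auto simp: \<Lambda>_def)
          then have "k' = k" using site_cancel[OF h(2) _ k] by (auto simp: sing_def t_def)
          then show False using k'(1) False by simp
        qed
        then have lk: "loc g i l \<in> Us i" "loc h i k \<in> Us i" using False k sites by (auto simp: sing_def)
        show ?thesis unfolding eq using Us(4)[OF Us(3)[OF lk(1)] lk(2)] .
      qed
    qed
    then show ?thesis using L(4)[OF L(3)[OF gh(1)] gh(2)] by (auto simp: V_def sing_def)
  qed
  then show ?thesis by blast
qed

lemma lc_L: "lc_perm_group L V"
  using perm_group_L perm_group_V commensurated_V countable_index_V closed_V finite_orbits_V VD(1)
  by (intro lc_perm_group.intro) auto

end

section \<open>Elements acting at a single site\<close>

context wreath
begin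

definition single :: "int \<Rightarrow> nat \<Rightarrow> (nat \<Rightarrow> nat) \<Rightarrow> nat \<Rightarrow> nat"
  where "single i k \<gamma> f = (if tr i f = k then upd f i (\<gamma> (co f i)) else f)"

lemma co_single: "co (single i k \<gamma> f) j = (if j = i \<and> tr i f = k then \<gamma> (co f i) else co f j)"
  by (simp add: single_def)

lemma single_comp: "single i k (\<gamma> \<circ> \<delta>) = single i k \<gamma> \<circ> single i k \<delta>"
  by (rule ext, rule co_eqI) (simp add: single_def)

lemma single_id: "single i k id = id"
  by (rule ext, rule co_eqI) (simp add: co_single)

lemma loc_single:
  assumes "l \<in> site j"
  shows "loc (single i k \<gamma>) j l = (if j = i \<and> l = k then \<gamma> else id)"
  using assms by (auto simp: loc_def co_single fun_eq_iff)

lemma single_pinv: "bij \<gamma> \<Longrightarrow> single i k \<gamma> \<circ> single i k (pinv \<gamma>) = id"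
  "bij \<gamma> \<Longrightarrow> single i k (pinv \<gamma>) \<circ> single i k \<gamma> = id"
  by (simp_all add: single_comp[symmetric] single_id)

lemma bij_single: "bij \<gamma> \<Longrightarrow> bij (single i k \<gamma>)"
  using single_pinv by (rule o_bij[rotated])

lemma pinv_single: "bij \<gamma> \<Longrightarrow> pinv (single i k \<gamma>) = single i k (pinv \<gamma>)"
  using inv_unique_comp[OF single_pinv] .

lemma single_in_L:
  assumes "\<gamma> \<in> Gs i"
  shows "single i k \<gamma> \<in> L"
proof -
  have "local (single i k \<gamma>)"
    unfolding local_def using assms Gs(1) by (auto simp: loc_single co_single)
  moreover have "sing (single i k \<gamma>) \<subseteq> {(i, k)}"
    using Us(1) by (auto simp: sing_def loc_single split: if_splits)
  then have "finite (sing (single i k \<gamma>))" by (rule finite_subset) simp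
  ultimately show ?thesis using bij_single Gs(2)[OF assms] by (simp add: L_def)
qed

lemma single_in_V:
  assumes "u \<in> Us i"
  shows "single i k u \<in> V"
proof -
  have "sing (single i k u) = {}"
    using Us(1) assms by (auto simp: sing_def loc_single)
  then show ?thesis using single_in_L[OF Us_Gs[OF assms]] by (simp add: V_def)
qed

lemma single_stab:
  assumes "u \<in> stab (Us i) ((\<lambda>f. co f i) ` E)"
  shows "single i k u \<in> stab V E"
proof -
  have "single i k u f = f" if "f \<in> E" for f
    using assms that by - (rule co_eqI, auto simp: co_single stab_def)
  then show ?thesis using single_in_V assms by (simp add: stab_def)
qed

subsection \<open>Retractions\<close>

definition up_closed :: "int set \<Rightarrow> bool"
  where "up_closed S \<longleftrightarrow> (\<forall>i\<in>S. \<forall>j. i \<sqsubset> j \<longrightarrow> j \<in> S)"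

definition ret :: "int set \<Rightarrow> (nat \<Rightarrow> nat) \<Rightarrow> nat \<Rightarrow> nat"
  where "ret S g f = enc (\<lambda>j. if j \<in> S then co (g f) j else co f j)"

lemma co_ret [simp]: "co (ret S g f) j = (if j \<in> S then co (g f) j else co f j)"
proof -
  have "finite {j. (if j \<in> S then co (g f) j else co f j) \<noteq> 0}"
    by (rule finite_subset[of _ "{j. co (g f) j \<noteq> 0} \<union> {j. co f j \<noteq> 0}"]) (auto simp: finite_co)
  then show ?thesis by (simp add: ret_def co_enc)
qed

lemma loc_ret: "loc (ret S g) i k = (if i \<in> S then loc g i k else id)"
  by (auto simp: loc_def fun_eq_iff)

text \<open>For an up-closed S, the values of g f on S depend only on the values of f on S, so
  restricting the action to these levels is a homomorphism.\<close>

lemma ret_comp: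
  assumes "up_closed S" "local g"
  shows "ret S (g \<circ> h) = ret S g \<circ> ret S h"
proof (rule ext, rule co_eqI)
  fix f j
  have "co (g (ret S h f)) j = co (g (h f)) j" if "j \<in> S"
  proof -
    have "tr j (ret S h f) = tr j (h f)"
      using assms(1) that by (auto simp: tr_eq_iff up_closed_def)
    then show ?thesis using localD(1)[OF assms(2)] that by simp
  qed
  then show "co (ret S (g \<circ> h) f) j = co ((ret S g \<circ> ret S h) f) j" by simp
qed

lemma ret_id [simp]: "ret S id = id"
  by (rule ext, rule co_eqI) simp

lemma local_ret: "local g \<Longrightarrow> local (ret S g)"
  unfolding local_def using Gs(1) by (auto simp: loc_ret)

lemma sing_ret: "sing (ret S g) = {(i, k) \<in> sing g. i \<in> S}"
  using Us(1) by (auto simp: sing_def loc_ret)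

lemma ret_in_L:
  assumes "up_closed S" "g \<in> L"
  shows "ret S g \<in> L"
proof -
  have g: "bij g" "local g" "finite (sing g)" using assms(2) LD by auto
  have "ret S g \<circ> ret S (pinv g) = id" "ret S (pinv g) \<circ> ret S g = id"
    using ret_comp[OF assms(1)] g local_pinv by (simp_all add: ret_comp[OF assms(1), symmetric])
  then have "bij (ret S g)" using o_bij by blast
  moreover have "finite (sing (ret S g))"
    using g(3) by (rule finite_subset[rotated]) (auto simp: sing_ret)
  ultimately show ?thesis using g(2) local_ret by (simp add: L_def)
qed

lemma ret_stab:
  assumes "up_closed S" "v \<in> stab V E"
  shows "ret S v \<in> stab V E"
proof -
  have "ret S v f = f" if "v f = f" for f
    using that by - (rule co_eqI, simp)
  then show ?thesis
    using assms ret_in_L by (auto simp: stab_def V_def sing_ret)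
qed

sublocale lc: lc_perm_group L V
  by (rule lc_L)

text \<open>These subgroups contain \<open>V\<close>, hence are open; for finite J they exhaust
  \<open>L\<close>, as \<open>sing\<close> is finite.\<close>

definition levels_in :: "int set \<Rightarrow> (nat \<Rightarrow> nat) set"
  where "levels_in J = {g \<in> L. sing g \<subseteq> J \<times> UNIV}"

lemma perm_group_levels_in: "perm_group (levels_in J)"
  unfolding perm_group_def
proof (intro conjI ballI)
  show "id \<in> levels_in J" using L(1) by (simp add: levels_in_def)
  fix g assume g: "g \<in> levels_in J"
  then have gL: "g \<in> L" by (simp add: levels_in_def)
  then show "bij g" using LD by blast
  show "pinv g \<in> levels_in J"
    using g sing_pinv[OF LD(2)[OF gL] LD(1)[OF gL]] L(3)[OF gL] by (auto simp: levels_in_def)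
  fix h assume h: "h \<in> levels_in J"
  then have hL: "h \<in> L" by (simp add: levels_in_def)
  show "g \<circ> h \<in> levels_in J"
    using g h sing_comp[OF LD(2)[OF gL] LD(2)[OF hL]] L(4)[OF gL hL]
    by (auto simp: levels_in_def)
qed

lemma V_levels_in: "V \<subseteq> levels_in J"
  by (auto simp: levels_in_def V_def)

lemma levels_in_L: "levels_in J \<subseteq> L"
  by (auto simp: levels_in_def)

lemma closed_levels_in: "lc.closed_perm_subgroup (levels_in J)"
  by (rule lc.closed_perm_subgroup_open[OF lc.closed_perm_subgroup_self perm_group_levels_in levels_in_L])
    (use V_levels_in in blast)

lemma closed_V_sub: "lc.closed_perm_subgroup V"
  by (rule lc.closed_perm_subgroup_open[OF lc.closed_perm_subgroup_self perm_group_V]) (use VD in auto)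

lemma ranked_elementary_V: "lc.ranked_elementary_sub V"
  using lc.ranked_elementary_compact_open by (simp add: lc.ranked_elementary_sub_def)

lemma perm_group_kernel:
  assumes "perm_group H" "\<And>g h. g \<in> H \<Longrightarrow> h \<in> H \<Longrightarrow> \<phi> (g \<circ> h) = \<phi> g \<circ> \<phi> h" "\<phi> id = id"
  shows "perm_group {h \<in> H. \<phi> h = id}"
  unfolding perm_group_def
proof (intro conjI ballI)
  fix g assume g: "g \<in> {h \<in> H. \<phi> h = id}"
  then show "bij g" using perm_groupD(2)[OF assms(1)] by blast
  have "\<phi> (pinv g) = \<phi> g \<circ> \<phi> (pinv g)" using g by simp
  also have "\<dots> = id"
    using g assms perm_groupD(2,3)[OF assms(1)] assms(2)[of g "pinv g"] by simp
  finally show "pinv g \<in> {h \<in> H. \<phi> h = id}" using g perm_groupD(3)[OF assms(1)] by simp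
qed (use assms perm_groupD[OF assms(1)] in auto)

lemma ret_id_iff: "ret S g = id \<longleftrightarrow> (\<forall>f. \<forall>i\<in>S. co (g f) i = co f i)"
proof
  assume "ret S g = id"
  then have "co (ret S g f) i = co f i" for f i by simp
  then show "\<forall>f. \<forall>i\<in>S. co (g f) i = co f i" by (metis co_ret)
next
  assume "\<forall>f. \<forall>i\<in>S. co (g f) i = co f i"
  then show "ret S g = id" by - (rule ext, rule co_eqI, simp)
qed

lemma ret_self_iff: "ret S g = g \<longleftrightarrow> (\<forall>f. \<forall>i\<in>-S. co (g f) i = co f i)"
proof
  assume "ret S g = g"
  then have "co (ret S g f) i = co (g f) i" for f i by simp
  then show "\<forall>f. \<forall>i\<in>-S. co (g f) i = co f i" by (metis co_ret ComplD)
next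
  assume "\<forall>f. \<forall>i\<in>-S. co (g f) i = co f i"
  then show "ret S g = g" by - (rule ext, rule co_eqI, simp)
qed

lemma closed_kernel_ret:
  assumes "lc.closed_perm_subgroup H" "up_closed S"
  shows "lc.closed_perm_subgroup {h \<in> H. ret S h = id}"
proof (rule lc.closed_perm_subgroup_values[OF assms(1)])
  note H = lc.closed_perm_subgroupD[OF assms(1)]
  show "perm_group {h \<in> H. ret S h = id}"
    using ret_comp[OF assms(2)] LD(2) H(1) by (intro perm_group_kernel[OF H(2)]) auto
  show "{h \<in> H. ret S h = id} = {h \<in> H. \<forall>f. (\<lambda>f y. \<forall>i\<in>S. co y i = co f i) f (h f)}"
    by (simp add: ret_id_iff)
qed

lemma closed_image_ret:
  assumes "lc.closed_perm_subgroup H" "up_closed S"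
  shows "lc.closed_perm_subgroup {h \<in> H. ret S h = h}"
proof (rule lc.closed_perm_subgroup_values[OF assms(1)])
  note H = lc.closed_perm_subgroupD[OF assms(1)]
  show "perm_group {h \<in> H. ret S h = h}"
    unfolding perm_group_def
  proof (intro conjI ballI)
    show "id \<in> {h \<in> H. ret S h = h}" using perm_groupD(1)[OF H(2)] by simp
    fix g assume g: "g \<in> {h \<in> H. ret S h = h}"
    then have gL: "g \<in> L" using H(1) by blast
    show "bij g" using LD(1)[OF gL] .
    have "g \<circ> ret S (pinv g) = ret S (g \<circ> pinv g)"
      using ret_comp[OF assms(2) LD(2)[OF gL]] g by simp
    also have "\<dots> = id" using LD(1)[OF gL] by simp
    finally have "pinv g \<circ> (g \<circ> ret S (pinv g)) = pinv g" by simp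
    then have "ret S (pinv g) = pinv g" using LD(1)[OF gL] by (simp add: comp_assoc[symmetric])
    then show "pinv g \<in> {h \<in> H. ret S h = h}" using g perm_groupD(3)[OF H(2)] by simp
    fix h assume h: "h \<in> {h \<in> H. ret S h = h}"
    then show "g \<circ> h \<in> {h \<in> H. ret S h = h}"
      using g ret_comp[OF assms(2) LD(2)[OF gL], of h] perm_groupD(4)[OF H(2)] by simp
  qed
  show "{h \<in> H. ret S h = h} = {h \<in> H. \<forall>f. (\<lambda>f y. \<forall>i\<in>-S. co y i = co f i) f (h f)}"
    unfolding ret_self_iff ..
qed

text \<open>The retraction is a homomorphism split by the inclusion of its image, so H is an
  extension of the image by the kernel with a continuous section.\<close>

lemma ranked_elementary_retract:
  assumes "lc.closed_perm_subgroup H" "up_closed S"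
    and "\<And>h. h \<in> H \<Longrightarrow> ret S h \<in> H"
    and "lc.ranked_elementary_sub {h \<in> H. ret S h = h}" "lc.ranked_elementary_sub {h \<in> H. ret S h = id}"
  shows "lc.ranked_elementary_sub H"
proof -
  let ?Q = "{h \<in> H. ret S h = h}"
  have Q: "perm_group ?Q" using lc.closed_perm_subgroupD(2)[OF closed_image_ret[OF assms(1,2)]] .
  have retret: "ret S (ret S h) = ret S h" for h
    by (rule ext, rule co_eqI) simp
  have HL: "H \<subseteq> L" using lc.closed_perm_subgroupD(1)[OF assms(1)] .
  show ?thesis
  proof (rule lc.ranked_elementary_sub_extension[OF assms(1) _ Q, where \<psi> = "\<lambda>q. q" and \<phi> = "ret S"])
    show "ranked_elementary (pg ?Q) (ptop ?Q (V \<inter> ?Q))"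
      using assms(4) by (simp add: lc.ranked_elementary_sub_def)
    show "\<exists>F. finite F \<and> (\<forall>v\<in>stab (V \<inter> H) F. ret S v \<in> stab (V \<inter> ?Q) E)" if "finite E" for E
    proof (intro exI[of _ E] conjI ballI that)
      fix v assume v: "v \<in> stab (V \<inter> H) E"
      then have "v \<in> stab V E" by (simp add: stab_def)
      then have "ret S v \<in> stab V E" by (rule ret_stab[OF assms(2)])
      then show "ret S v \<in> stab (V \<inter> ?Q) E"
        using assms(3) v retret by (simp add: stab_def)
    qed
    show "\<exists>F. finite F \<and> (\<forall>v\<in>stab (V \<inter> ?Q) F. v \<in> stab V E)" if "finite E" for E
      using that by (intro exI[of _ E]) (auto simp: stab_def)
  qed (use assms(3,5) retret ret_comp[OF assms(2)] LD(2) HL in auto)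
qed

subsection \<open>One level\<close>

text \<open>The restricted product, over the sites of level j, of copies of \<open>Gs j\<close>
  relative to \<open>Us j\<close>; its elements move no site of level j, so the local actions
  multiply independently.\<close>

definition level :: "int \<Rightarrow> (nat \<Rightarrow> nat) set"
  where "level j = {g \<in> L. ret (- {j}) g = id}"

lemma level_co: "g \<in> level j \<Longrightarrow> i \<noteq> j \<Longrightarrow> co (g f) i = co f i"
  by (auto simp: level_def ret_id_iff)

lemma level_tr: "g \<in> level j \<Longrightarrow> tr j (g f) = tr j f"
  using level_co[of g j] lt_less by (fastforce simp: tr_eq_iff)

lemma perm_group_level: "perm_group (level j)"
  unfolding perm_group_def
proof (intro conjI ballI)
  show "id \<in> level j" using L(1) by (simp add: level_def)
  fix g assume g: "g \<in> level j"
  then have gL: "g \<in> L" by (simp add: level_def)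
  show "bij g" using LD(1)[OF gL] .
  have "co (pinv g f) i = co f i" if "i \<noteq> j" for f i
    using level_co[OF g that, of "pinv g f"] LD(1)[OF gL] by simp
  then show "pinv g \<in> level j" using L(3)[OF gL] by (auto simp: level_def ret_id_iff)
  fix h assume h: "h \<in> level j"
  then have "g \<circ> h \<in> L" using L(4)[OF gL] by (simp add: level_def)
  then show "g \<circ> h \<in> level j" using level_co[OF g] level_co[OF h] by (auto simp: level_def ret_id_iff)
qed

lemma closed_level: "lc.closed_perm_subgroup (level j)"
proof (rule lc.closed_perm_subgroup_values[OF lc.closed_perm_subgroup_self perm_group_level])
  show "level j = {g \<in> L. \<forall>f. (\<lambda>f y. \<forall>i\<in>-{j}. co y i = co f i) f (g f)}"
    unfolding level_def ret_id_iff ..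
qed

lemma loc_level: "g \<in> level j \<Longrightarrow> i \<noteq> j \<Longrightarrow> loc g i k = id"
  by (simp add: loc_def level_co fun_eq_iff)

lemma loc_comp_level:
  assumes "g \<in> level j" "h \<in> level j" "k \<in> site j"
  shows "loc (g \<circ> h) j k = loc g j k \<circ> loc h j k"
proof -
  have "local g" "local h" using assms(1,2) LD(2) by (auto simp: level_def)
  then show ?thesis using loc_comp[of g h k j] level_tr[OF assms(2), of k] assms(3) by simp
qed

lemma loc_pinv_level:
  assumes "g \<in> level j" "k \<in> site j"
  shows "loc (pinv g) j k = pinv (loc g j k)"
proof -
  have "local g" "bij g" using assms(1) LD by (auto simp: level_def)
  moreover have "pinv g \<in> level j" using perm_groupD(3)[OF perm_group_level assms(1)] .
  ultimately show ?thesis using loc_pinv[of g k j] level_tr[of "pinv g" j k] assms(2) by simp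
qed

definition level_sites :: "int \<Rightarrow> nat set \<Rightarrow> (nat \<Rightarrow> nat) set"
  where "level_sites j E = {g \<in> level j. \<forall>k\<in>site j - E. loc g j k \<in> Us j}"

lemma perm_group_level_sites: "perm_group (level_sites j E)"
  unfolding perm_group_def
proof (intro conjI ballI)
  note lev = perm_groupD[OF perm_group_level[of j]]
  show "id \<in> level_sites j E" using lev(1) Us(1) by (simp add: level_sites_def)
  fix g assume g: "g \<in> level_sites j E"
  then have gl: "g \<in> level j" by (simp add: level_sites_def)
  show "bij g" using lev(2)[OF gl] .
  show "pinv g \<in> level_sites j E"
    using g lev(3)[OF gl] loc_pinv_level[OF gl] Us(3) by (auto simp: level_sites_def)
  fix h assume h: "h \<in> level_sites j E"
  then have hl: "h \<in> level j" by (simp add: level_sites_def)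
  show "g \<circ> h \<in> level_sites j E"
    using g h lev(4)[OF gl hl] loc_comp_level[OF gl hl] Us(4) by (auto simp: level_sites_def)
qed

lemma V_level_sites: "V \<inter> level j \<subseteq> level_sites j E"
  using VD(2) by (auto simp: level_sites_def)

lemma closed_level_sites: "lc.closed_perm_subgroup (level_sites j E)"
  by (rule lc.closed_perm_subgroup_open[OF closed_level perm_group_level_sites])
    (use V_level_sites in \<open>auto simp: level_sites_def\<close>)

lemma level_sites_empty: "level_sites j {} \<subseteq> V"
  using Us(1) loc_level by (auto simp: level_sites_def V_def sing_def level_def)
    (metis (no_types, lifting) level_def mem_Collect_eq)

lemma single_level: "\<gamma> \<in> Gs j \<Longrightarrow> single j k \<gamma> \<in> level j"
  using single_in_L by (auto simp: level_def ret_id_iff co_single)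

text \<open>The right-hand side relates each f to g f, which is the shape that
  \<open>closed_perm_subgroup_values\<close> takes.\<close>

lemma loc_eq_id_iff: "loc g j k = id \<longleftrightarrow> (\<forall>f. \<forall>x. f = upd k j x \<longrightarrow> co (g f) j = x)"
  by (auto simp: loc_def fun_eq_iff)

text \<open>Each step splits off the copy of \<open>Gs j\<close> at one site k: the local action at
  k is a homomorphism with section \<open>single j k\<close>, and its kernel is covered by the
  smaller set. With no free sites, the group lies in the compact \<open>V\<close>.\<close>

lemma ranked_elementary_level_sites:
  assumes lamps: "ranked_elementary (pg (Gs j)) (ptop (Gs j) (Us j))"
    and "finite E" "E \<subseteq> site j"
  shows "lc.ranked_elementary_sub (level_sites j E)"
  using assms(2,3)
proof (induction E)
  case empty
  then show ?case
    using lc.ranked_elementary_sub_closed[OF ranked_elementary_V closed_V_sub closed_level_sites]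
      level_sites_empty by blast
next
  case (insert k E)
  then have k: "k \<in> site j" by simp
  let ?H = "level_sites j (insert k E)" and ?\<phi> = "\<lambda>g. loc g j k"
  have Hlev: "g \<in> level j" if "g \<in> ?H" for g using that by (simp add: level_sites_def)
  have comp: "?\<phi> (g \<circ> h) = ?\<phi> g \<circ> ?\<phi> h" if "g \<in> ?H" "h \<in> ?H" for g h
    using loc_comp_level[OF Hlev Hlev k] that by blast
  show ?case
  proof (rule lc.ranked_elementary_sub_extension[OF closed_level_sites lamps,
        where \<phi> = ?\<phi> and \<psi> = "single j k"])
    show "perm_group (Gs j)" "Us j \<subseteq> Gs j" using lc_perm_group.perm_group[OF lc] by auto
    show "?\<phi> g \<in> Gs j" if "g \<in> ?H" for g
      using Hlev[OF that] localD(2)[OF _ k] LD(2) by (auto simp: level_def)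
    show "\<exists>F. finite F \<and> (\<forall>v\<in>stab (V \<inter> ?H) F. ?\<phi> v \<in> stab (Us j) Y)" if "finite Y" for Y
    proof (intro exI[of _ "upd k j ` Y"] conjI ballI)
      fix v assume v: "v \<in> stab (V \<inter> ?H) (upd k j ` Y)"
      then have "?\<phi> v \<in> Us j" using VD(2)[OF _ k] by (simp add: stab_def)
      moreover have "?\<phi> v y = y" if "y \<in> Y" for y using v that by (simp add: stab_def loc_def)
      ultimately show "?\<phi> v \<in> stab (Us j) Y" by (simp add: stab_def)
    qed (use that in simp)
    show "single j k q \<in> ?H" if "q \<in> Gs j" for q
      using that single_level Us(1) loc_single[of _ j j k q]
      by (auto simp: level_sites_def)
    show "\<exists>F. finite F \<and> (\<forall>v\<in>stab (Us j) F. single j k v \<in> stab V Y)" if "finite Y" for Y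
      using that single_stab by (intro exI[of _ "(\<lambda>f. co f j) ` Y"]) auto
    show "?\<phi> (single j k q) = q" for q using loc_single[OF k] by simp
    have sub: "{h \<in> ?H. ?\<phi> h = id} \<subseteq> level_sites j E"
      using Us(1) by (auto simp: level_sites_def)
    have "lc.closed_perm_subgroup {h \<in> ?H. ?\<phi> h = id}"
    proof (rule lc.closed_perm_subgroup_values[OF closed_level_sites])
      show "perm_group {h \<in> ?H. ?\<phi> h = id}"
        using comp by (intro perm_group_kernel[OF perm_group_level_sites]) auto
      show "{h \<in> ?H. ?\<phi> h = id} = {h \<in> ?H. \<forall>f. (\<lambda>f y. \<forall>x. f = upd k j x \<longrightarrow> co y j = x) f (h f)}"
        unfolding loc_eq_id_iff ..
    qed
    moreover have "lc.ranked_elementary_sub (level_sites j E)"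
      using insert.IH insert.prems by blast
    ultimately show "lc.ranked_elementary_sub {h \<in> ?H. ?\<phi> h = id}"
      using lc.ranked_elementary_sub_closed[OF _ closed_level_sites _ sub] by blast
  qed (use single_comp comp in auto)
qed

lemma ranked_elementary_level:
  assumes "ranked_elementary (pg (Gs j)) (ptop (Gs j) (Us j))"
  shows "lc.ranked_elementary_sub (level j)"
proof (rule lc.ranked_elementary_sub_union[OF closed_level])
  let ?W = "\<lambda>n. level_sites j (site j \<inter> {..n})"
  show "incseq ?W" by (auto simp: incseq_def level_sites_def)
  show "(\<Union>n. ?W n) = level j"
  proof
    show "level j \<subseteq> (\<Union>n. ?W n)"
    proof
      fix g assume g: "g \<in> level j"
      then have "finite (snd ` sing g)" using LD(3) by (auto simp: level_def)
      then obtain n where n: "snd ` sing g \<subseteq> {..n}" using finite_nat_iff_bounded_le by blast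
      have "g \<in> ?W n"
        using g n by (force simp: level_sites_def sing_def)
      then show "g \<in> (\<Union>n. ?W n)" by blast
    qed
  qed (auto simp: level_sites_def)
  show "perm_group (?W n)" for n by (rule perm_group_level_sites)
  show "V \<inter> level j \<subseteq> ?W n" for n by (rule V_level_sites)
  show "lc.ranked_elementary_sub (?W n)" for n
    by (rule ranked_elementary_level_sites[OF assms]) auto
qed

subsection \<open>All levels\<close>

text \<open>Levels are added in decreasing order. Two retractions cut the group into three pieces:
  the image on the levels S, which is governed by J; the single level j; and a rest without singular
  sites, contained in \<open>V\<close>.\<close>

lemma ranked_elementary_levels_in:
  assumes "\<And>j. ranked_elementary (pg (Gs j)) (ptop (Gs j) (Us j))" "finite J"
  shows "lc.ranked_elementary_sub (levels_in J)"
  using assms(2)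
proof (induction J rule: finite_linorder_min_induct)
  case empty
  have "levels_in {} = V" by (auto simp: levels_in_def V_def)
  then show ?case using ranked_elementary_V by simp
next
  case (insert j J)
  let ?H = "levels_in (insert j J)"
  \<comment> \<open>The new level j is smaller than all of J, so S contains J. Both S and its union
    with j are up-closed by transitivity.\<close>
  define S where "S = {i. i \<noteq> j \<and> \<not> i \<sqsubset> j}"
  have J: "J \<subseteq> S" using insert.hyps(2) lt_less by (fastforce simp: S_def)
  have jS: "j \<notin> S" by (simp add: S_def)
  have S: "up_closed S" "up_closed (insert j S)"
    using lt_trans lt_less by (fastforce simp: S_def up_closed_def)+
  show ?case
  proof (rule ranked_elementary_retract[OF closed_levels_in S(1)])
    show ret: "ret S h \<in> ?H" if "h \<in> ?H" for h
      using that ret_in_L[OF S(1)] by (auto simp: levels_in_def sing_ret)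
    have sub: "{h \<in> ?H. ret S h = h} \<subseteq> levels_in J"
    proof
      fix h assume h: "h \<in> {h \<in> ?H. ret S h = h}"
      then have "sing h = {(i, k) \<in> sing h. i \<in> S}" using sing_ret[of S h] by simp
      then show "h \<in> levels_in J" using h jS by (auto simp: levels_in_def)
    qed
    show "lc.ranked_elementary_sub {h \<in> ?H. ret S h = h}"
      by (rule lc.ranked_elementary_sub_closed[OF insert.IH closed_levels_in
            closed_image_ret[OF closed_levels_in S(1)] sub])
    let ?K = "{h \<in> ?H. ret S h = id}"
    have K: "lc.closed_perm_subgroup ?K" by (rule closed_kernel_ret[OF closed_levels_in S(1)])
    \<comment> \<open>Here the levels in S are already trivial, so the image of the second
      retraction acts at level j alone. What it kills acts only below j, where no singular sites are
      allowed.\<close>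
    show "lc.ranked_elementary_sub ?K"
    proof (rule ranked_elementary_retract[OF K S(2)])
      have locS: "co (h f) i = co f i" if "h \<in> ?K" "i \<in> S" for h f i
        using that by (auto simp: ret_id_iff)
      show "ret (insert j S) h \<in> ?K" if "h \<in> ?K" for h
        using that ret_in_L[OF S(2)] locS[OF that] jS by (auto simp: levels_in_def sing_ret ret_id_iff)
      have "{h \<in> ?K. ret (insert j S) h = h} = level j"
      proof
        show "{h \<in> ?K. ret (insert j S) h = h} \<subseteq> level j"
          using levels_in_L[of "insert j J"] unfolding level_def ret_id_iff ret_self_iff by blast
        show "level j \<subseteq> {h \<in> ?K. ret (insert j S) h = h}"
        proof
          fix h assume h: "h \<in> level j"
          have "h \<in> L" using h by (simp add: level_def)
          moreover have "sing h \<subseteq> insert j J \<times> UNIV"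
            using loc_level[OF h] Us(1) by (auto simp: sing_def) metis
          moreover have "co (h f) i = co f i" if "i \<in> S \<or> i \<notin> insert j S" for f i
            using level_co[OF h, of i f] jS that by blast
          ultimately show "h \<in> {h \<in> ?K. ret (insert j S) h = h}"
            unfolding levels_in_def ret_id_iff ret_self_iff by simp
        qed
      qed
      then show "lc.ranked_elementary_sub {h \<in> ?K. ret (insert j S) h = h}"
        using ranked_elementary_level[OF assms(1)] by simp
      have "{h \<in> ?K. ret (insert j S) h = id} \<subseteq> V"
      proof
        fix h assume h: "h \<in> {h \<in> ?K. ret (insert j S) h = id}"
        then have "sing (ret (insert j S) h) = {}" by simp
        then show "h \<in> V" using h J by (auto simp: sing_ret V_def levels_in_def)
      qed
      then show "lc.ranked_elementary_sub {h \<in> ?K. ret (insert j S) h = id}"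
        by (intro lc.ranked_elementary_sub_closed[OF ranked_elementary_V closed_V_sub]
            closed_kernel_ret K S)
    qed
  qed
qed

theorem ranked_elementary_L:
  assumes "\<And>j. ranked_elementary (pg (Gs j)) (ptop (Gs j) (Us j))"
  shows "ranked_elementary (pg L) (ptop L V)"
proof -
  let ?W = "\<lambda>n :: nat. levels_in {- int n..int n}"
  have "lc.ranked_elementary_sub L"
  proof (rule lc.ranked_elementary_sub_union[OF lc.closed_perm_subgroup_self])
    show "incseq ?W" by (fastforce simp: incseq_def levels_in_def)
    show "(\<Union>n. ?W n) = L"
    proof
      show "L \<subseteq> (\<Union>n. ?W n)"
      proof
        fix g assume g: "g \<in> L"
        then have "finite ((\<lambda>(i, k). nat \<bar>i\<bar>) ` sing g)" using LD(3) by blast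
        then obtain n where n: "(\<lambda>(i, k). nat \<bar>i\<bar>) ` sing g \<subseteq> {..n}"
          using finite_nat_iff_bounded_le by blast
        have "g \<in> ?W n" using g n by (fastforce simp: levels_in_def)
        then show "g \<in> (\<Union>n. ?W n)" by blast
      qed
    qed (use levels_in_L in blast)
    show "perm_group (?W n)" for n by (rule perm_group_levels_in)
    show "V \<inter> L \<subseteq> ?W n" for n using V_levels_in by blast
    show "lc.ranked_elementary_sub (?W n)" for n
      by (rule ranked_elementary_levels_in[OF assms]) simp
  qed
  moreover have "V \<inter> L = V" using VD(1) by blast
  ultimately show ?thesis by (simp add: lc.ranked_elementary_sub_def)
qed

end

section \<open>Affine permutations\<close>

definition affine_perms :: "(int \<Rightarrow> int) set"
  where "affine_perms = {\<pi>. bij \<pi> \<and> (\<forall>i. \<pi> (i + 3) = \<pi> i + 3)}"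

text \<open>The simple reflections of the affine symmetric group on three letters.\<close>

definition swp :: "int \<Rightarrow> int \<Rightarrow> int"
  where "swp r i = (if i mod 3 = r then i + 1 else if i mod 3 = (r + 1) mod 3 then i - 1 else i)"

lemma mod3_cases:
  fixes i :: int
  obtains q where "i = 3 * q" | q where "i = 3 * q + 1" | q where "i = 3 * q + 2"
proof -
  have "i = 3 * (i div 3) + i mod 3" by simp
  moreover have "i mod 3 = 0 \<or> i mod 3 = 1 \<or> i mod 3 = 2" by presburger
  ultimately show ?thesis using that by (metis add.right_neutral)
qed

lemma swp_values:
  "swp 0 (3 * q) = 3 * q + 1" "swp 0 (3 * q + 1) = 3 * q" "swp 0 (3 * q + 2) = 3 * q + 2"
  "swp 1 (3 * q) = 3 * q" "swp 1 (3 * q + 1) = 3 * q + 2" "swp 1 (3 * q + 2) = 3 * q + 1"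
  "swp 2 (3 * q) = 3 * q - 1" "swp 2 (3 * q + 1) = 3 * q + 1" "swp 2 (3 * q + 2) = 3 * q + 3"
  "swp 2 (3 * q + 3) = 3 * q + 2" "swp 1 (3 * q - 1) = 3 * q - 2" "swp 1 (3 * q + 3) = 3 * q + 3"
  "swp 2 (3 * q - 1) = 3 * q" "swp 1 (3 * q - 2) = 3 * q - 1" "swp 2 (3 * q - 2) = 3 * q - 2"
proof -
  have "(3 * q) mod 3 = 0" "(3 * q + 1) mod 3 = 1" "(3 * q + 2) mod 3 = 2" "(3 * q + 3) mod 3 = 0"
    "(3 * q - 1) mod 3 = 2" "(3 * q - 2) mod 3 = 1" for q :: int
    by presburger+
  then show "swp 0 (3 * q) = 3 * q + 1" "swp 0 (3 * q + 1) = 3 * q" "swp 0 (3 * q + 2) = 3 * q + 2"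
    "swp 1 (3 * q) = 3 * q" "swp 1 (3 * q + 1) = 3 * q + 2" "swp 1 (3 * q + 2) = 3 * q + 1"
    "swp 2 (3 * q) = 3 * q - 1" "swp 2 (3 * q + 1) = 3 * q + 1" "swp 2 (3 * q + 2) = 3 * q + 3"
    "swp 2 (3 * q + 3) = 3 * q + 2" "swp 1 (3 * q - 1) = 3 * q - 2" "swp 1 (3 * q + 3) = 3 * q + 3"
    "swp 2 (3 * q - 1) = 3 * q" "swp 1 (3 * q - 2) = 3 * q - 1" "swp 2 (3 * q - 2) = 3 * q - 2"
    by (simp_all add: swp_def)
qed

lemma swp_involution:
  assumes "r \<in> {0, 1, 2}"
  shows "swp r \<circ> swp r = id"
proof
  fix i
  show "(swp r \<circ> swp r) i = id i"
    by (cases i rule: mod3_cases) (use assms in \<open>auto simp: swp_values\<close>)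
qed

text \<open>The braid relations, written as a double conjugation that turns \<open>swp 1\<close>
  into \<open>swp 0\<close> or \<open>swp 2\<close>: a normal subgroup containing
  \<open>swp 1\<close> contains all simple reflections.\<close>

lemma swp_braid: "swp 1 \<circ> (swp 0 \<circ> swp 1 \<circ> swp 0) \<circ> swp 1 = swp 0"
  "swp 1 \<circ> (swp 2 \<circ> swp 1 \<circ> swp 2) \<circ> swp 1 = swp 2"
proof (rule_tac [!] ext)
  fix i
  show "(swp 1 \<circ> (swp 0 \<circ> swp 1 \<circ> swp 0) \<circ> swp 1) i = swp 0 i"
    by (cases i rule: mod3_cases) (simp_all add: swp_values)
  show "(swp 1 \<circ> (swp 2 \<circ> swp 1 \<circ> swp 2) \<circ> swp 1) i = swp 2 i"
    by (cases i rule: mod3_cases) (simp_all add: swp_values)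
qed

lemma bij_swp: "r \<in> {0, 1, 2} \<Longrightarrow> bij (swp r)"
  using swp_involution o_bij by blast

lemma pinv_swp: "r \<in> {0, 1, 2} \<Longrightarrow> pinv (swp r) = swp r"
  using inv_unique_comp[OF swp_involution swp_involution] .

lemma swp_affine: "r \<in> {0, 1, 2} \<Longrightarrow> swp r \<in> affine_perms"
  using bij_swp by (simp add: affine_perms_def swp_def)

lemma affine_shift:
  assumes "\<pi> \<in> affine_perms"
  shows "\<pi> (i + 3 * n) = \<pi> i + 3 * n"
proof (induction n rule: int_induct[where k = 0])
  case (step1 n)
  have "\<pi> ((i + 3 * n) + 3) = \<pi> (i + 3 * n) + 3" using assms by (simp add: affine_perms_def)
  then show ?case using step1 by (simp add: algebra_simps)
next
  case (step2 n)
  have "\<pi> ((i + 3 * (n - 1)) + 3) = \<pi> (i + 3 * (n - 1)) + 3"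
    using assms unfolding affine_perms_def by blast
  moreover have "(i + 3 * (n - 1)) + 3 = i + 3 * n" by simp
  ultimately have "\<pi> (i + 3 * n) = \<pi> (i + 3 * (n - 1)) + 3" by metis
  then show ?case using step2 by simp
qed simp

lemma perm_group_affine: "perm_group affine_perms"
  unfolding perm_group_def
proof (intro conjI ballI)
  show "id \<in> affine_perms" by (simp add: affine_perms_def)
  fix \<pi> assume \<pi>: "\<pi> \<in> affine_perms"
  then show b: "bij \<pi>" by (simp add: affine_perms_def)
  have "pinv \<pi> (i + 3) = pinv \<pi> i + 3" for i
  proof -
    have "\<pi> (pinv \<pi> i + 3) = \<pi> (pinv \<pi> i) + 3" using \<pi> by (simp add: affine_perms_def)
    also have "\<dots> = i + 3" using b by simp
    finally have "pinv \<pi> (\<pi> (pinv \<pi> i + 3)) = pinv \<pi> (i + 3)" by simp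
    then show ?thesis using b by simp
  qed
  then show "pinv \<pi> \<in> affine_perms" using b by (simp add: affine_perms_def)
  fix \<rho> assume "\<rho> \<in> affine_perms"
  then show "\<pi> \<circ> \<rho> \<in> affine_perms" using \<pi> by (simp add: affine_perms_def bij_comp)
qed

lemmas affine_perms = perm_groupD[OF perm_group_affine]

lemma affine_eqI:
  assumes "\<pi> \<in> affine_perms" "\<rho> \<in> affine_perms" "\<pi> 0 = \<rho> 0" "\<pi> 1 = \<rho> 1" "\<pi> 2 = \<rho> 2"
  shows "\<pi> = \<rho>"
proof
  fix i
  show "\<pi> i = \<rho> i"
    by (cases i rule: mod3_cases)
      (use affine_shift[OF assms(1), of 0] affine_shift[OF assms(2), of 0]
        affine_shift[OF assms(1), of 1] affine_shift[OF assms(2), of 1]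
        affine_shift[OF assms(1), of 2] affine_shift[OF assms(2), of 2] assms(3-5)
       in \<open>simp_all add: add.commute\<close>)
qed

lemma countable_affine: "countable affine_perms"
proof -
  have "inj_on (\<lambda>\<pi> :: int \<Rightarrow> int. (\<pi> 0, \<pi> 1, \<pi> 2)) affine_perms"
    using affine_eqI by (auto intro!: inj_onI)
  then show ?thesis by (rule countableI')
qed

text \<open>Three incomparable copies of the ordered integers, one per residue class. Affine
  permutations preserve this order since they commute with adding 3.\<close>

definition lt3 :: "int \<Rightarrow> int \<Rightarrow> bool"
  where "lt3 i j \<longleftrightarrow> i < j \<and> 3 dvd j - i"

lemma lt3_affine_imp: "\<pi> \<in> affine_perms \<Longrightarrow> lt3 i j \<Longrightarrow> lt3 (\<pi> i) (\<pi> j)"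
proof -
  assume \<pi>: "\<pi> \<in> affine_perms" and "lt3 i j"
  then obtain n where "j - i = 3 * n" "i < j" by (auto simp: lt3_def)
  then have "j = i + 3 * n" "n > 0" by auto
  then show "lt3 (\<pi> i) (\<pi> j)" using affine_shift[OF \<pi>] by (simp add: lt3_def)
qed

lemma lt3_affine: "\<pi> \<in> affine_perms \<Longrightarrow> lt3 (\<pi> i) (\<pi> j) \<longleftrightarrow> lt3 i j"
  using lt3_affine_imp[of \<pi> i j] lt3_affine_imp[OF affine_perms(3), of \<pi> "\<pi> i" "\<pi> j"] affine_perms(2)[of \<pi>]
  by auto

lemma ptop_discrete:
  assumes "stab U E \<subseteq> {id}" "finite E"
  shows "ptop G U = discrete_topology G"
proof -
  have "openin (ptop G U) Y" if "Y \<subseteq> G" for Y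
    unfolding openin_ptop
  proof (intro conjI ballI that)
    fix g assume "g \<in> Y"
    then have "\<forall>u\<in>stab U E. g \<circ> u \<in> Y" using assms(1) by auto
    then show "\<exists>E. finite E \<and> (\<forall>u\<in>stab U E. g \<circ> u \<in> Y)" using assms(2) by blast
  qed
  moreover have "Y \<subseteq> G" if "openin (ptop G U) Y" for Y
    using that by (simp add: openin_ptop)
  ultimately show ?thesis by (auto simp: topology_eq)
qed

lemma perm_group_involution: "a \<circ> a = id \<Longrightarrow> perm_group {id, a}"
  using o_bij[of a a] inv_unique_comp[of a a] by (auto simp: perm_group_def inv_id)

section \<open>Permuting the levels\<close>

definition act :: "(int \<Rightarrow> int) \<Rightarrow> nat \<Rightarrow> nat"
  where "act \<pi> f = enc (\<lambda>i. co f (pinv \<pi> i))"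

lemma co_act [simp]: "bij \<pi> \<Longrightarrow> co (act \<pi> f) i = co f (pinv \<pi> i)"
proof -
  assume b: "bij \<pi>"
  have "{i. co f (pinv \<pi> i) \<noteq> 0} \<subseteq> \<pi> ` {i. co f i \<noteq> 0}"
    using b by (auto simp: image_iff intro!: exI[of _ "pinv \<pi> _"])
  then have "finite {i. co f (pinv \<pi> i) \<noteq> 0}"
    using finite_co by (rule finite_subset[OF _ finite_imageI])
  then show ?thesis by (simp add: act_def co_enc)
qed

lemma act_comp: "bij \<pi> \<Longrightarrow> bij \<rho> \<Longrightarrow> act (\<pi> \<circ> \<rho>) = act \<pi> \<circ> act \<rho>"
  by (rule ext, rule co_eqI) (simp add: bij_comp o_inv_distrib)

lemma act_id: "act id = id"
  by (rule ext, rule co_eqI) (simp add: inv_id)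

lemma act_pinv: "bij \<pi> \<Longrightarrow> act \<pi> \<circ> act (pinv \<pi>) = id" "bij \<pi> \<Longrightarrow> act (pinv \<pi>) \<circ> act \<pi> = id"
  by (simp_all add: act_comp[symmetric] act_id)

lemma bij_act: "bij \<pi> \<Longrightarrow> bij (act \<pi>)"
  using act_pinv by (rule o_bij[rotated])

lemma pinv_act: "bij \<pi> \<Longrightarrow> pinv (act \<pi>) = act (pinv \<pi>)"
  using inv_unique_comp[OF act_pinv] .

lemma act_upd: "bij \<pi> \<Longrightarrow> act \<pi> (upd f i x) = upd (act \<pi> f) (\<pi> i) x"
  by (rule co_eqI) (auto simp: fun_upd_def)

lemma act_zero: "bij \<pi> \<Longrightarrow> act \<pi> 0 = 0"
  by (rule co_eqI) simp

lemma act_cancel: "bij \<pi> \<Longrightarrow> act \<pi> (act (pinv \<pi>) f) = f" "bij \<pi> \<Longrightarrow> act (pinv \<pi>) (act \<pi> f) = f"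
  using act_pinv[of \<pi>] by (simp_all add: fun_eq_iff)

locale affine_wreath =
  fixes G U :: "(nat \<Rightarrow> nat) set"
  assumes lc_lamp: "lc_perm_group G U"
    and lamp_fix_zero: "u \<in> U \<Longrightarrow> u 0 = 0"

sublocale affine_wreath \<subseteq> wreath lt3 "\<lambda>_. G" "\<lambda>_. U"
  by unfold_locales
    (use lc_lamp lamp_fix_zero in \<open>auto simp: lt3_def lc_perm_group_def dest: dvd_add\<close>)

context affine_wreath
begin

lemma tr_act: "\<pi> \<in> affine_perms \<Longrightarrow> tr (\<pi> i) (act \<pi> f) = act \<pi> (tr i f)"
proof (rule co_eqI)
  fix j assume \<pi>: "\<pi> \<in> affine_perms"
  have "lt3 (\<pi> i) j \<longleftrightarrow> lt3 i (pinv \<pi> j)"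
    using lt3_affine[OF \<pi>, of i "pinv \<pi> j"] affine_perms(2)[OF \<pi>] by simp
  then show "co (tr (\<pi> i) (act \<pi> f)) j = co (act \<pi> (tr i f)) j"
    using affine_perms(2)[OF \<pi>] by simp
qed

lemma site_act: "\<pi> \<in> affine_perms \<Longrightarrow> k \<in> site i \<Longrightarrow> act \<pi> k \<in> site (\<pi> i)"
  using tr_act[of \<pi> i k] by (metis tr_id tr_site)

definition conj_act :: "(int \<Rightarrow> int) \<Rightarrow> (nat \<Rightarrow> nat) \<Rightarrow> nat \<Rightarrow> nat"
  where "conj_act \<pi> g = act \<pi> \<circ> g \<circ> act (pinv \<pi>)"

lemma loc_conj:
  assumes "\<pi> \<in> affine_perms"
  shows "loc (conj_act \<pi> g) i k = loc g (pinv \<pi> i) (act (pinv \<pi>) k)"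
  using affine_perms(2)[OF assms] by (simp add: loc_def conj_act_def act_upd fun_eq_iff)

lemma local_conj:
  assumes "\<pi> \<in> affine_perms" "local g"
  shows "local (conj_act \<pi> g)"
  unfolding local_def
proof (intro conjI allI ballI)
  note b = affine_perms(2)[OF assms(1)]
  fix i f
  have "co (conj_act \<pi> g f) i = loc g (pinv \<pi> i) (tr (pinv \<pi> i) (act (pinv \<pi>) f)) (co (act (pinv \<pi>) f) (pinv \<pi> i))"
    using localD(1)[OF assms(2)] b by (simp add: conj_act_def)
  then show "co (conj_act \<pi> g f) i = loc (conj_act \<pi> g) i (tr i f) (co f i)"
    using tr_act[OF affine_perms(3)[OF assms(1)], of i f] b by (simp add: loc_conj[OF assms(1)])
next
  fix i k assume "k \<in> site i"
  then show "loc (conj_act \<pi> g) i k \<in> G"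
    using site_act[OF affine_perms(3)[OF assms(1)]] localD(2)[OF assms(2)] by (simp add: loc_conj[OF assms(1)])
qed

lemma sing_conj:
  assumes "\<pi> \<in> affine_perms"
  shows "sing (conj_act \<pi> g) \<subseteq> (\<lambda>(i, k). (\<pi> i, act \<pi> k)) ` sing g"
proof
  note b = affine_perms(2)[OF assms]
  fix s assume "s \<in> sing (conj_act \<pi> g)"
  then obtain i k where s: "s = (i, k)" "k \<in> site i" "loc (conj_act \<pi> g) i k \<notin> U"
    by (auto simp: sing_def)
  then have "(pinv \<pi> i, act (pinv \<pi>) k) \<in> sing g"
    using site_act[OF affine_perms(3)[OF assms]] by (auto simp: sing_def loc_conj[OF assms])
  then show "s \<in> (\<lambda>(i, k). (\<pi> i, act \<pi> k)) ` sing g"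
    using b by (intro image_eqI[of _ _ "(pinv \<pi> i, act (pinv \<pi>) k)"]) (simp_all add: s act_cancel)
qed

lemma conj_L:
  assumes "\<pi> \<in> affine_perms" "g \<in> L"
  shows "conj_act \<pi> g \<in> L"
proof -
  have "bij (conj_act \<pi> g)"
    using LD(1)[OF assms(2)] affine_perms(2)[OF assms(1)] bij_act by (simp add: conj_act_def bij_comp)
  moreover have "finite (sing (conj_act \<pi> g))"
    using finite_subset[OF sing_conj[OF assms(1)]] LD(3)[OF assms(2)] by simp
  ultimately show ?thesis using local_conj[OF assms(1)] LD(2)[OF assms(2)] by (simp add: L_def)
qed

lemma conj_V: "\<pi> \<in> affine_perms \<Longrightarrow> v \<in> V \<Longrightarrow> conj_act \<pi> v \<in> V"
  using conj_L[of \<pi> v] sing_conj[of \<pi> v] by (simp add: V_def)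

lemma act_comp_conj:
  assumes "\<pi> \<in> affine_perms"
  shows "act \<pi> \<circ> g = conj_act \<pi> g \<circ> act \<pi>"
  using affine_perms(2)[OF assms] by (simp add: conj_act_def comp_assoc act_pinv)

text \<open>Test on the function with value 1 at m only. The permutation transports this value to
  the level \<open>\<pi> m\<close>, but a local map lets the value at m influence another level only
  if that level lies below m.\<close>

lemma act_in_L_decreasing:
  assumes "bij \<pi>" "act \<pi> \<in> L" "\<pi> m \<noteq> m"
  shows "\<pi> m < m"
proof (rule ccontr)
  assume "\<not> \<pi> m < m"
  then have nlt: "\<not> lt3 (\<pi> m) m" by (simp add: lt3_def)
  let ?f = "upd 0 m 1"
  have loc: "local (act \<pi>)" using LD(2)[OF assms(2)] .
  have "tr (\<pi> m) ?f = tr (\<pi> m) 0" using nlt by (simp add: tr_eq_iff)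
  then have "co (act \<pi> ?f) (\<pi> m) = co (act \<pi> 0) (\<pi> m)"
    using localD(1)[OF loc, of ?f "\<pi> m"] localD(1)[OF loc, of 0 "\<pi> m"] assms(3) by simp
  then show False using assms(1) by simp
qed

text \<open>A non-trivial permutation in \<open>L\<close> would lower some m, and its inverse would
  lower \<open>\<pi> m\<close>. Hence \<open>L\<close> meets the permutations of levels
  trivially.\<close>

lemma act_in_L:
  assumes "bij \<pi>" "act \<pi> \<in> L"
  shows "\<pi> = id"
proof (rule ccontr)
  assume "\<pi> \<noteq> id"
  then obtain m where m: "\<pi> m \<noteq> m" by (auto simp: fun_eq_iff)
  have "act (pinv \<pi>) \<in> L" using L(3)[OF assms(2)] pinv_act[OF assms(1)] by simp
  then have "pinv \<pi> (\<pi> m) < \<pi> m"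
    using act_in_L_decreasing[of "pinv \<pi>" "\<pi> m"] assms(1) m by simp
  moreover have "\<pi> m < m" using act_in_L_decreasing[OF assms m] .
  ultimately show False using assms(1) by simp
qed

text \<open>The semidirect product of \<open>L\<close> with the affine permutations of the
  levels.\<close>

definition LA :: "(nat \<Rightarrow> nat) set"
  where "LA = {g \<circ> act \<pi> | g \<pi>. g \<in> L \<and> \<pi> \<in> affine_perms}"

text \<open>
  The reflection is adjoined to \<open>V\<close> because the normal closure of \<open>V\<close> does not contain any
  nontrivial permutation of the levels.
\<close>

definition VF :: "(nat \<Rightarrow> nat) set"
  where "VF = {v \<circ> act \<pi> | v \<pi>. v \<in> V \<and> \<pi> \<in> {id, swp 1}}"

lemma perm_group_extend:
  assumes "perm_group H" "perm_group P" "P \<subseteq> affine_perms" "\<And>\<pi> h. \<pi> \<in> P \<Longrightarrow> h \<in> H \<Longrightarrow> conj_act \<pi> h \<in> H"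
  shows "perm_group {h \<circ> act \<pi> | h \<pi>. h \<in> H \<and> \<pi> \<in> P}" (is "perm_group ?K")
  unfolding perm_group_def
proof (intro conjI ballI)
  note H = perm_groupD[OF assms(1)] and P = perm_groupD[OF assms(2)]
  have "id \<circ> act id \<in> ?K" using H(1) P(1) by blast
  then show "id \<in> ?K" by (simp add: act_id)
  fix x assume "x \<in> ?K"
  then obtain g \<pi> where x: "x = g \<circ> act \<pi>" "g \<in> H" "\<pi> \<in> P" by blast
  have b: "bij g" "bij \<pi>" "bij (act \<pi>)" using x H(2) P(2) bij_act by auto
  show "bij x" using x(1) b bij_comp by blast
  have "pinv x = act (pinv \<pi>) \<circ> pinv g"
    using b by (simp add: x(1) o_inv_distrib pinv_act)
  also have "\<dots> = conj_act (pinv \<pi>) (pinv g) \<circ> act (pinv \<pi>)"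
    using act_comp_conj affine_perms(3) assms(3) x(3) by blast
  finally show "pinv x \<in> ?K" using assms(4) H(3) P(3) x by blast
  fix y assume "y \<in> ?K"
  then obtain h \<rho> where y: "y = h \<circ> act \<rho>" "h \<in> H" "\<rho> \<in> P" by blast
  have "act \<pi> \<circ> h = conj_act \<pi> h \<circ> act \<pi>" using act_comp_conj assms(3) x(3) by blast
  then have "act \<pi> (h z) = conj_act \<pi> h (act \<pi> z)" for z by (simp add: fun_eq_iff)
  then have "x \<circ> y = (g \<circ> conj_act \<pi> h) \<circ> act (\<pi> \<circ> \<rho>)"
    using act_comp[OF b(2) P(2)[OF y(3)]] by (simp add: x(1) y(1) fun_eq_iff)
  moreover have "g \<circ> conj_act \<pi> h \<in> H" "\<pi> \<circ> \<rho> \<in> P" using assms(4) H(4) P(4) x y by auto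
  ultimately show "x \<circ> y \<in> ?K" by blast
qed

lemma perm_group_LA: "perm_group LA"
  unfolding LA_def using perm_group_extend[OF perm_group_L perm_group_affine] conj_L by simp

lemmas LA = perm_groupD[OF perm_group_LA]

lemma swp1_affine: "{id, swp 1} \<subseteq> affine_perms"
  using swp_affine affine_perms(1) by simp

lemma perm_group_VF: "perm_group VF"
  unfolding VF_def
proof (rule perm_group_extend[OF perm_group_V _ swp1_affine])
  show "perm_group {id, swp 1}" using swp_involution by (intro perm_group_involution) simp
qed (use conj_V swp1_affine in blast)

lemmas VF = perm_groupD[OF perm_group_VF]

lemma L_LA: "L \<subseteq> LA"
proof
  fix g assume "g \<in> L"
  then have "g \<circ> act id \<in> LA" using affine_perms(1) unfolding LA_def by blast
  then show "g \<in> LA" by (simp add: act_id)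
qed

lemma act_LA: "\<pi> \<in> affine_perms \<Longrightarrow> act \<pi> \<in> LA"
proof -
  assume "\<pi> \<in> affine_perms"
  then have "id \<circ> act \<pi> \<in> LA" using L(1) unfolding LA_def by blast
  then show ?thesis by simp
qed

lemma V_VF: "V \<subseteq> VF"
proof
  fix v assume "v \<in> V"
  then have "v \<circ> act id \<in> VF" unfolding VF_def by blast
  then show "v \<in> VF" by (simp add: act_id)
qed

lemma VF_LA: "VF \<subseteq> LA"
  using swp1_affine VD(1) by (auto simp: VF_def LA_def)

lemma act_swp_VF: "act (swp 1) \<in> VF"
proof -
  have "id \<circ> act (swp 1) \<in> VF" using perm_groupD(1)[OF perm_group_V] unfolding VF_def by blast
  then show ?thesis by simp
qed

lemma VF_zero: "v \<in> VF \<Longrightarrow> v 0 = 0"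
  using V_zero bij_swp[of 1] by (auto simp: VF_def act_zero)

lemma decomposition_unique:
  assumes "g \<circ> act \<pi> = h \<circ> act \<rho>" "g \<in> L" "h \<in> L" "\<pi> \<in> affine_perms" "\<rho> \<in> affine_perms"
  shows "\<pi> = \<rho>" "g = h"
proof -
  have b: "bij \<pi>" "bij \<rho>" "bij h" using assms affine_perms(2) LD(1) by auto
  have "pinv h \<circ> g = act \<rho> \<circ> act (pinv \<pi>)"
  proof -
    have "pinv h \<circ> (g \<circ> act \<pi>) \<circ> act (pinv \<pi>) = pinv h \<circ> (h \<circ> act \<rho>) \<circ> act (pinv \<pi>)"
      by (simp add: assms(1))
    then show ?thesis using b act_cancel by (simp add: fun_eq_iff)
  qed
  then have "pinv h \<circ> g = act (\<rho> \<circ> pinv \<pi>)" using b by (simp add: act_comp)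
  moreover have "pinv h \<circ> g \<in> L" using L(4)[OF L(3)[OF assms(3)] assms(2)] .
  ultimately have "\<rho> \<circ> pinv \<pi> = id" using act_in_L b bij_comp by (metis bij_imp_bij_inv)
  then have "(\<rho> \<circ> pinv \<pi>) (\<pi> x) = \<pi> x" for x by simp
  then show "\<pi> = \<rho>" using b by (simp add: fun_eq_iff)
  then have "g (act \<rho> (act (pinv \<rho>) x)) = h (act \<rho> (act (pinv \<rho>) x))" for x
    using fun_cong[OF assms(1), of "act (pinv \<rho>) x"] by simp
  then show "g = h" using b act_cancel by (simp add: fun_eq_iff)
qed

text \<open>The test point has the single non-zero value 1, at level 1. The reflection transports it
  to level 2, and \<open>V\<close> cannot turn it into 0 there because \<open>U\<close> fixes 0. So
  \<open>V\<close> is open in \<open>VF\<close>.\<close>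

lemma VF_stab: "stab VF {upd 0 1 1} \<subseteq> V"
proof
  fix x assume x: "x \<in> stab VF {upd 0 1 1}"
  then obtain v \<pi> where v: "x = v \<circ> act \<pi>" "v \<in> V" "\<pi> \<in> {id, swp 1}" by (auto simp: stab_def VF_def)
  have "\<pi> \<noteq> swp 1"
  proof
    assume p: "\<pi> = swp 1"
    have s: "swp 1 2 = 1" "swp 1 1 = 2" by (simp_all add: swp_def)
    have "v (act (swp 1) (upd 0 1 1)) = upd 0 1 1" using x v p by (simp add: stab_def)
    then have "co (v (upd 0 2 1)) 2 = 0"
      using bij_swp[of 1] s by (simp add: act_upd act_zero)
    moreover obtain u where u: "u \<in> U" "co (v (upd 0 2 1)) 2 = u (co (upd 0 2 1) 2)"
      using V_co[OF v(2)] by blast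
    ultimately have "u 1 = u 0" using lamp_fix_zero by simp
    then show False using Us(2)[OF u(1)] by (metis bij_pinv_simps(2) zero_neq_one)
  qed
  then show "x \<in> V" using v by (simp add: act_id)
qed

lemma finite_VF_orbits: "finite ((\<lambda>v. v f) ` VF)"
proof -
  have "(\<lambda>v. v f) ` VF \<subseteq> (\<lambda>v. v (act id f)) ` V \<union> (\<lambda>v. v (act (swp 1) f)) ` V"
    by (auto simp: VF_def)
  then show ?thesis by (rule finite_subset) (simp add: finite_orbits_V)
qed

lemma closed_VF: "closed VF"
proof -
  have inv: "act (swp 1) (act (swp 1) f) = f" for f
    using act_comp[of "swp 1" "swp 1"] bij_swp[of 1] swp_involution[of 1] act_id
    by (simp add: fun_eq_iff)
  have "VF = V \<union> (\<lambda>g. g \<circ> act (swp 1)) -` V"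
  proof
    show "VF \<subseteq> V \<union> (\<lambda>g. g \<circ> act (swp 1)) -` V"
      using inv by (auto simp: VF_def act_id comp_def)
    show "V \<union> (\<lambda>g. g \<circ> act (swp 1)) -` V \<subseteq> VF"
    proof
      fix g assume "g \<in> V \<union> (\<lambda>g. g \<circ> act (swp 1)) -` V"
      moreover have "g \<in> VF" if "g \<circ> act (swp 1) \<in> V"
      proof -
        have "(g \<circ> act (swp 1)) \<circ> act (swp 1) \<in> VF" using that unfolding VF_def by blast
        moreover have "(g \<circ> act (swp 1)) \<circ> act (swp 1) = g" using inv by (simp add: fun_eq_iff)
        ultimately show ?thesis by simp
      qed
      ultimately show "g \<in> VF" using V_VF by blast
    qed
  qed
  moreover have "continuous_on UNIV (\<lambda>g :: nat \<Rightarrow> nat. g \<circ> act (swp 1))"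
    unfolding comp_def
    by (intro continuous_on_coordinatewise_then_product continuous_on_product_coordinates)
  then have "closed ((\<lambda>g. g \<circ> act (swp 1)) -` V)"
    using closed_V by (intro closed_vimage)
  ultimately show ?thesis using closed_Un[OF closed_V] by simp
qed

lemma conj_pinv_comp:
  assumes "\<pi> \<in> affine_perms" "bij g"
  shows "pinv (g \<circ> act \<pi>) \<circ> h \<circ> act \<pi> = conj_act (pinv \<pi>) (pinv g \<circ> h)"
  using assms affine_perms(2)[OF assms(1)] bij_act
  by (simp add: o_inv_distrib pinv_act conj_act_def comp_assoc)

lemma lc_LA: "lc_perm_group LA VF"
proof
  fix x assume "x \<in> LA"
  then obtain g \<pi> where x: "x = g \<circ> act \<pi>" "g \<in> L" "\<pi> \<in> affine_perms" by (auto simp: LA_def)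
  obtain E where E: "finite E" "\<forall>u\<in>stab V E. pinv g \<circ> u \<circ> g \<in> V"
    using commensurated_V[OF x(2)] by blast
  have "pinv x \<circ> u \<circ> x \<in> VF" if u: "u \<in> stab VF (insert (upd 0 1 1) E)" for u
  proof -
    have "u \<in> stab VF {upd 0 1 1}" using u by (simp add: stab_def)
    then have "u \<in> V" using VF_stab by blast
    then have "u \<in> stab V E" using u by (simp add: stab_def)
    then have "conj_act (pinv \<pi>) (pinv g \<circ> u \<circ> g) \<in> V"
      using E(2) conj_V[OF affine_perms(3)[OF x(3)]] by blast
    moreover have "pinv x \<circ> u \<circ> x = conj_act (pinv \<pi>) (pinv g \<circ> u \<circ> g)"
      using conj_pinv_comp[OF x(3) LD(1)[OF x(2)], of "u \<circ> g"] by (simp add: x(1) comp_assoc)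
    ultimately show ?thesis using V_VF by auto
  qed
  then show "\<exists>E. finite E \<and> (\<forall>u\<in>stab VF E. pinv x \<circ> u \<circ> x \<in> VF)"
    using E(1) by (intro exI[of _ "insert (upd 0 1 1) E"]) simp
next
  obtain c :: "(nat \<Rightarrow> nat) \<Rightarrow> nat" where c: "\<And>g h. g \<in> L \<Longrightarrow> h \<in> L \<Longrightarrow> c g = c h \<Longrightarrow> pinv g \<circ> h \<in> V"
    using countable_index_V by blast
  have "\<exists>z. \<forall>x\<in>LA. x = fst (z x) \<circ> act (snd (z x)) \<and> fst (z x) \<in> L \<and> snd (z x) \<in> affine_perms"
  proof (rule bchoice, rule ballI)
    fix x assume "x \<in> LA"
    then obtain g \<pi> where "x = g \<circ> act \<pi>" "g \<in> L" "\<pi> \<in> affine_perms" by (auto simp: LA_def)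
    then show "\<exists>y. x = fst y \<circ> act (snd y) \<and> fst y \<in> L \<and> snd y \<in> affine_perms"
      by (intro exI[of _ "(g, \<pi>)"]) simp
  qed
  then obtain z where z: "\<And>x. x \<in> LA \<Longrightarrow> x = fst (z x) \<circ> act (snd (z x))"
    "\<And>x. x \<in> LA \<Longrightarrow> fst (z x) \<in> L" "\<And>x. x \<in> LA \<Longrightarrow> snd (z x) \<in> affine_perms" by blast
  \<comment> \<open>An affine permutation is determined by its values at 0, 1 and 2, so these encode
    the second factor.\<close>
  define d where "d x = to_nat (c (fst (z x)), snd (z x) 0, snd (z x) 1, snd (z x) 2)" for x
  have "pinv x \<circ> y \<in> VF" if xy: "x \<in> LA" "y \<in> LA" "d x = d y" for x y
  proof -
    let ?g = "fst (z x)" and ?h = "fst (z y)" and ?\<pi> = "snd (z x)"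
    have eq: "c ?g = c ?h" "?\<pi> 0 = snd (z y) 0" "?\<pi> 1 = snd (z y) 1" "?\<pi> 2 = snd (z y) 2"
      using xy(3) by (auto simp: d_def)
    have "snd (z y) = ?\<pi>" using affine_eqI z(3)[OF xy(1)] z(3)[OF xy(2)] eq by metis
    then have y: "y = ?h \<circ> act ?\<pi>" using z(1)[OF xy(2)] by simp
    have "pinv x \<circ> y = pinv (?g \<circ> act ?\<pi>) \<circ> ?h \<circ> act ?\<pi>"
      using z(1)[OF xy(1)] y by (metis comp_assoc)
    also have "\<dots> = conj_act (pinv ?\<pi>) (pinv ?g \<circ> ?h)"
      using conj_pinv_comp z(3)[OF xy(1)] LD(1)[OF z(2)[OF xy(1)]] by blast
    also have "\<dots> \<in> V"
      using conj_V[OF affine_perms(3)[OF z(3)[OF xy(1)]]] c z(2) xy eq(1) by blast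
    finally show ?thesis using V_VF by blast
  qed
  then show "\<exists>c :: (nat \<Rightarrow> nat) \<Rightarrow> nat. \<forall>g\<in>LA. \<forall>h\<in>LA. c g = c h \<longrightarrow> pinv g \<circ> h \<in> VF" by blast
qed (use perm_group_LA perm_group_VF VF_LA closed_VF finite_VF_orbits in auto)

sublocale lcA: lc_perm_group LA VF
  by (rule lc_LA)

lemma VF_Int_L: "VF \<inter> L = V"
proof
  show "VF \<inter> L \<subseteq> V"
  proof
    fix x assume x: "x \<in> VF \<inter> L"
    then obtain v \<pi> where v: "x = v \<circ> act \<pi>" "v \<in> V" "\<pi> \<in> affine_perms"
      using swp1_affine by (auto simp: VF_def)
    have "v \<circ> act \<pi> = x \<circ> act id" using v(1) by (simp add: act_id)
    then have "v = x" using decomposition_unique(2) x v VD(1) affine_perms(1) by blast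
    then show "x \<in> V" using v(2) by simp
  qed
qed (use V_VF VD(1) in auto)

text \<open>\<open>LA\<close> is a split extension of \<open>L\<close> by the countable group of
  level permutations, which gets the discrete topology by taking the trivial group as its compact
  open subgroup.\<close>

theorem ranked_elementary_LA:
  assumes "ranked_elementary (pg G) (ptop G U)"
  shows "ranked_elementary (pg LA) (ptop LA VF)"
proof -
  let ?A = "act ` affine_perms"
  have "\<exists>p. \<forall>x\<in>LA. p x \<in> affine_perms \<and> (\<exists>g\<in>L. x = g \<circ> act (p x))"
    by (rule bchoice) (unfold LA_def, blast)
  then obtain p where p: "\<And>x. x \<in> LA \<Longrightarrow> p x \<in> affine_perms" "\<And>x. x \<in> LA \<Longrightarrow> \<exists>g\<in>L. x = g \<circ> act (p x)"
    by blast
  have p_eq: "p (g \<circ> act \<pi>) = \<pi>" if "g \<in> L" "\<pi> \<in> affine_perms" for g \<pi>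
  proof -
    have "g \<circ> act \<pi> \<in> LA" using that by (auto simp: LA_def)
    then show ?thesis using p decomposition_unique(1) that by metis
  qed
  have p_act: "p (act \<pi>) = \<pi>" if "\<pi> \<in> affine_perms" for \<pi>
    using p_eq[OF L(1) that] by simp
  have p_L: "p g = id" if "g \<in> L" for g
    using p_eq[OF that affine_perms(1)] by (simp add: act_id)
  have p_comp: "p (x \<circ> y) = p x \<circ> p y" if xy: "x \<in> LA" "y \<in> LA" for x y
  proof -
    obtain g h where gh: "g \<in> L" "x = g \<circ> act (p x)" "h \<in> L" "y = h \<circ> act (p y)"
      using p(2)[OF xy(1)] p(2)[OF xy(2)] by blast
    have "act (p x) (h z) = conj_act (p x) h (act (p x) z)" for z
      using act_comp_conj[OF p(1)[OF xy(1)], of h] by (simp add: fun_eq_iff)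
    then have "(g \<circ> act (p x)) \<circ> (h \<circ> act (p y)) = (g \<circ> conj_act (p x) h) \<circ> act (p x \<circ> p y)"
      using act_comp affine_perms(2) p(1) xy by (simp add: fun_eq_iff)
    then have "x \<circ> y = (g \<circ> conj_act (p x) h) \<circ> act (p x \<circ> p y)"
      using gh(2,4) by simp
    then show ?thesis
      using p_eq L(4)[OF gh(1) conj_L[OF p(1)[OF xy(1)] gh(3)]] affine_perms(4)[OF p(1)[OF xy(1)] p(1)[OF xy(2)]]
      by simp
  qed
  have A: "perm_group ?A"
  proof -
    have "act \<pi> \<circ> act \<rho> \<in> ?A" "pinv (act \<pi>) \<in> ?A" "bij (act \<pi>)" if "\<pi> \<in> affine_perms" "\<rho> \<in> affine_perms" for \<pi> \<rho>
      using that affine_perms act_comp[of \<pi> \<rho>] pinv_act[of \<pi>] bij_act by (metis image_eqI)+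
    moreover have "id \<in> ?A" using act_id affine_perms(1) by (metis image_eqI)
    ultimately show ?thesis unfolding perm_group_def by blast
  qed
  have "ptop ?A {id} = discrete_topology ?A"
    by (rule ptop_discrete[of _ "{}"]) (auto simp: stab_def)
  then have "ranked_elementary (pg ?A) (ptop ?A {id})"
    using ranked_elementary_discrete[OF group_pg[OF A]] countable_affine by simp
  then have "lcA.ranked_elementary_sub LA"
  proof (rule lcA.ranked_elementary_sub_extension[OF lcA.closed_perm_subgroup_self _ A,
        where \<phi> = "\<lambda>x. act (p x)" and \<psi> = "\<lambda>q. q"])
    show "{id} \<subseteq> ?A" using perm_groupD(1)[OF A] by simp
    show "act (p (x \<circ> y)) = act (p x) \<circ> act (p y)" if "x \<in> LA" "y \<in> LA" for x y
      using p_comp[OF that] act_comp affine_perms(2) p(1) that by simp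
    show "\<exists>F. finite F \<and> (\<forall>v\<in>stab (VF \<inter> LA) F. act (p v) \<in> stab {id} E)" for E
    proof (intro exI[of _ "{upd 0 1 1}"] conjI ballI)
      fix v assume "v \<in> stab (VF \<inter> LA) {upd 0 1 1}"
      then have "v \<in> V" using VF_stab by (auto simp: stab_def)
      then show "act (p v) \<in> stab {id} E" using p_L VD(1) act_id by (simp add: stab_def)
    qed simp
    show "\<exists>F. finite F \<and> (\<forall>v\<in>stab {id} F. v \<in> stab VF E)" for E
      using VF(1) by (intro exI[of _ "{}"]) (auto simp: stab_def)
    have "{h \<in> LA. act (p h) = id} = L"
    proof
      show "{h \<in> LA. act (p h) = id} \<subseteq> L"
      proof
        fix h assume h: "h \<in> {h \<in> LA. act (p h) = id}"
        then obtain g where "g \<in> L" "h = g \<circ> act (p h)" using p(2) by blast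
        then show "h \<in> L" using h by simp
      qed
      show "L \<subseteq> {h \<in> LA. act (p h) = id}"
        using subsetD[OF L_LA] p_L by (simp add: act_id subset_iff)
    qed
    then show "lcA.ranked_elementary_sub {h \<in> LA. act (p h) = id}"
      using ranked_elementary_L[OF assms] by (simp add: lcA.ranked_elementary_sub_def VF_Int_L)
  qed (use act_LA p p_act in auto)
  moreover have "VF \<inter> LA = VF" using VF_LA by blast
  ultimately show ?thesis by (simp add: lcA.ranked_elementary_sub_def)
qed

end

section \<open>Displacement of local subgroups\<close>

context wreath
begin

text \<open>The lamp c at the upper level j replaces the value 0 there by c 0, so conjugation by it
  moves the lamp u from the zero site of level i to the site with value c 0 at j. Infinitely many
  values c 0 give infinitely many places for u.\<close>

lemma single_conj:
  assumes "i \<sqsubset> j" "bij c"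
  shows "single j 0 c \<circ> single i 0 u \<circ> single j 0 (pinv c) = single i (upd 0 j (c 0)) u"
proof (rule ext, rule co_eqI)
  fix f l
  define f' where "f' = single j 0 (pinv c) f"
  have trj: "tr j f' = tr j f" by (simp add: f'_def tr_eq_iff co_single)
  have site: "tr i f' = 0 \<longleftrightarrow> tr i f = upd 0 j (c 0)"
  proof
    assume z: "tr i f' = 0"
    have co0: "co f' m = 0" if "i \<sqsubset> m" for m
      using that arg_cong[OF z, of "\<lambda>k. co k m"] by simp
    then have "tr j f' = tr j 0" using lt_trans[OF assms(1)] by (auto simp: tr_eq_iff)
    then have tj: "tr j f = 0" using trj by (simp add: tr_id[of 0] site_def)
    then have "pinv c (co f j) = 0" using co0[OF assms(1)] by (simp add: f'_def co_single)
    then have "co f j = c 0" using assms(2) by (metis bij_pinv_simps(1))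
    moreover have "co f m = 0" if "i \<sqsubset> m" "m \<noteq> j" for m
      using co0[OF that(1)] that(2) by (simp add: f'_def co_single)
    ultimately show "tr i f = upd 0 j (c 0)"
      using assms(1) by - (rule co_eqI, auto)
  next
    assume z: "tr i f = upd 0 j (c 0)"
    have cof: "co f m = (if m = j then c 0 else 0)" if "i \<sqsubset> m" for m
      using that arg_cong[OF z, of "\<lambda>k. co k m"] by (simp split: if_splits)
    have "co f m = 0" if "j \<sqsubset> m" for m
      using cof[OF lt_trans[OF assms(1) that]] lt_less[OF that] by simp
    then have "tr j f = tr j 0" by (simp add: tr_eq_iff)
    then have tj: "tr j f = 0" by (simp add: tr_id[of 0] site_def)
    have "co f' m = 0" if "i \<sqsubset> m" for m
      using cof[OF that] tj assms(2) by (cases "m = j") (simp_all add: f'_def co_single)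
    then show "tr i f' = 0" by - (rule co_eqI, simp)
  qed
  have ij: "i \<noteq> j" using assms(1) by auto
  have tri: "tr j (single i 0 u f') = tr j f'"
  proof -
    have "m \<noteq> i" if "j \<sqsubset> m" for m using lt_less[OF assms(1)] lt_less[OF that] by simp
    then show ?thesis by (auto simp: tr_eq_iff co_single)
  qed
  have "co ((single j 0 c \<circ> single i 0 u \<circ> single j 0 (pinv c)) f) l =
      co (single j 0 c (single i 0 u f')) l"
    by (simp add: f'_def)
  also have "\<dots> = co (single i (upd 0 j (c 0)) u f) l"
  proof (cases "l = j")
    case True
    then show ?thesis
      using ij assms(2) trj tri by (simp add: co_single f'_def)
  next
    case False
    have cf: "co f' m = co f m" if "m \<noteq> j" for m using that by (simp add: f'_def co_single)
    show ?thesis using False site ij cf by (simp add: co_single)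
  qed
  finally show "co ((single j 0 c \<circ> single i 0 u \<circ> single j 0 (pinv c)) f) l =
      co (single i (upd 0 j (c 0)) u f) l" .
qed

lemma single_zero_orbit: "single i 0 c 0 = upd 0 i (c 0)"
  by (rule co_eqI) (simp add: co_single tr_id[of 0] site_def)

text \<open>A point of E on the displaced site would have the value x at level j. For finite E
  almost every x is admissible, so displaced lamps enter any neighbourhood of the identity.\<close>

lemma single_displace:
  assumes "x \<notin> (\<lambda>f. co f j) ` E" "i \<sqsubset> j" "u \<in> Us i"
  shows "single i (upd 0 j x) u \<in> stab V E"
proof -
  have "single i (upd 0 j x) u f = f" if f: "f \<in> E" for f
  proof -
    have "tr i f \<noteq> upd 0 j x"
    proof
      assume "tr i f = upd 0 j x"
      from arg_cong[OF this, of "\<lambda>k. co k j"] have "co f j = x" using assms(2) by simp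
      then show False using assms(1) f by blast
    qed
    then show ?thesis by (simp add: single_def)
  qed
  then show ?thesis using single_in_V[OF assms(3)] by (simp add: stab_def)
qed

end

section \<open>The inductive step\<close>

lemma normal_vimage:
  assumes "group_hom G H h" "N \<lhd> H"
  shows "{x \<in> carrier G. h x \<in> N} \<lhd> G"
proof -
  interpret group_hom G H h by fact
  interpret N: normal N H by fact
  have "subgroup {x \<in> carrier G. h x \<in> N} G"
    by (rule G.subgroupI) (auto intro!: exI[of _ "\<one>\<^bsub>G\<^esub>"])
  then show ?thesis
    unfolding G.normal_inv_iff using N.inv_op_closed2 by simp
qed

text \<open>The invariant of the induction. Fixing 0 keeps the orbits of the next compact open
  subgroup finite, normal generation by U keeps copies of G inside residuals, and compact generation
  of G passes to the towers and to the next group.\<close>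

definition lamp_group :: "(nat \<Rightarrow> nat) set \<Rightarrow> (nat \<Rightarrow> nat) set \<Rightarrow> countable_ord \<Rightarrow> bool"
  where "lamp_group G U \<theta> \<longleftrightarrow> lc_perm_group G U \<and> (\<forall>u\<in>U. u 0 = 0) \<and>
    ranked_elementary (pg G) (ptop G U) \<and> compactly_generated (pg G) (ptop G U) \<and>
    (\<forall>N. N \<lhd> pg G \<longrightarrow> U \<subseteq> N \<longrightarrow> N = G) \<and> height_ge (pg G) (ptop G U) G \<theta>"

locale affine_step = affine_wreath +
  fixes Q \<theta>
  assumes lamp_elementary: "ranked_elementary (pg G) (ptop G U)"
    and Q: "compactin (ptop G U) Q" "generate (pg G) Q = G"
    and lamp_normal: "N \<lhd> pg G \<Longrightarrow> U \<subseteq> N \<Longrightarrow> N = G"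
    and lamp_height: "height_ge (pg G) (ptop G U) G \<theta>"
begin

definition S :: "(nat \<Rightarrow> nat) set"
  where "S = VF \<union> single 0 0 ` Q \<union> {act (swp 0), act (swp 2)}"

text \<open>All of \<open>LA\<close> would be too large: \<open>affine_perms\<close> contains the
  shift by 1, which is not a product of reflections, so \<open>VF\<close> does not generate
  \<open>LA\<close> as a normal subgroup. The subgroup chosen here contains \<open>VF\<close>, hence
  is open and closed in \<open>LA\<close>.\<close>

definition G' :: "(nat \<Rightarrow> nat) set"
  where "G' = generate (pg LA) S"

lemma Q_G: "Q \<subseteq> G"
proof -
  interpret lcG: lc_perm_group G U by (rule lc_lamp)
  show ?thesis using compactin_subset_topspace[OF Q(1)] by simp
qed

lemma group_LA: "group (pg LA)"
  by (rule group_pg[OF perm_group_LA])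

lemma group_G: "group (pg G)"
  using lc_lamp by (simp add: lc_perm_group_def group_pg)

lemma group_hom_single: "group_hom (pg G) (pg LA) (single i 0)"
  using group_G group_LA single_in_L L_LA single_comp
  by (auto simp: group_hom_def group_hom_axioms_def hom_def)

lemma S_LA: "S \<subseteq> LA"
  using VF_LA subsetD[OF L_LA single_in_L] subsetD[OF Q_G] act_LA swp_affine by (auto simp: S_def)

lemma subgroup_G': "subgroup G' (pg LA)"
  unfolding G'_def using group.generate_is_subgroup[OF group_LA] S_LA by simp

lemma G': "perm_group G'" "G' \<subseteq> LA" "VF \<subseteq> G'" "single 0 0 ` Q \<subseteq> G'"
    "act (swp 0) \<in> G'" "act (swp 1) \<in> G'" "act (swp 2) \<in> G'"
proof -
  show "perm_group G'" "G' \<subseteq> LA"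
    using subgroup_G' lcA.subgroup_iff by auto
  have "S \<subseteq> G'" unfolding G'_def by (auto intro: generate.incl)
  then show "VF \<subseteq> G'" "single 0 0 ` Q \<subseteq> G'" "act (swp 0) \<in> G'" "act (swp 2) \<in> G'"
    by (auto simp: S_def)
  then show "act (swp 1) \<in> G'" using act_swp_VF by blast
qed

lemmas G'_group = perm_groupD[OF G'(1)]

sublocale lc': lc_perm_group G' VF
  by (rule lcA.lc_perm_group_open_subgroup[OF G'(1,3,2)])

lemma generate_G': "Z \<subseteq> G' \<Longrightarrow> generate (pg G') Z = generate (pg LA) Z"
  using group.generate_consistent[OF group_LA _ subgroup_G'] by simp

lemma act_single:
  assumes "\<pi> \<in> affine_perms"
  shows "act \<pi> \<circ> single i 0 \<gamma> \<circ> act (pinv \<pi>) = single (\<pi> i) 0 \<gamma>"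
proof (rule ext, rule co_eqI)
  fix f j
  note b = affine_perms(2)[OF assms]
  have "tr (\<pi> i) f = act \<pi> (tr i (act (pinv \<pi>) f))"
    using tr_act[OF assms, of i "act (pinv \<pi>) f"] b by (simp add: act_cancel)
  then have "tr i (act (pinv \<pi>) f) = 0 \<longleftrightarrow> tr (\<pi> i) f = 0"
    using act_zero[OF b] b by (metis act_cancel(2) act_zero bij_imp_bij_inv)
  moreover have "pinv \<pi> j = i \<longleftrightarrow> j = \<pi> i" using b by auto
  ultimately show "co ((act \<pi> \<circ> single i 0 \<gamma> \<circ> act (pinv \<pi>)) f) j = co (single (\<pi> i) 0 \<gamma> f) j"
    using b by (auto simp: co_single)
qed

text \<open>The levels 3k lie in one residue class and increase with k, so the copy with index k
  sits above, and displaces, those with smaller index.\<close>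

definition \<epsilon> :: "nat \<Rightarrow> (nat \<Rightarrow> nat) \<Rightarrow> nat \<Rightarrow> nat"
  where "\<epsilon> k = single (3 * int k) 0"

lemma \<epsilon>_G': "\<gamma> \<in> G \<Longrightarrow> \<epsilon> k \<gamma> \<in> G'"
proof (induction k)
  case 0
  interpret group_hom "pg G" "pg LA" "single 0 0" by (rule group_hom_single)
  have "single 0 0 ` G = generate (pg LA) (single 0 0 ` Q)"
    using generate_img[of Q] Q_G Q(2) by simp
  also have "\<dots> \<subseteq> G'"
    using group.generate_subgroup_incl[OF group_LA G'(4) subgroup_G'] .
  finally show ?case using 0 by (auto simp: \<epsilon>_def)
next
  case (Suc k)
  \<comment> \<open>This product takes 3k through 3k + 1 and 3k + 2 to 3k + 3, so conjugation by it
    moves the copy with index k to the next one.\<close>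
  let ?t = "swp 2 \<circ> (swp 1 \<circ> swp 0)"
  have sw: "swp 0 \<in> affine_perms" "swp 1 \<in> affine_perms" "swp 2 \<in> affine_perms"
    using swp_affine by auto
  have t: "?t \<in> affine_perms" using affine_perms(4) sw by blast
  have bs: "bij (swp 0)" "bij (swp 1)" "bij (swp 2)" using bij_swp by auto
  have "act ?t = act (swp 2) \<circ> (act (swp 1) \<circ> act (swp 0))"
    using bs by (simp add: act_comp bij_comp)
  then have tG: "act ?t \<in> G'" using G'_group(4) G'(5-7) by metis
  then have "act (pinv ?t) \<in> G'" using G'_group(3) pinv_act affine_perms(2)[OF t] by metis
  moreover have "?t (3 * int k) = 3 * int (Suc k)"
    by (simp add: swp_values)
  ultimately show ?case
    using act_single[OF t, of "3 * int k" \<gamma>] G'_group(4) tG Suc by (metis \<epsilon>_def)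
qed

lemma \<epsilon>_hom: "\<epsilon> k \<in> hom (pg G) (pg G')"
  using \<epsilon>_G' by (auto simp: hom_def \<epsilon>_def single_comp)

lemma continuous_\<epsilon>: "continuous_map (ptop G U) (ptop G' VF) (\<epsilon> k)"
proof (rule continuous_map_ptop)
  show "perm_group G" "U \<subseteq> G" using lc_lamp by (simp_all add: lc_perm_group_def)
  fix E :: "nat set" assume "finite E"
  moreover have "\<epsilon> k v \<in> stab VF E" if "v \<in> stab U ((\<lambda>f. co f (3 * int k)) ` E)" for v
    using single_stab[OF that] V_VF by (auto simp: \<epsilon>_def stab_def)
  ultimately show "\<exists>F. finite F \<and> (\<forall>v\<in>stab U F. \<epsilon> k v \<in> stab VF E)" by blast
qed (use G' \<epsilon>_G' single_comp in \<open>auto simp: \<epsilon>_def\<close>)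

lemma elementary_G': "ranked_elementary (pg G') (ptop G' VF)"
proof -
  have "lcA.closed_perm_subgroup G'"
    using lcA.closed_perm_subgroup_open[OF lcA.closed_perm_subgroup_self G'(1,2)] G'(3) by blast
  moreover have "lcA.ranked_elementary_sub LA"
    using ranked_elementary_LA[OF lamp_elementary] VF_LA
    by (simp add: lcA.ranked_elementary_sub_def Int_absorb2)
  ultimately have "lcA.ranked_elementary_sub G'"
    using lcA.ranked_elementary_sub_closed lcA.closed_perm_subgroup_self G'(2) by blast
  then show ?thesis using G'(3) by (simp add: lcA.ranked_elementary_sub_def Int_absorb2)
qed

lemma compactly_generated_G': "compactly_generated (pg G') (ptop G' VF)"
  unfolding compactly_generated_def
proof (intro exI conjI)
  have "compactin (ptop G' VF) (single 0 0 ` Q)"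
    using image_compactin[OF Q(1) continuous_\<epsilon>[of 0]] by (simp add: \<epsilon>_def)
  moreover have "compactin (ptop G' VF) {act (swp 0), act (swp 2)}"
    using G'(5,7) by (intro finite_imp_compactin) auto
  ultimately show "compactin (ptop G' VF) S"
    unfolding S_def using lc'.compactin by (intro compactin_Un)
  have "S \<subseteq> G'" using G' by (auto simp: S_def)
  then show "generate (pg G') S = carrier (pg G')"
    using generate_G' by (simp add: G'_def)
qed

lemma normal_act:
  assumes "N \<lhd> pg G'" "act (swp 1) \<in> N" "r \<in> {0, 2}"
  shows "act (swp r) \<in> N"
proof -
  interpret N: normal N "pg G'" by fact
  have b: "bij (swp r)" "bij (swp 1)" using assms(3) bij_swp by auto
  have rG: "act (swp r) \<in> G'" using assms(3) G' by auto
  have inv: "pinv (act (swp r)) = act (swp r)" "pinv (act (swp 1)) = act (swp 1)"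
    using pinv_act[of "swp r"] pinv_act[of "swp 1"] b pinv_swp assms(3) by auto
  have "act (swp r) \<circ> act (swp 1) \<circ> act (swp r) \<in> N"
    using N.inv_op_closed2[of "act (swp r)" "act (swp 1)"] assms(2) rG inv(1) m_inv_pg[OF G'(1)] by simp
  then have "act (swp 1) \<circ> (act (swp r) \<circ> act (swp 1) \<circ> act (swp r)) \<circ> act (swp 1) \<in> N"
    using N.inv_op_closed2[of "act (swp 1)"] G'(6) inv(2) m_inv_pg[OF G'(1)] by simp
  moreover have "act (swp 1) \<circ> (act (swp r) \<circ> act (swp 1) \<circ> act (swp r)) \<circ> act (swp 1) =
      act (swp 1 \<circ> (swp r \<circ> swp 1 \<circ> swp r) \<circ> swp 1)"
    using b by (simp add: act_comp bij_comp)
  moreover have "swp 1 \<circ> (swp r \<circ> swp 1 \<circ> swp r) \<circ> swp 1 = swp r"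
    using swp_braid assms(3) by auto
  ultimately show ?thesis by simp
qed

text \<open>N contains the copy of U at level 0, hence that of G by \<open>lamp_normal\<close>, and
  it contains one reflection, hence all by the braid relations.\<close>

lemma normal_G':
  assumes "N \<lhd> pg G'" "VF \<subseteq> N"
  shows "N = G'"
proof -
  interpret N: normal N "pg G'" by fact
  have NG: "N \<subseteq> G'" using N.subset by simp
  have "group_hom (pg G) (pg G') (\<epsilon> 0)"
    using group_G group_pg[OF G'(1)] \<epsilon>_hom by (simp add: group_hom_def group_hom_axioms_def)
  from normal_vimage[OF this assms(1)] have "{x \<in> G. \<epsilon> 0 x \<in> N} \<lhd> pg G" by simp
  moreover have "U \<subseteq> {x \<in> G. \<epsilon> 0 x \<in> N}"
  proof
    fix u assume u: "u \<in> U"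
    have "\<epsilon> 0 u \<in> VF" using single_in_V[OF u] V_VF by (auto simp: \<epsilon>_def)
    then show "u \<in> {x \<in> G. \<epsilon> 0 x \<in> N}" using assms(2) Us_Gs[OF u] by blast
  qed
  ultimately have "{x \<in> G. \<epsilon> 0 x \<in> N} = G" by (rule lamp_normal)
  then have "single 0 0 ` Q \<subseteq> N" using Q_G by (auto simp: \<epsilon>_def)
  moreover have "act (swp 0) \<in> N" "act (swp 2) \<in> N"
    using normal_act[OF assms(1)] assms(2) act_swp_VF by auto
  ultimately have SN: "S \<subseteq> N" using assms(2) by (auto simp: S_def)
  have "subgroup N (pg LA)"
    using N.subgroup_axioms subgroup_pg_iff[OF G'(1)] lcA.subgroup_iff G'(2) by auto
  then have "G' \<subseteq> N"
    unfolding G'_def using group.generate_subgroup_incl[OF group_LA SN] by blast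
  then show ?thesis using NG by blast
qed

text \<open>An iterated wreath product that grows at the top: the copy of G at level 3k permutes the
  sites of the levels already used.\<close>

fun tower :: "nat \<Rightarrow> (nat \<Rightarrow> nat) set"
  where "tower 0 = {id}"
  | "tower (Suc k) = generate (pg G') (tower k \<union> \<epsilon> k ` G)"

text \<open>The set \<open>W\<close> for \<open>height_ge_generate\<close>: it normally generates
  the tower, and being made of single lamps from U it can be displaced into any neighbourhood of the
  identity.\<close>

definition lamps :: "nat \<Rightarrow> (nat \<Rightarrow> nat) set"
  where "lamps k = (\<Union>m<k. \<epsilon> m ` U)"

lemma subgroup_tower: "subgroup (tower k) (pg G')"
proof (induction k)
  case 0
  show ?case using group.triv_subgroup[OF group_pg[OF G'(1)]] by simp
next
  case (Suc k)
  then have "tower k \<union> \<epsilon> k ` G \<subseteq> carrier (pg G')"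
    using subgroup.subset \<epsilon>_G' by fastforce
  then show ?case using group.generate_is_subgroup[OF group_pg[OF G'(1)]] by simp
qed

lemma tower_Suc: "tower k \<subseteq> tower (Suc k)" "\<epsilon> k ` G \<subseteq> tower (Suc k)"
  by (auto intro: generate.incl)

lemma lamps_tower: "lamps k \<subseteq> tower k"
proof (induction k)
  case (Suc k)
  have "lamps (Suc k) = lamps k \<union> \<epsilon> k ` U" by (auto simp: lamps_def lessThan_Suc)
  moreover have "\<epsilon> k ` U \<subseteq> \<epsilon> k ` G" using Us_Gs by blast
  ultimately show ?case using Suc tower_Suc[of k] by blast
qed (simp add: lamps_def)

lemma compactly_generated_tower:
  "compactly_generated (pg G'\<lparr>carrier := tower k\<rparr>) (subtopology (ptop G' VF) (tower k))"
proof (induction k)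
  case 0
  have "compactin (subtopology (ptop G' VF) {id}) {id}"
    using G'_group(1) by (intro finite_imp_compactin) auto
  moreover have "generate (pg {id}) {id} = {id :: nat \<Rightarrow> nat}"
  proof -
    have "perm_group {id :: nat \<Rightarrow> nat}" by (simp add: perm_group_def inv_id)
    from group.generate_one[OF group_pg[OF this]] show ?thesis by simp
  qed
  ultimately show ?case
    unfolding compactly_generated_def by (intro exI[of _ "{id}"]) simp
next
  case (Suc k)
  interpret T: topological_group "pg G" "ptop G U"
    using lc_perm_group.topological_group[OF lc_lamp] .
  have "subtopology (ptop G U) G = ptop G U"
    using subtopology_topspace[of "ptop G U"] lc_perm_group.topspace[OF lc_lamp] by simp
  then have "compactly_generated (pg G\<lparr>carrier := G\<rparr>) (subtopology (ptop G U) G)"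
    using Q by (auto simp: compactly_generated_def)
  then show ?case
    unfolding tower.simps
    by (intro compactly_generated_generate[OF T.topological_group_axioms lc'.topological_group
          \<epsilon>_hom continuous_\<epsilon> subgroup_tower Suc])
      (use T.subgroup_self in simp_all)
qed

lemma normal_tower:
  "N \<lhd> pg G'\<lparr>carrier := tower k\<rparr> \<Longrightarrow> lamps k \<subseteq> N \<Longrightarrow> tower k \<subseteq> N"
proof (induction k arbitrary: N)
  case 0
  show ?case
    using subgroup.one_closed[OF normal_imp_subgroup[OF "0.prems"(1)]] by simp
next
  case (Suc k)
  interpret group "pg G'" by (rule group_pg[OF G'(1)])
  let ?K = "tower (Suc k)"
  interpret K: group "pg G'\<lparr>carrier := ?K\<rparr>" by (rule subgroup_imp_group[OF subgroup_tower])
  interpret N: normal N "pg G'\<lparr>carrier := ?K\<rparr>" by (rule Suc.prems(1))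
  have "lamps (Suc k) = lamps k \<union> \<epsilon> k ` U" by (auto simp: lamps_def lessThan_Suc)
  then have lam: "lamps k \<subseteq> N" "\<epsilon> k ` U \<subseteq> N" using Suc.prems(2) by auto
  have "N \<inter> tower k \<lhd> (pg G'\<lparr>carrier := ?K\<rparr>)\<lparr>carrier := tower k\<rparr>"
    using K.normal_Int_subgroup[OF subgroup_incl[OF subgroup_tower subgroup_tower tower_Suc(1)] Suc.prems(1)] .
  then have "tower k \<subseteq> N \<inter> tower k"
    using Suc.IH[of "N \<inter> tower k"] lam(1) lamps_tower[of k] by simp
  moreover have "\<epsilon> k ` G \<subseteq> N"
  proof -
    have "\<epsilon> k \<in> hom (pg G) (pg G'\<lparr>carrier := ?K\<rparr>)"
      using \<epsilon>_hom[of k] tower_Suc(2)[of k] by (auto simp: hom_def)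
    then have "group_hom (pg G) (pg G'\<lparr>carrier := ?K\<rparr>) (\<epsilon> k)"
      using group_G K.group_axioms by (simp add: group_hom_def group_hom_axioms_def)
    from normal_vimage[OF this Suc.prems(1)] have "{x \<in> G. \<epsilon> k x \<in> N} \<lhd> pg G" by simp
    moreover have "U \<subseteq> {x \<in> G. \<epsilon> k x \<in> N}" using lam(2) Us_Gs by blast
    ultimately have "{x \<in> G. \<epsilon> k x \<in> N} = G" by (rule lamp_normal)
    then show ?thesis by blast
  qed
  moreover have "subgroup N (pg G')"
    using N.subgroup_axioms incl_subgroup[OF subgroup_tower] by blast
  ultimately show ?case
    unfolding tower.simps by (intro generate_subgroup_incl) auto
qed

text \<open>\<open>height_ge_generate\<close>, with the tower as H and one more copy of G on top,
  adds \<theta> on the right, which is the successor rule of the ordinal product.\<close>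

lemma height_tower: "height_ge (pg G') (ptop G' VF) (tower k) (ord_mult \<theta> ((ord_succ ^^ k) 0))"
proof (induction k)
  case 0
  show ?case
    unfolding funpow.simps id_apply ord_mult_0
    by (rule height_geI[OF subgroup_tower]) (use zero_le_ord leD in blast)
next
  case (Suc k)
  interpret lcG: lc_perm_group G U by (rule lc_lamp)
  have "height_ge (pg G') (ptop G' VF) (generate (pg G') (tower k \<union> \<epsilon> k ` G))
      (ord_mult \<theta> ((ord_succ ^^ k) 0) + \<theta>)"
  proof (rule height_ge_generate[OF lcG.topological_group lc'.topological_group \<epsilon>_hom
        continuous_\<epsilon> subgroup_tower compactly_generated_tower lamps_tower normal_tower _ _ Suc lamp_height])
    fix C assume C: "subgroup C (pg G)" "infinite ((\<lambda>c. c 0) ` C)"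
    have CG: "C \<subseteq> G" using C(1) lcG.subgroup_iff by blast
    have "(\<lambda>c. \<epsilon> k c 0) ` C = (\<lambda>x. upd 0 (3 * int k) x) ` ((\<lambda>c. c 0) ` C)"
      by (auto simp: \<epsilon>_def single_zero_orbit)
    moreover have "inj (\<lambda>x. upd 0 (3 * int k) x)"
      by (rule injI) (metis co_upd fun_upd_same)
    ultimately show "infinite ((\<lambda>c. \<epsilon> k c 0) ` C)"
      using C(2) by (simp add: finite_image_iff inj_on_subset)
    fix Y assume Y: "openin (ptop G' VF) Y" "\<one>\<^bsub>pg G'\<^esub> \<in> Y"
    then have "\<exists>E. finite E \<and> (\<forall>u\<in>stab VF E. id \<circ> u \<in> Y)"
      unfolding openin_ptop by (metis pg_simps(3))
    then obtain E where E: "finite E" "stab VF E \<subseteq> Y" by auto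
    \<comment> \<open>Finitely many values occur at level 3k in E, but C moves 0 to infinitely many
      points. A c whose value at 0 is new moves all lamps below to sites that E does not
      meet.\<close>
    have "\<not> (\<lambda>c. c 0) ` C \<subseteq> (\<lambda>f. co f (3 * int k)) ` E"
      using C(2) E(1) finite_subset by blast
    then obtain c where c: "c \<in> C" "c 0 \<notin> (\<lambda>f. co f (3 * int k)) ` E" by blast
    have bc: "bij c" "c \<in> G" using c(1) CG Gs(2) by auto
    have "\<epsilon> k c \<circ> w \<circ> pinv (\<epsilon> k c) \<in> Y" if w: "w \<in> lamps k" for w
    proof -
      obtain m u where m: "m < k" "w = \<epsilon> m u" "u \<in> U" using w by (auto simp: lamps_def)
      have lt: "lt3 (3 * int m) (3 * int k)" using m(1) by (simp add: lt3_def)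
      have "\<epsilon> k c \<circ> w \<circ> pinv (\<epsilon> k c) = single (3 * int m) (upd 0 (3 * int k) (c 0)) u"
        using single_conj[OF lt bc(1)] pinv_single[OF bc(1)] by (simp add: m(2) \<epsilon>_def)
      then have "\<epsilon> k c \<circ> w \<circ> pinv (\<epsilon> k c) \<in> stab V E"
        using single_displace[OF c(2) lt m(3)] by simp
      then show ?thesis using E(2) V_VF by (auto simp: stab_def)
    qed
    then show "\<exists>c\<in>C. \<forall>w\<in>lamps k. \<epsilon> k c \<otimes>\<^bsub>pg G'\<^esub> w \<otimes>\<^bsub>pg G'\<^esub> inv\<^bsub>pg G'\<^esub> \<epsilon> k c \<in> Y"
      using m_inv_pg[OF G'(1) \<epsilon>_G'[OF bc(2)]] by (intro bexI[OF _ c(1)]) simp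
  qed
  then show ?case by (simp add: ord_mult_succ)
qed

text \<open>Height asks for a witness for each \<gamma> separately, so the bounds for the towers
  pass to their supremum although no single tower attains it.\<close>

lemma height_G': "height_ge (pg G') (ptop G' VF) G' (ord_mult \<theta> ord_omega)"
proof (rule height_geI)
  show "subgroup G' (pg G')" using G'(1) by (simp add: subgroup_pg_iff)
  fix \<gamma> assume "\<gamma> < ord_mult \<theta> ord_omega"
  then have "\<not> ord_mult \<theta> ord_omega \<le> \<gamma>" by simp
  then obtain c where c: "c < ord_omega" "\<not> ord_mult \<theta> c + \<theta> \<le> \<gamma>"
    unfolding ord_mult_le_iff[of \<theta> ord_omega] by blast
  obtain k where k: "c < (ord_succ ^^ k) 0"
    using c(1) unfolding ord_omega_def ord_less_SUP_iff by blast
  have "ord_mult \<theta> c + \<theta> \<le> ord_mult \<theta> ((ord_succ ^^ k) 0)"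
    using order_refl[of "ord_mult \<theta> ((ord_succ ^^ k) 0)"] k unfolding ord_mult_le_iff by blast
  then have "\<gamma> < ord_mult \<theta> ((ord_succ ^^ k) 0)" using c(2) by (metis not_le order_trans)
  then obtain C where C: "subgroup C (pg G')" "C \<subseteq> tower k"
    "compactly_generated (pg G'\<lparr>carrier := C\<rparr>) (subtopology (ptop G' VF) C)"
    "infinite ((\<lambda>c. c 0) ` C)" "height_ge (pg G') (ptop G' VF) (residual_in (pg G') (ptop G' VF) C) \<gamma>"
    by (rule height_geE[OF height_tower])
  then show "\<exists>C. subgroup C (pg G') \<and> C \<subseteq> G' \<and>
        compactly_generated (pg G'\<lparr>carrier := C\<rparr>) (subtopology (ptop G' VF) C) \<and>
        infinite ((\<lambda>c. c 0) ` C) \<and>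
        height_ge (pg G') (ptop G' VF) (residual_in (pg G') (ptop G' VF) C) \<gamma>"
    using subgroup.subset[OF C(1)] by auto
qed

end

theorem lamp_group_step:
  assumes "lamp_group G U \<theta>"
  shows "\<exists>G' U'. lamp_group G' U' (ord_mult \<theta> ord_omega)"
proof -
  obtain Q where Q: "compactin (ptop G U) Q" "generate (pg G) Q = G"
    using assms by (auto simp: lamp_group_def compactly_generated_def)
  interpret affine_step G U Q \<theta>
    by unfold_locales (use assms Q in \<open>auto simp: lamp_group_def lc_perm_group_def\<close>)
  have "lamp_group G' VF (ord_mult \<theta> ord_omega)"
    unfolding lamp_group_def
    using lc'.lc_perm_group_axioms VF_zero elementary_G' compactly_generated_G' normal_G' height_G'
    by blast
  then show ?thesis by blast
qed

section \<open>The base group\<close>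

definition on_nat :: "(int \<Rightarrow> int) \<Rightarrow> nat \<Rightarrow> nat"
  where "on_nat \<pi> = int_encode \<circ> \<pi> \<circ> int_decode"

lemma on_nat_comp: "on_nat (\<pi> \<circ> \<rho>) = on_nat \<pi> \<circ> on_nat \<rho>"
  by (simp add: on_nat_def fun_eq_iff)

lemma on_nat_id: "on_nat id = id"
  by (simp add: on_nat_def fun_eq_iff)

lemma on_nat_encode: "on_nat \<pi> (int_encode i) = int_encode (\<pi> i)"
  by (simp add: on_nat_def)

lemma on_nat_pinv:
  assumes "bij \<pi>"
  shows "bij (on_nat \<pi>)" "pinv (on_nat \<pi>) = on_nat (pinv \<pi>)"
proof -
  have "on_nat \<pi> \<circ> on_nat (pinv \<pi>) = id" "on_nat (pinv \<pi>) \<circ> on_nat \<pi> = id"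
    using assms by (simp_all add: on_nat_comp[symmetric] on_nat_id)
  then show "bij (on_nat \<pi>)" "pinv (on_nat \<pi>) = on_nat (pinv \<pi>)"
    using o_bij inv_unique_comp by blast+
qed

lemma int_encode_zero: "int_encode 0 = 0"
  by (simp add: int_encode_def sum_encode_def)

text \<open>The affine symmetric group itself. \<open>affine_perms\<close> is the extended group: it
  also contains the shift by 1, which is outside the normal closure of the reflections.\<close>

definition base :: "(nat \<Rightarrow> nat) set"
  where "base = generate (pg (on_nat ` affine_perms)) {on_nat (swp 0), on_nat (swp 1), on_nat (swp 2)}"

lemma perm_group_on_nat: "perm_group (on_nat ` affine_perms)"
proof -
  have "on_nat \<pi> \<circ> on_nat \<rho> \<in> on_nat ` affine_perms" "pinv (on_nat \<pi>) \<in> on_nat ` affine_perms"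
    "bij (on_nat \<pi>)" if "\<pi> \<in> affine_perms" "\<rho> \<in> affine_perms" for \<pi> \<rho>
    using that affine_perms on_nat_comp[of \<pi> \<rho>] on_nat_pinv[of \<pi>] by (metis image_eqI)+
  moreover have "id \<in> on_nat ` affine_perms" using on_nat_id affine_perms(1) by (metis image_eqI)
  ultimately show ?thesis unfolding perm_group_def by blast
qed

lemma base: "subgroup base (pg (on_nat ` affine_perms))" "perm_group base"
    "base \<subseteq> on_nat ` affine_perms" "r \<in> {0, 1, 2} \<Longrightarrow> on_nat (swp r) \<in> base"
proof -
  interpret group "pg (on_nat ` affine_perms)" by (rule group_pg[OF perm_group_on_nat])
  show "subgroup base (pg (on_nat ` affine_perms))"
    unfolding base_def using swp_affine by (intro generate_is_subgroup) auto
  then show "perm_group base" "base \<subseteq> on_nat ` affine_perms"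
    using subgroup_pg_iff[OF perm_group_on_nat] by auto
  show "on_nat (swp r) \<in> base" if "r \<in> {0, 1, 2}"
    unfolding base_def using that by (auto intro: generate.incl)
qed

text \<open>The topology is discrete, but the trivial subgroup would not generate
  \<open>base\<close> as a normal subgroup. Among the simple reflections \<open>swp 1\<close> is the
  one that fixes 0.\<close>

definition base_open :: "(nat \<Rightarrow> nat) set"
  where "base_open = {id, on_nat (swp 1)}"

lemma on_nat_swp_involution: "r \<in> {0, 1, 2} \<Longrightarrow> on_nat (swp r) \<circ> on_nat (swp r) = id"
  by (simp add: on_nat_comp[symmetric] swp_involution on_nat_id)

lemma stab_base_open: "stab base_open {int_encode 1} \<subseteq> {id}"
proof -
  have "swp 1 1 = 2" by (simp add: swp_def)
  then have "on_nat (swp 1) (int_encode 1) \<noteq> int_encode 1"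
    by (simp add: on_nat_encode int_encode_eq)
  then show ?thesis by (auto simp: stab_def base_open_def)
qed

lemma countable_base: "countable base"
  using countable_subset[OF base(3)] countable_affine by blast

lemma lc_base: "lc_perm_group base base_open"
proof
  show "perm_group base_open"
    unfolding base_open_def by (rule perm_group_involution, rule on_nat_swp_involution) simp
  show "base_open \<subseteq> base"
    using perm_groupD(1)[OF base(2)] base(4)[of 1] by (simp add: base_open_def)
  show "\<exists>E. finite E \<and> (\<forall>u\<in>stab base_open E. pinv g \<circ> u \<circ> g \<in> base_open)" if "g \<in> base" for g
  proof (intro exI[of _ "{int_encode 1}"] conjI ballI)
    fix u assume "u \<in> stab base_open {int_encode 1}"
    then have "u = id" using stab_base_open by blast
    then show "pinv g \<circ> u \<circ> g \<in> base_open"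
      using perm_groupD(2)[OF base(2) that] by (simp add: base_open_def)
  qed simp
  show "\<exists>c :: (nat \<Rightarrow> nat) \<Rightarrow> nat. \<forall>g\<in>base. \<forall>h\<in>base. c g = c h \<longrightarrow> pinv g \<circ> h \<in> base_open"
  proof (intro exI[of _ "to_nat_on base"] ballI impI)
    fix g h assume gh: "g \<in> base" "h \<in> base" "to_nat_on base g = to_nat_on base h"
    then have "g = h" using inj_on_to_nat_on[OF countable_base] by (simp add: inj_on_def)
    then show "pinv g \<circ> h \<in> base_open"
      using perm_groupD(2)[OF base(2) gh(1)] by (simp add: base_open_def)
  qed
  have "closed {k}" for k :: "nat \<Rightarrow> nat"
  proof -
    have "{k} = (\<Inter>x. (\<lambda>g. g x) -` {k x})" by auto
    moreover have "closed ((\<lambda>g :: nat \<Rightarrow> nat. g x) -` {k x})" for x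
      by (rule closed_vimage) (auto intro: continuous_on_product_coordinates)
    ultimately show ?thesis by (simp add: closed_INT)
  qed
  from closed_Un[OF this[of "on_nat (swp 1)"] this[of id]] show "closed base_open"
    by (simp add: base_open_def)
qed (use base(2) in \<open>auto simp: base_open_def\<close>)

lemma normal_base:
  assumes "N \<lhd> pg base" "base_open \<subseteq> N"
  shows "N = base"
proof -
  interpret N: normal N "pg base" by fact
  note inv = m_inv_pg[OF base(2)]
  have swp: "bij (swp r)" "pinv (on_nat (swp r)) = on_nat (swp r)" if "r \<in> {0, 1, 2}" for r
    using that bij_swp on_nat_pinv(2) pinv_swp by auto
  have one: "on_nat (swp 1) \<in> N" using assms(2) by (simp add: base_open_def)
  have "on_nat (swp r) \<in> N" if r: "r \<in> {0, 2}" for r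
  proof -
    have r': "r \<in> {0, 1, 2}" using r by auto
    have "on_nat (swp r) \<circ> on_nat (swp 1) \<circ> on_nat (swp r) \<in> N"
      using N.inv_op_closed2[OF _ one, of "on_nat (swp r)"] base(4)[OF r'] swp(2)[OF r']
        inv[OF base(4)[OF r']] by simp
    then have "on_nat (swp 1) \<circ> (on_nat (swp r) \<circ> on_nat (swp 1) \<circ> on_nat (swp r)) \<circ> on_nat (swp 1) \<in> N"
      using N.inv_op_closed2[of "on_nat (swp 1)"] base(4)[of 1] swp(2)[of 1] inv[OF base(4)[of 1]] by simp
    moreover have "on_nat (swp 1) \<circ> (on_nat (swp r) \<circ> on_nat (swp 1) \<circ> on_nat (swp r)) \<circ> on_nat (swp 1)
        = on_nat (swp r)"
      using swp_braid r by (auto simp: on_nat_comp[symmetric])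
    ultimately show ?thesis by simp
  qed
  then have gens: "{on_nat (swp 0), on_nat (swp 1), on_nat (swp 2)} \<subseteq> N" using one by simp
  have "subgroup N (pg (on_nat ` affine_perms))"
    using N.subgroup_axioms subgroup_pg_iff[OF base(2)] subgroup_pg_iff[OF perm_group_on_nat] base(3)
    by auto
  then have "base \<subseteq> N"
    unfolding base_def using group.generate_subgroup_incl[OF group_pg[OF perm_group_on_nat] gens] by blast
  then show ?thesis using N.subset by auto
qed

lemma base_orbit: "\<exists>g\<in>base. g 0 = int_encode (3 * int k)"
proof (induction k)
  case 0
  show ?case using perm_groupD(1)[OF base(2)] by (intro bexI[of _ id]) (simp_all add: int_encode_zero)
next
  case (Suc k)
  then obtain g where g: "g \<in> base" "g 0 = int_encode (3 * int k)" by blast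
  let ?t = "on_nat (swp 2) \<circ> (on_nat (swp 1) \<circ> (on_nat (swp 0) \<circ> g))"
  have "?t \<in> base" using perm_groupD(4)[OF base(2)] base(4) g(1) by simp
  moreover have "?t 0 = int_encode (3 * int (Suc k))"
    using g(2) by (simp add: on_nat_encode swp_values) (simp add: add.commute)
  ultimately show ?case by blast
qed

lemma lamp_group_base: "lamp_group base base_open 1"
proof -
  interpret lc_perm_group base base_open by (rule lc_base)
  interpret T: topological_group "pg base" "ptop base base_open" by (rule topological_group)
  have "swp 1 0 = 0" by (simp add: swp_def)
  then have "on_nat (swp 1) 0 = 0" using on_nat_encode[of "swp 1" 0] by (simp add: int_encode_zero)
  then have fix0: "\<forall>u\<in>base_open. u 0 = 0" by (simp add: base_open_def)
  have "ptop base base_open = discrete_topology base" by (rule ptop_discrete[OF stab_base_open]) simp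
  then have re: "ranked_elementary (pg base) (ptop base base_open)"
    using ranked_elementary_discrete[OF T.group_axioms] countable_base by simp
  let ?X = "{on_nat (swp 0), on_nat (swp 1), on_nat (swp 2)}"
  have sub: "?X \<subseteq> base" using base(4) by simp
  have "generate (pg base) ?X = base"
    using group.generate_consistent[OF group_pg[OF perm_group_on_nat] sub base(1)] by (simp add: base_def)
  moreover have "compactin (ptop base base_open) ?X"
    using sub by (intro finite_imp_compactin) auto
  ultimately have cg: "compactly_generated (pg base) (ptop base base_open)"
    unfolding compactly_generated_def by auto
  have "height_ge (pg base) (ptop base base_open) base 1"
  proof (rule height_geI)
    show self: "subgroup base (pg base)" using T.subgroup_self by simp
    \<comment> \<open>Height 1 concerns \<gamma> = 0 only, where nothing is asked of the residual.
      So an infinite orbit of 0 under the finitely generated group suffices, with the whole group as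
      C.\<close>
    fix \<gamma> :: countable_ord assume "\<gamma> < 1"
    then have "\<gamma> \<le> 0" by (simp add: one_countable_ord_def less_ord_succ_iff)
    then have "\<gamma> = 0" by (simp add: order_antisym)
    have "range (\<lambda>k. int_encode (3 * int k)) \<subseteq> (\<lambda>g. g 0) ` base"
      using base_orbit by (auto simp: image_iff) metis
    moreover have "inj (\<lambda>k. int_encode (3 * int k))" by (rule injI) (simp add: int_encode_eq)
    ultimately have "infinite ((\<lambda>g. g 0) ` base)"
      using finite_subset range_inj_infinite by blast
    moreover have "height_ge (pg base) (ptop base base_open)
        (residual_in (pg base) (ptop base base_open) base) \<gamma>"
      unfolding \<open>\<gamma> = 0\<close>
      by (rule height_geI[OF T.residual_in_subgroup[OF self]]) (use zero_le_ord leD in blast)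
    moreover have "subtopology (ptop base base_open) base = ptop base base_open"
      using subtopology_topspace[of "ptop base base_open"] by simp
    ultimately show "\<exists>C. subgroup C (pg base) \<and> C \<subseteq> base \<and>
        compactly_generated (pg base\<lparr>carrier := C\<rparr>) (subtopology (ptop base base_open) C) \<and>
        infinite ((\<lambda>c. c 0) ` C) \<and>
        height_ge (pg base) (ptop base base_open) (residual_in (pg base) (ptop base base_open) C) \<gamma>"
      using self cg by (intro exI[of _ base]) simp
  qed
  then show ?thesis
    unfolding lamp_group_def using lc_base fix0 re cg normal_base by blast
qed

lemma ex_lamp_group: "\<exists>G U. lamp_group G U (ord_power ord_omega ((ord_succ ^^ n) 0))"
proof (induction n)
  case 0
  then show ?case using lamp_group_base by (auto simp: ord_power_0)
next
  case (Suc n)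
  then show ?case using lamp_group_step by (auto simp: ord_power_succ ord_omega_limit(1))
qed

section \<open>The main theorem\<close>

lemma ord_power_omega_omega_le:
  assumes "\<And>n. ord_power ord_omega ((ord_succ ^^ n) 0) \<le> \<beta>"
  shows "ord_power ord_omega ord_omega \<le> \<beta>"
  unfolding ord_power_le_iff[of ord_omega ord_omega]
proof (intro conjI allI impI)
  show "1 \<le> \<beta>" using assms[of 0] by (simp add: ord_power_0)
  fix c assume "c < ord_omega"
  then obtain n where n: "c < (ord_succ ^^ n) 0"
    unfolding ord_omega_def ord_less_SUP_iff by blast
  have "ord_mult (ord_power ord_omega c) ord_omega = ord_power ord_omega (ord_succ c)"
    by (simp add: ord_power_succ ord_omega_limit(1))
  also have "\<dots> \<le> ord_power ord_omega ((ord_succ ^^ n) 0)"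
    using n by (intro ord_power_mono_right) (simp add: ord_succ_le_iff)
  finally show "ord_mult (ord_power ord_omega c) ord_omega \<le> \<beta>" using assms order_trans by blast
qed

lemma ex_elementary_rank_ge:
  "\<exists>G T \<alpha>. elementary G T \<and> has_decomposition_rank G T \<alpha> \<and> ord_power ord_omega ord_omega + 1 \<le> \<alpha>"
proof -
  obtain GG UU where lamp: "\<And>n. lamp_group (GG n) (UU n) (ord_power ord_omega ((ord_succ ^^ n) 0))"
    using ex_lamp_group by metis
  have lampD: "lc_perm_group (GG n) (UU n)" "u \<in> UU n \<Longrightarrow> u 0 = 0"
    "ranked_elementary (pg (GG n)) (ptop (GG n) (UU n))"
    "height_ge (pg (GG n)) (ptop (GG n) (UU n)) (GG n) (ord_power ord_omega ((ord_succ ^^ n) 0))" for n u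
    using lamp[of n] unfolding lamp_group_def by blast+
  \<comment> \<open>The order of the levels does not matter here.\<close>
  interpret wreath "(<)" "\<lambda>i. GG (nat i)" "\<lambda>i. UU (nat i)"
    by (rule wreath.intro) (use lampD in auto)
  have "ranked_elementary (pg L) (ptop L V)"
    by (rule ranked_elementary_L[OF lampD(3)])
  then obtain \<alpha> where \<alpha>: "elementary (pg L) (ptop L V)" "has_decomposition_rank (pg L) (ptop L V) \<alpha>"
    unfolding ranked_elementary_def ranked_def by blast
  have less: "ord_power ord_omega ((ord_succ ^^ n) 0) < \<alpha>" for n
  proof -
    interpret lcn: lc_perm_group "GG n" "UU n" by (rule lampD(1))
    interpret T: topological_group "pg (GG n)" "ptop (GG n) (UU n)" by (rule lcn.topological_group)
    let ?\<epsilon> = "single (int n) 0"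
    have sub: "subtopology (ptop (GG n) (UU n)) (GG n) = ptop (GG n) (UU n)"
      using subtopology_topspace[of "ptop (GG n) (UU n)"] by simp
    have \<epsilon>: "?\<epsilon> \<gamma> \<in> L" if "\<gamma> \<in> GG n" for \<gamma>
      using single_in_L[of \<gamma> "int n" 0] that by simp
    show ?thesis
    proof (rule height_less_decomposition_rank[OF \<alpha>(2) lampD(4) T.topological_group_axioms lc.topological_group,
          where \<phi> = ?\<epsilon>])
      show "?\<epsilon> \<in> hom (pg (GG n)\<lparr>carrier := GG n\<rparr>) (pg L)"
        using \<epsilon> by (auto simp: hom_def single_comp)
      show "inj_on ?\<epsilon> (GG n)"
        using loc_single[of 0 "int n" "int n" 0] by (intro inj_onI) (simp add: site_def, metis)
      have "continuous_map (ptop (GG n) (UU n)) (ptop L V) ?\<epsilon>"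
      proof (rule continuous_map_ptop)
        fix E :: "nat set" assume "finite E"
        then show "\<exists>F. finite F \<and> (\<forall>v\<in>stab (UU n) F. ?\<epsilon> v \<in> stab V E)"
          using single_stab[of _ "int n" E 0] by (intro exI[of _ "(\<lambda>f. co f (int n)) ` E"]) simp
      qed (use lcn.perm_group lc.perm_group \<epsilon> single_comp in auto)
      then show "continuous_map (subtopology (ptop (GG n) (UU n)) (GG n)) (ptop L V) ?\<epsilon>"
        by (simp add: sub)
    qed
  qed
  \<comment> \<open>Every rank is a successor, the trivial group having rank 0 + 1. So strict bounds
    below \<alpha> become bounds by \<beta>, their supremum is at most \<beta>, and the final + 1 is
    gained.\<close>
  obtain \<beta> where \<beta>: "\<alpha> = \<beta> + 1"
    using \<alpha>(2) ord_zero_add[of 1, symmetric]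
    by (cases rule: has_decomposition_rank.cases) blast+
  have "ord_power ord_omega ord_omega \<le> \<beta>"
    using less by (intro ord_power_omega_omega_le) (simp add: \<beta> ord_add_1 less_ord_succ_iff)
  then have "ord_power ord_omega ord_omega + 1 \<le> \<alpha>"
    by (simp add: \<beta> ord_add_1 ord_succ_le_iff less_ord_succ_iff)
  then show ?thesis using \<alpha> by blast
qed

theorem mainTheorem2:
  shows "(\<forall>\<alpha>. successor_ord \<alpha> \<and> \<alpha> < ord_power ord_omega ord_omega + 1 \<longrightarrow>
            (\<exists>G T. elementary G T \<and> decomposition_rank G T = \<alpha>)) \<and>
         (\<exists>G T. elementary G T \<and> decomposition_rank G T = ord_power ord_omega ord_omega + 1)"
proof -
  obtain G T \<alpha> where G: "elementary G T" "has_decomposition_rank G T \<alpha>"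
    "ord_power ord_omega ord_omega + 1 \<le> \<alpha>"
    using ex_elementary_rank_ge by blast
  have "\<exists>G T. elementary G T \<and> decomposition_rank G T = \<beta> + 1" if \<beta>: "\<beta> + 1 \<le> \<alpha>" for \<beta>
  proof -
    obtain H S where H: "elementary H S" "has_decomposition_rank H S (\<beta> + 1)"
      using elementary_successor_rank_below[OF G(1,2) \<beta>] by blast
    interpret tdlcsc_group H S using elementary_imp_tdlcsc_group[OF H(1)] .
    show ?thesis using H decomposition_rank_eqI[OF topological_group_axioms H(2)] by blast
  qed
  then show ?thesis
    using G(3) unfolding successor_ord_def by (metis less_imp_le order_trans)
qed

end
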